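(* Let $R$ be a commutative Noetherian ring of finite Krull dimension and let $M$ be a finitely generated $R$-module. Then the ordinal length of $M$ is $$\operatorname{len}(M)=\bigoplus_{\mathfrak p} e_{\mathfrak p}(M)\,\omega^{\dim(R/\mathfrak p)},$$ where $\mathfrak p$ runs over all prime ideals of $R$ (only the finitely many associated primes of $M$ contribute a non-zero term) and $\bigoplus$ denotes the natural (shuffle) sum of ordinals.
   Context: Ordinal length: for a Noetherian module $M$, define recursively for submodules $N\subseteq M$ the height rank $\mathfrak l(M)=0$ and $\mathfrak l(N)=\sup\{\mathfrak l(N')+1 : N\subsetneq N'\subseteq M\}$ (an ordinal). Then $\operatorname{len}(M):=\mathfrak l(0)$; equivalently, it is the supremum of the order types of chains of non-zero submodules of $M$, well-ordered by reverse inclusion. It agrees with the usual length when the latter is finite. For $n\in\mathbb N$ and an ordinal $\alpha$, $n\alpha$ denotes the sum of $n$ copies of $\alpha$. An ordinal $<\omega^\omega$ has a unique Cantor normal form $a_d\omega^d+\dots+a_1\omega+a_0$ with $a_i\in\mathbb N$; the shuffle sum $\oplus$ is coefficientwise addition of Cantor normal forms. Local multiplicity: for a prime $\mathfrak p$, $\operatorname{H}^0_{\mathfrak p}(M)$ denotes the submodule of $M_{\mathfrak p}$ of all elements killed by some power of $\mathfrak p$; it has finite length over $R_{\mathfrak p}$, and $e_{\mathfrak p}(M)\in\mathbb N$ denotes this length. It is non-zero if and only if $\mathfrak p\in\operatorname{Ass}(M)$. *)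

theory Defs
  imports "HOL-Algebra.Ring_Divisibility" "HOL-Algebra.Ideal_Product" "HOL-Library.Extended_Nat"
begin

unbundle cardinal_syntax

section \<open>Ordinals\<close>

text \<open>
  HOL has no type of all ordinals. The type \<open>'k ordinal\<close> consists of the order types of all
  well-orders living on (subsets of) \<open>'k + nat\<close>, that is, of all ordinals of cardinality at most
  \<open>max |'k| \<aleph>\<^sub>0\<close>. Every family of at most that many of its elements is bounded
  (\<open>small_imp_bounded\<close> below), so that all suprema taken in this file are genuine.
\<close>

quotient_type 'k ordinal = "('k + nat) rel" / partial: "\<lambda>r s. (r, s) \<in> ordIso"
proof (rule part_equivpI)
  have "({}, {}) \<in> (ordIso :: (('a + nat) rel \<times> ('a + nat) rel) set)"
    by (rule ordIso_reflexive) (simp add: well_order_on_empty)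
  then show "\<exists>x :: ('a + nat) rel. (x, x) \<in> ordIso" by blast
  show "symp (\<lambda>(r :: ('a + nat) rel) s. (r, s) \<in> ordIso)"
    by (rule sympI) (rule ordIso_symmetric)
  show "transp (\<lambda>(r :: ('a + nat) rel) s. (r, s) \<in> ordIso)"
    by (rule transpI) (rule ordIso_transitive)
qed

lemma Well_order_if_ordIso: "(r, s) \<in> ordIso \<Longrightarrow> Well_order r \<and> Well_order s"
  unfolding ordIso_def by blast

lemma ordinal_cases:
  obtains r where "Well_order r" "x = abs_ordinal r"
proof
  show "Well_order (rep_ordinal x)"
    using Quotient3_rep_reflp[OF Quotient3_ordinal] Well_order_if_ordIso by blast
  show "x = abs_ordinal (rep_ordinal x)"
    by (rule Quotient3_abs_rep[OF Quotient3_ordinal, symmetric])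
qed

instantiation ordinal :: (type) wellorder
begin

lift_definition less_eq_ordinal :: "'a ordinal \<Rightarrow> 'a ordinal \<Rightarrow> bool"
  is "\<lambda>r s. (r, s) \<in> ordLeq"
  by (meson ordIso_ordLeq_trans ordIso_symmetric ordLeq_ordIso_trans)

lift_definition less_ordinal :: "'a ordinal \<Rightarrow> 'a ordinal \<Rightarrow> bool"
  is "\<lambda>r s. (r, s) \<in> ordLess"
  by (meson ordIso_ordLess_trans ordIso_symmetric ordLess_ordIso_trans)

instance
proof
  fix x y z :: "'a ordinal"
  show "x < y \<longleftrightarrow> x \<le> y \<and> \<not> y \<le> x"
    by transfer (meson Well_order_if_ordIso not_ordLeq_iff_ordLess not_ordLess_ordLeq ordLess_imp_ordLeq)
  show "x \<le> x"
    by transfer (meson Well_order_if_ordIso ordLeq_reflexive)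
  show "x \<le> y \<Longrightarrow> y \<le> z \<Longrightarrow> x \<le> z"
    by transfer (rule ordLeq_transitive)
  show "x \<le> y \<Longrightarrow> y \<le> x \<Longrightarrow> x = y"
    by transfer (simp add: ordIso_iff_ordLeq)
  show "x \<le> y \<or> y \<le> x"
    by transfer (meson Well_order_if_ordIso ordLeq_total)
next
  fix P :: "'a ordinal \<Rightarrow> bool" and a
  assume step: "\<And>x. (\<And>y. y < x \<Longrightarrow> P y) \<Longrightarrow> P x"
  have "P (abs_ordinal r)" if "Well_order r" for r :: "('a + nat) rel"
    using that
  proof (induction r rule: wf_induct_rule[OF wf_ordLess])
    case (1 r)
    have rr: "(r, r) \<in> ordIso" using 1(2) by (rule ordIso_reflexive)
    show ?case
    proof (rule step)
      fix y assume y: "y < abs_ordinal r"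
      obtain s where s: "Well_order s" "y = abs_ordinal s" by (rule ordinal_cases)
      have "(s, r) \<in> ordLess"
        using y unfolding s(2) by (simp add: less_ordinal.abs_eq ordIso_reflexive s(1) rr)
      then show "P y" using 1(1) s by blast
    qed
  qed
  then show "P a"
    by (metis ordinal_cases)
qed

end

lemma abs_ordinal_less:
  "Well_order r \<Longrightarrow> Well_order s \<Longrightarrow> abs_ordinal r < abs_ordinal s \<longleftrightarrow> (r, s) \<in> ordLess"
  by (simp add: less_ordinal.abs_eq ordIso_reflexive)

lemma abs_ordinal_eq: "(r, s) \<in> ordIso \<Longrightarrow> abs_ordinal r = abs_ordinal s"
  by (rule Quotient3_rel_abs[OF Quotient3_ordinal])

lemma card_of_lessThan_ordinal:
  "|{..< x :: 'k ordinal}| \<le>o |UNIV :: ('k + nat) set|"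
proof -
  obtain r where r: "Well_order r" "x = abs_ordinal r" by (rule ordinal_cases)
  have "{..< x} \<subseteq> (\<lambda>a. abs_ordinal (Restr r (underS r a))) ` UNIV"
  proof
    fix y assume "y \<in> {..< x}"
    moreover obtain s where s: "Well_order s" "y = abs_ordinal s" by (rule ordinal_cases)
    ultimately have "(s, r) \<in> ordLess" using r by (simp add: abs_ordinal_less)
    then obtain a where "(s, Restr r (underS r a)) \<in> ordIso"
      using ordLess_iff_ordIso_Restr[OF r(1) s(1)] by blast
    then show "y \<in> (\<lambda>a. abs_ordinal (Restr r (underS r a))) ` UNIV"
      using s abs_ordinal_eq by blast
  qed
  then show ?thesis by (meson card_of_image card_of_mono1 ordLeq_transitive)
qed

lemma not_small_UNIV_ordinal:
  "\<not> |UNIV :: 'k ordinal set| \<le>o |UNIV :: ('k + nat) set|"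
proof
  assume "|UNIV :: 'k ordinal set| \<le>o |UNIV :: ('k + nat) set|"
  then obtain f :: "'k ordinal \<Rightarrow> 'k + nat" where f: "inj f"
    by (auto simp: card_of_ordLeq[symmetric])
  define q where "q = {(x, y :: 'k ordinal). x \<le> y}"
  define r where "r = dir_image q f"
  have fld: "Field q = UNIV" unfolding q_def Field_def by auto
  have "Well_order q"
    unfolding fld well_order_on_def linear_order_on_def partial_order_on_def preorder_on_def
  proof (intro conjI)
    show "refl q" "trans q" "antisym q" "total q" "q \<subseteq> UNIV \<times> UNIV"
      by (auto simp: q_def refl_on_def trans_def antisym_def total_on_def)
    have "q - Id = {(x, y). x < y}" by (auto simp: q_def)
    then show "wf (q - Id)" by (simp add: wf)
  qed
  then have r: "Well_order r"
    unfolding r_def using f by (metis Well_order_dir_image inj_on_subset subset_UNIV)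
  have r_iff: "(f x, f y) \<in> r \<longleftrightarrow> x \<le> y" for x y
    using f by (auto simp: r_def dir_image_def q_def inj_eq)
  have fr: "f x \<in> Field r" for x using r_iff[of x x] by (auto simp: Field_def)
  define g where "g x = abs_ordinal (Restr r (underS r (f x)))" for x
  have of: "wo_rel.ofilter r (underS r a)" for a
    using r by (simp add: wo_rel.underS_ofilter wo_rel_def)
  have wr: "Well_order (Restr r A)" for A using r by (rule Well_order_Restr)
  have g_less: "g x < abs_ordinal r" for x
    unfolding g_def using r wr fr underS_Restr_ordLess[OF r] by (auto simp: abs_ordinal_less)
  have mono: "g x < g y" if "x < y" for x y
  proof -
    have "underS r (f x) \<subset> underS r (f y)"
    proof
      have "(f x, f y) \<in> r" "f x \<noteq> f y" using that r_iff f by (auto simp: inj_eq)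
      then show "underS r (f x) \<subseteq> underS r (f y)"
        using r unfolding order_on_defs underS_def by (auto dest: transD antisymD)
      show "underS r (f x) \<noteq> underS r (f y)"
        using \<open>(f x, f y) \<in> r\<close> \<open>f x \<noteq> f y\<close> by (auto simp: underS_def)
    qed
    then show ?thesis
      unfolding g_def using ofilter_subset_ordLess[OF r of of] wr by (simp add: abs_ordinal_less)
  qed
  have "x \<le> g x" for x
  proof (induction x rule: less_induct)
    case (less x)
    show ?case
    proof (rule ccontr)
      assume "\<not> x \<le> g x"
      then have "g (g x) < g x" "g x \<le> g (g x)" using mono less by auto
      then show False by simp
    qed
  qed
  then show False using g_less[of "abs_ordinal r"] by (meson leD)
qed

lemma small_imp_bounded:
  fixes A :: "'k ordinal set"
  assumes "|A| \<le>o |UNIV :: ('k + nat) set|"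
  shows "\<exists>\<beta>. \<forall>\<alpha>\<in>A. \<alpha> < \<beta>"
proof (rule ccontr)
  assume "\<not> ?thesis"
  then have UN: "(\<Union>\<alpha>\<in>A. {..\<alpha>}) = UNIV" by (auto simp: not_less)
  have inf: "infinite (UNIV :: ('k + nat) set)" by simp
  have "|{..\<alpha>}| \<le>o |UNIV :: ('k + nat) set|" for \<alpha> :: "'k ordinal"
  proof -
    have "|{\<alpha>}| \<le>o |UNIV :: ('k + nat) set|" by (simp add: card_of_singl_ordLeq)
    moreover have "{..\<alpha>} = {..<\<alpha>} \<union> {\<alpha>}" by auto
    ultimately show ?thesis
      using card_of_Un_ordLeq_infinite_Field[OF _ card_of_lessThan_ordinal[of \<alpha>], of "{\<alpha>}"] inf
      by (metis Field_card_of card_of_Card_order)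
  qed
  then have "|\<Union>\<alpha>\<in>A. {..\<alpha>}| \<le>o |UNIV :: ('k + nat) set|"
    using card_of_UNION_ordLeq_infinite[OF inf assms] by blast
  then show False unfolding UN using not_small_UNIV_ordinal by (rule notE[rotated])
qed

definition osup :: "'k ordinal set \<Rightarrow> 'k ordinal" where
  "osup A = (LEAST \<beta>. \<forall>\<alpha>\<in>A. \<alpha> \<le> \<beta>)"

definition osucc :: "'k ordinal \<Rightarrow> 'k ordinal" where
  "osucc \<alpha> = (LEAST \<beta>. \<alpha> < \<beta>)"

lemma osucc_least: "\<alpha> < osucc \<alpha>" "\<alpha> < \<beta> \<Longrightarrow> osucc \<alpha> \<le> \<beta>"
proof -
  have "\<exists>\<beta>. \<forall>\<gamma>\<in>{\<alpha>}. \<gamma> < \<beta>"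
    by (rule small_imp_bounded) (simp add: card_of_singl_ordLeq)
  then show "\<alpha> < osucc \<alpha>" unfolding osucc_def by (auto intro: LeastI)
  show "\<alpha> < \<beta> \<Longrightarrow> osucc \<alpha> \<le> \<beta>" unfolding osucc_def by (rule Least_le)
qed

text \<open>Ordinal addition, by transfinite recursion on the right summand.\<close>

function oadd :: "'k ordinal \<Rightarrow> 'k ordinal \<Rightarrow> 'k ordinal" where
  "oadd \<alpha> \<beta> = osup (insert \<alpha> ((\<lambda>\<gamma>. osucc (oadd \<alpha> \<gamma>)) ` {..<\<beta>}))"
  by auto
termination
  by (relation "inv_image {(x, y). x < y} snd") (auto intro: wf)

declare oadd.simps [simp del]

instantiation ordinal :: (type) "{zero, one, plus}"
begin

definition zero_ordinal :: "'a ordinal" where "0 = osup {}"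
definition one_ordinal :: "'a ordinal" where "1 = osucc 0"
definition plus_ordinal :: "'a ordinal \<Rightarrow> 'a ordinal \<Rightarrow> 'a ordinal" where "\<alpha> + \<beta> = oadd \<alpha> \<beta>"

instance ..

end

primrec ncopies :: "nat \<Rightarrow> 'k ordinal \<Rightarrow> 'k ordinal" where
  "ncopies 0 \<alpha> = 0"
| "ncopies (Suc n) \<alpha> = ncopies n \<alpha> + \<alpha>"

primrec omega_pow :: "nat \<Rightarrow> 'k ordinal" where
  "omega_pow 0 = 1"
| "omega_pow (Suc n) = osup (range (\<lambda>k. ncopies k (omega_pow n)))"

subsection \<open>Cantor normal forms below \<open>\<omega>\<^sup>\<omega>\<close> and the shuffle sum\<close>

text \<open>\<open>cnf_eval a d\<close> is \<open>a\<^sub>d \<omega>\<^sup>d + \<dots> + a\<^sub>1 \<omega> + a\<^sub>0\<close>.\<close>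

primrec cnf_eval :: "(nat \<Rightarrow> nat) \<Rightarrow> nat \<Rightarrow> 'k ordinal" where
  "cnf_eval a 0 = ncopies (a 0) (omega_pow 0)"
| "cnf_eval a (Suc d) = ncopies (a (Suc d)) (omega_pow (Suc d)) + cnf_eval a d"

definition is_cnf :: "(nat \<Rightarrow> nat) \<Rightarrow> 'k ordinal \<Rightarrow> bool" where
  "is_cnf a \<alpha> \<longleftrightarrow> (\<exists>d. (\<forall>i>d. a i = 0) \<and> \<alpha> = cnf_eval a d)"

text \<open>Meaningful for \<open>\<alpha> < \<omega>\<^sup>\<omega>\<close> only.\<close>

definition cnf_coeff :: "'k ordinal \<Rightarrow> nat \<Rightarrow> nat" where
  "cnf_coeff \<alpha> = (THE a. is_cnf a \<alpha>)"

text \<open>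
  The shuffle sum of a family of ordinals below \<open>\<omega>\<^sup>\<omega>\<close> with only finitely many non-zero members.
\<close>

definition shuffle_sum :: "('i \<Rightarrow> 'k ordinal) \<Rightarrow> 'i set \<Rightarrow> 'k ordinal" where
  "shuffle_sum f I =
     (THE \<gamma>. is_cnf (\<lambda>n. \<Sum>i | i \<in> I \<and> f i \<noteq> 0. cnf_coeff (f i) n) \<gamma>)"


section \<open>Ordinal length of a module\<close>

definition supermodule_rel ::
  "('r, 'x) ring_scheme \<Rightarrow> ('r, 'm, 'y) module_scheme \<Rightarrow> ('m set \<times> 'm set) set" where
  "supermodule_rel R M = {(N', N). submodule N' R M \<and> submodule N R M \<and> N \<subset> N'}"

text \<open>
  The recursion is well-founded when \<open>M\<close> is Noetherian, see \<open>height_rank_unfold\<close>.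
\<close>

definition height_rank ::
  "('r, 'x) ring_scheme \<Rightarrow> ('r, 'm, 'y) module_scheme \<Rightarrow> 'm set \<Rightarrow> 'm set ordinal" where
  "height_rank R M = wfrec (supermodule_rel R M)
     (\<lambda>l N. osup {osucc (l N') | N'. (N', N) \<in> supermodule_rel R M})"

definition ordinal_length ::
  "('r, 'x) ring_scheme \<Rightarrow> ('r, 'm, 'y) module_scheme \<Rightarrow> 'm set ordinal" where
  "ordinal_length R M = height_rank R M {\<zero>\<^bsub>M\<^esub>}"

lemma height_rank_unfold:
  fixes M :: "('a, 'b, 'c) module_scheme"
  assumes "wf (supermodule_rel R M)" "submodule N R M"
  shows "height_rank R M N =
    osup {osucc (height_rank R M N') | N'. submodule N' R M \<and> N \<subset> N'}"
proof -
  let ?r = "supermodule_rel R M"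
  have r: "(N', N) \<in> ?r \<longleftrightarrow> submodule N' R M \<and> N \<subset> N'" for N'
    using assms(2) by (simp add: supermodule_rel_def)
  define F where "F = (\<lambda>(l :: _ \<Rightarrow> 'b set ordinal) N. osup {osucc (l N') | N'. (N', N) \<in> ?r})"
  have "height_rank R M = wfrec ?r F" unfolding height_rank_def F_def ..
  then have "height_rank R M N = F (cut (height_rank R M) ?r N) N"
    using wfrec[OF assms(1), of F N] by simp
  then have "height_rank R M N = osup {osucc (cut (height_rank R M) ?r N N') | N'. (N', N) \<in> ?r}"
    unfolding F_def .
  also have "{osucc (cut (height_rank R M) ?r N N') | N'. (N', N) \<in> ?r} =
      {osucc (height_rank R M N') | N'. (N', N) \<in> ?r}"
    by (rule Collect_cong) (metis cut_apply)
  finally show ?thesis unfolding r .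
qed


section \<open>Commutative algebra\<close>

definition fin_gen_module ::
  "('r, 'x) ring_scheme \<Rightarrow> ('r, 'm, 'y) module_scheme \<Rightarrow> bool" where
  "fin_gen_module R M \<longleftrightarrow>
     (\<exists>A \<subseteq> carrier M. finite A \<and> (\<forall>N. submodule N R M \<and> A \<subseteq> N \<longrightarrow> N = carrier M))"

definition Spec :: "('r, 'x) ring_scheme \<Rightarrow> 'r set set" where
  "Spec R = {\<pp>. primeideal \<pp> R}"

text \<open>The zero ring, which has no primes, gets dimension \<open>0\<close>.\<close>

definition krull_dim :: "('r, 'x) ring_scheme \<Rightarrow> enat" where
  "krull_dim R = Sup {enat n | n.
     \<exists>P. (\<forall>i\<le>n. P i \<in> Spec R) \<and> (\<forall>i<n. P i \<subset> P (Suc i))}"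

definition Ass :: "('r, 'x) ring_scheme \<Rightarrow> ('r, 'm, 'y) module_scheme \<Rightarrow> 'r set set" where
  "Ass R M = {\<pp> \<in> Spec R. \<exists>m \<in> carrier M. \<pp> = {a \<in> carrier R. a \<odot>\<^bsub>M\<^esub> m = \<zero>\<^bsub>M\<^esub>}}"

text \<open>The classical length of a module: the supremum of the lengths of chains of submodules.\<close>

definition module_length ::
  "('r, 'x) ring_scheme \<Rightarrow> ('r, 'm, 'y) module_scheme \<Rightarrow> enat" where
  "module_length R M = Sup {enat n | n.
     \<exists>N. (\<forall>i\<le>n. submodule (N i) R M) \<and> (\<forall>i<n. N i \<subset> N (Suc i))}"

primrec ideal_power :: "('r, 'x) ring_scheme \<Rightarrow> 'r set \<Rightarrow> nat \<Rightarrow> 'r set" where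
  "ideal_power R I 0 = carrier R"
| "ideal_power R I (Suc k) = ideal_prod R I (ideal_power R I k)"

subsection \<open>Localization at a multiplicative set \<open>S\<close>\<close>

definition ring_frac_rel ::
  "('r, 'x) ring_scheme \<Rightarrow> 'r set \<Rightarrow> (('r \<times> 'r) \<times> ('r \<times> 'r)) set" where
  "ring_frac_rel R S = {((a, s), (b, t)).
     a \<in> carrier R \<and> s \<in> S \<and> b \<in> carrier R \<and> t \<in> S \<and>
     (\<exists>u\<in>S. u \<otimes>\<^bsub>R\<^esub> (t \<otimes>\<^bsub>R\<^esub> a) = u \<otimes>\<^bsub>R\<^esub> (s \<otimes>\<^bsub>R\<^esub> b))}"

definition ring_frac :: "('r, 'x) ring_scheme \<Rightarrow> 'r set \<Rightarrow> 'r \<Rightarrow> 'r \<Rightarrow> ('r \<times> 'r) set" where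
  "ring_frac R S a s = ring_frac_rel R S `` {(a, s)}"

definition loc_ring :: "('r, 'x) ring_scheme \<Rightarrow> 'r set \<Rightarrow> ('r \<times> 'r) set ring" where
  "loc_ring R S =
    \<lparr> carrier = (carrier R \<times> S) // ring_frac_rel R S,
      mult = (\<lambda>x y. \<Union>(a, s)\<in>x. \<Union>(b, t)\<in>y. ring_frac R S (a \<otimes>\<^bsub>R\<^esub> b) (s \<otimes>\<^bsub>R\<^esub> t)),
      one = ring_frac R S \<one>\<^bsub>R\<^esub> \<one>\<^bsub>R\<^esub>,
      zero = ring_frac R S \<zero>\<^bsub>R\<^esub> \<one>\<^bsub>R\<^esub>,
      add = (\<lambda>x y. \<Union>(a, s)\<in>x. \<Union>(b, t)\<in>y.
        ring_frac R S (t \<otimes>\<^bsub>R\<^esub> a \<oplus>\<^bsub>R\<^esub> s \<otimes>\<^bsub>R\<^esub> b) (s \<otimes>\<^bsub>R\<^esub> t)) \<rparr>"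

definition module_frac_rel ::
  "('r, 'x) ring_scheme \<Rightarrow> 'r set \<Rightarrow> ('r, 'm, 'y) module_scheme \<Rightarrow>
     (('m \<times> 'r) \<times> ('m \<times> 'r)) set" where
  "module_frac_rel R S M = {((m, s), (n, t)).
     m \<in> carrier M \<and> s \<in> S \<and> n \<in> carrier M \<and> t \<in> S \<and>
     (\<exists>u\<in>S. u \<odot>\<^bsub>M\<^esub> (t \<odot>\<^bsub>M\<^esub> m) = u \<odot>\<^bsub>M\<^esub> (s \<odot>\<^bsub>M\<^esub> n))}"

definition module_frac ::
  "('r, 'x) ring_scheme \<Rightarrow> 'r set \<Rightarrow> ('r, 'm, 'y) module_scheme \<Rightarrow> 'm \<Rightarrow> 'r \<Rightarrow>
     ('m \<times> 'r) set" where
  "module_frac R S M m s = module_frac_rel R S M `` {(m, s)}"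

text \<open>
  The result is a module over \<^term>\<open>loc_ring R S\<close>. The fields \<open>mult\<close> and \<open>one\<close>, present in every
  module record, play no role.
\<close>

definition loc_module ::
  "('r, 'x) ring_scheme \<Rightarrow> 'r set \<Rightarrow> ('r, 'm, 'y) module_scheme \<Rightarrow>
     (('r \<times> 'r) set, ('m \<times> 'r) set) module" where
  "loc_module R S M =
    \<lparr> carrier = (carrier M \<times> S) // module_frac_rel R S M,
      mult = undefined,
      one = undefined,
      zero = module_frac R S M \<zero>\<^bsub>M\<^esub> \<one>\<^bsub>R\<^esub>,
      add = (\<lambda>x y. \<Union>(m, s)\<in>x. \<Union>(n, t)\<in>y.
        module_frac R S M (t \<odot>\<^bsub>M\<^esub> m \<oplus>\<^bsub>M\<^esub> s \<odot>\<^bsub>M\<^esub> n) (s \<otimes>\<^bsub>R\<^esub> t)),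
      smult = (\<lambda>x y. \<Union>(a, s)\<in>x. \<Union>(m, t)\<in>y.
        module_frac R S M (a \<odot>\<^bsub>M\<^esub> m) (s \<otimes>\<^bsub>R\<^esub> t)) \<rparr>"

subsection \<open>Local multiplicity\<close>

abbreviation ring_at :: "('r, 'x) ring_scheme \<Rightarrow> 'r set \<Rightarrow> ('r \<times> 'r) set ring" where
  "ring_at R \<pp> \<equiv> loc_ring R (carrier R - \<pp>)"

abbreviation module_at ::
  "('r, 'x) ring_scheme \<Rightarrow> ('r, 'm, 'y) module_scheme \<Rightarrow> 'r set \<Rightarrow>
     (('r \<times> 'r) set, ('m \<times> 'r) set) module" where
  "module_at R M \<pp> \<equiv> loc_module R (carrier R - \<pp>) M"

definition local_cohomology_0 ::
  "('r, 'x) ring_scheme \<Rightarrow> ('r, 'm, 'y) module_scheme \<Rightarrow> 'r set \<Rightarrow> ('m \<times> 'r) set set" where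
  "local_cohomology_0 R M \<pp> = {x \<in> carrier (module_at R M \<pp>).
     \<exists>k. \<forall>a \<in> ideal_power R \<pp> k.
       ring_frac R (carrier R - \<pp>) a \<one>\<^bsub>R\<^esub> \<odot>\<^bsub>module_at R M \<pp>\<^esub> x = \<zero>\<^bsub>module_at R M \<pp>\<^esub>}"

definition local_mult ::
  "('r, 'x) ring_scheme \<Rightarrow> ('r, 'm, 'y) module_scheme \<Rightarrow> 'r set \<Rightarrow> nat" where
  "local_mult R M \<pp> = the_enat (module_length (ring_at R \<pp>)
     (module_at R M \<pp> \<lparr>carrier := local_cohomology_0 R M \<pp>\<rparr>))"

end

theory Submission
  imports Defs
begin

text \<open>
  Everything is expressed through submodules \<open>N\<close> of the fixed module \<open>M\<close>, which stand for the
  quotients \<open>M/N\<close>. Write \<open>c\<^sub>i(N)\<close> for the sum of the multiplicities \<open>e\<^sub>\<pp>(M/N)\<close> over the primes with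
  \<open>dim R/\<pp> = i\<close>. By Noetherian induction the height rank of \<open>N\<close> is \<open>\<Sum>\<^sub>i c\<^sub>i(N) \<omega>\<^sup>i\<close>, for two reasons.

  If \<open>N \<subset> N'\<close> and \<open>d\<close> is the dimension of \<open>N'/N\<close>, then localizing at primes of coheight \<open>\<ge> d\<close> shows
  that \<open>c\<^sub>i\<close> is unchanged for \<open>i > d\<close> and that \<open>c\<^sub>d\<close> drops, so the normal form decreases.

  Conversely, if \<open>c\<^sub>i(N) > 0\<close>, then \<open>M/N\<close> contains an element \<open>y\<close> whose annihilator is a prime \<open>\<pp>\<close> of
  coheight \<open>i\<close>. If \<open>i > 0\<close>, choose a prime \<open>\<qq> \<supset> \<pp>\<close> of coheight \<open>i - 1\<close> and \<open>f \<in> \<qq> - \<pp>\<close>. Dividing out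
  \<open>R f\<^sup>n y\<close> lowers \<open>c\<^sub>i\<close> by one, keeps the higher coefficients, and makes \<open>c\<^bsub>i-1\<^esub>\<close> at least \<open>n\<close> because of
  the chain \<open>R f\<^sup>n y \<subset> \<dots> \<subset> R f y \<subset> R y\<close>. Hence every ordinal below \<open>\<Sum>\<^sub>i c\<^sub>i(N) \<omega>\<^sup>i\<close> is dominated by the
  rank of a larger submodule.
\<close>

section \<open>Ordinal arithmetic\<close>

text \<open>What shapes the proof is that enlarging N cannot be controlled in low dimensions:
  coefficients below c_d may rise arbitrarily. Normal forms tolerate this, since the highest
  differing coefficient decides a comparison. For the lower bound only c_(i-1) has to become large,
  because \<omega>^i is the supremum of the multiples of \<omega>^(i-1).

  Multiplicities are additive only under a condition: passing from N to N' leaves the preimage of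
  H^0 at \<pp> unchanged if N'/N vanishes at all primes properly below \<pp>. For primes of coheight
  at least dim N'/N this is automatic. Hence the ordering by coheight, and hence the description of
  H^0 by vanishing at smaller primes instead of by powers of \<pp>; the latter returns only in the
  comparison with \<open>local_mult\<close>.

  Lengths at \<pp> are counted by chains of submodules of M itself, so the induction forms neither
  quotients nor localizations.

  In the lower bound the coheight of \<qq> is exactly i - 1, which leaves no prime strictly between
  \<pp> and \<qq>. This is what puts y into H^0 at \<qq> after R f^n y has been divided out.\<close>

lemma osup_upper:
  fixes A :: "'k ordinal set"
  assumes "|A| \<le>o |UNIV :: ('k + nat) set|" "\<alpha> \<in> A"
  shows "\<alpha> \<le> osup A"
proof -
  obtain \<beta> where "\<forall>\<alpha>\<in>A. \<alpha> < \<beta>" using small_imp_bounded[OF assms(1)] by blast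
  then have "\<exists>\<beta>. \<forall>\<alpha>\<in>A. \<alpha> \<le> \<beta>" by (meson less_imp_le)
  then have "\<forall>\<alpha>\<in>A. \<alpha> \<le> osup A" unfolding osup_def by (rule LeastI_ex)
  then show ?thesis using assms(2) by blast
qed

lemma osup_least: "(\<And>\<alpha>. \<alpha> \<in> A \<Longrightarrow> \<alpha> \<le> \<beta>) \<Longrightarrow> osup A \<le> \<beta>"
  unfolding osup_def by (rule Least_le) blast

lemma less_osupD: "\<beta> < osup A \<Longrightarrow> \<exists>\<alpha>\<in>A. \<beta> < \<alpha>"
  using osup_least[of A \<beta>] by (meson not_less)

lemma less_osuccD: "\<alpha> < osucc \<beta> \<Longrightarrow> \<alpha> \<le> \<beta>"
  using osucc_least(2)[of \<beta> \<alpha>] by (meson not_less)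

lemma ordinal_zero_le [simp]: "0 \<le> (\<alpha> :: 'k ordinal)"
  unfolding zero_ordinal_def by (rule osup_least) simp

lemma ordinal_not_less_zero [simp]: "\<not> \<alpha> < (0 :: 'k ordinal)"
  by (simp add: not_less)

text \<open>The recursion for \<open>+\<close> takes a supremum over a family indexed by an initial
  segment; smallness makes this supremum a genuine upper bound.\<close>

lemma oadd_family_small:
  fixes \<beta> :: "'k ordinal"
  shows "|insert \<alpha> (f ` {..<\<beta>}) :: 'k ordinal set| \<le>o |UNIV :: ('k + nat) set|"
proof -
  have a: "|{\<alpha>}| \<le>o |UNIV :: ('k + nat) set|" by (simp add: card_of_singl_ordLeq)
  have b: "|f ` {..<\<beta>}| \<le>o |UNIV :: ('k + nat) set|"
    using card_of_image card_of_lessThan_ordinal ordLeq_transitive by blast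
  have inf: "infinite (UNIV :: ('k + nat) set)" by simp
  have "|{\<alpha>} \<union> f ` {..<\<beta>}| \<le>o |UNIV :: ('k + nat) set|"
    using card_of_Un_ordLeq_infinite_Field[OF _ a b] inf
    by (metis Field_card_of card_of_Card_order)
  then show ?thesis by simp
qed

lemma plus_ordinal_rec:
  "\<alpha> + \<beta> = osup (insert \<alpha> ((\<lambda>\<gamma>. osucc (\<alpha> + \<gamma>)) ` {..<\<beta>}))" for \<alpha> \<beta> :: "'k ordinal"
  unfolding plus_ordinal_def by (subst oadd.simps) simp

lemma ordinal_le_add: "\<alpha> \<le> \<alpha> + \<beta>" for \<alpha> \<beta> :: "'k ordinal"
  by (subst plus_ordinal_rec) (rule osup_upper[OF oadd_family_small], simp)

lemma ordinal_add_strict_mono_right: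
  fixes \<alpha> \<beta> :: "'k ordinal"
  assumes "\<gamma> < \<beta>"
  shows "\<alpha> + \<gamma> < \<alpha> + \<beta>"
proof -
  have "osucc (\<alpha> + \<gamma>) \<le> \<alpha> + \<beta>"
    by (subst (2) plus_ordinal_rec) (rule osup_upper[OF oadd_family_small], use assms in simp)
  then show ?thesis using osucc_least(1)[of "\<alpha> + \<gamma>"] by order
qed

lemma ordinal_add_mono_right: "\<gamma> \<le> \<beta> \<Longrightarrow> \<alpha> + \<gamma> \<le> \<alpha> + \<beta>" for \<alpha> \<beta> :: "'k ordinal"
  using ordinal_add_strict_mono_right[of \<gamma> \<beta> \<alpha>] by (cases "\<gamma> = \<beta>") (simp_all add: less_imp_le)

text \<open>The least-upper-bound half of the recursion: \<delta> is below some member of the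
  family, and being below \<open>osucc (\<alpha> + \<gamma>)\<close> means \<delta> \<le> \<alpha> +
  \<gamma>.\<close>

lemma less_ordinal_addD:
  fixes \<alpha> \<beta> :: "'k ordinal"
  assumes "\<delta> < \<alpha> + \<beta>"
  shows "\<delta> < \<alpha> \<or> (\<exists>\<gamma><\<beta>. \<delta> \<le> \<alpha> + \<gamma>)"
  using assms less_osupD[of \<delta>] by (subst (asm) plus_ordinal_rec) (auto dest!: less_osuccD)

lemma ordinal_add_zero [simp]: "\<alpha> + 0 = (\<alpha> :: 'k ordinal)"
proof -
  have "\<not> \<alpha> < \<alpha> + 0" using less_ordinal_addD[of \<alpha> \<alpha> 0] by auto
  then show ?thesis using ordinal_le_add[of \<alpha> 0] by order
qed

lemma ordinal_zero_add [simp]: "0 + \<alpha> = (\<alpha> :: 'k ordinal)"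
proof (induction \<alpha> rule: less_induct)
  case (less \<alpha>)
  have "\<not> \<alpha> < 0 + \<alpha>"
  proof
    assume "\<alpha> < 0 + \<alpha>"
    then obtain \<gamma> where "\<gamma> < \<alpha>" "\<alpha> \<le> 0 + \<gamma>"
      using less_ordinal_addD[of \<alpha> 0 \<alpha>] by auto
    then show False using less[of \<gamma>] by simp
  qed
  moreover have "\<not> 0 + \<alpha> < \<alpha>"
  proof
    assume "0 + \<alpha> < \<alpha>"
    then show False
      using less[of "0 + \<alpha>"] ordinal_add_strict_mono_right[of "0 + \<alpha>" \<alpha> 0] by simp
  qed
  ultimately show ?case by order
qed

lemma ordinal_zero_less_one: "(0 :: 'k ordinal) < 1"
  unfolding one_ordinal_def by (rule osucc_least(1))

lemma less_one_ordinal: "\<alpha> < 1 \<Longrightarrow> \<alpha> = (0 :: 'k ordinal)"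
  unfolding one_ordinal_def using less_osuccD ordinal_zero_le by (metis order_antisym)

section \<open>Finite multiples and finite powers of \<omega>\<close>

lemma ncopies_mono: "m \<le> n \<Longrightarrow> ncopies m \<alpha> \<le> ncopies n \<alpha>"
proof (induction n)
  case (Suc n)
  then show ?case using ordinal_le_add[of "ncopies n \<alpha>" \<alpha>] by (cases "m = Suc n") (auto simp: le_Suc_eq)
qed simp

lemma ncopies_less_Suc: "0 < \<alpha> \<Longrightarrow> ncopies m \<alpha> < ncopies (Suc m) \<alpha>"
  using ordinal_add_strict_mono_right[of 0 \<alpha> "ncopies m \<alpha>"] by simp

lemma ncopies_le_omega_pow_Suc: "ncopies k (omega_pow d) \<le> (omega_pow (Suc d) :: 'k ordinal)"
proof -
  have "|range (\<lambda>k. ncopies k (omega_pow d :: 'k ordinal))| \<le>o |UNIV :: nat set|"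
    by (rule card_of_image)
  also have "|UNIV :: nat set| \<le>o |UNIV :: ('k + nat) set|"
    by (simp add: infinite_iff_card_of_nat[symmetric])
  finally show ?thesis
    by (simp add: osup_upper)
qed

lemma omega_pow_pos: "0 < (omega_pow d :: 'k ordinal)"
proof (induction d)
  case 0 then show ?case by (simp add: ordinal_zero_less_one)
next
  case (Suc d)
  have "ncopies 0 (omega_pow d :: 'k ordinal) < ncopies 1 (omega_pow d)"
    using ncopies_less_Suc[OF Suc, of 0] by simp
  also have "\<dots> \<le> omega_pow (Suc d)" by (rule ncopies_le_omega_pow_Suc)
  finally show ?case by simp
qed

lemma ncopies_less_omega_pow_Suc: "ncopies k (omega_pow d) < (omega_pow (Suc d) :: 'k ordinal)"
  using ncopies_less_Suc[OF omega_pow_pos, of k d] ncopies_le_omega_pow_Suc[of "Suc k" d]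
  by (rule less_le_trans)

lemma ncopies_omega_pow_eq_0_iff: "ncopies k (omega_pow d) = (0 :: 'k ordinal) \<longleftrightarrow> k = 0"
proof (cases k)
  case (Suc m)
  have "ncopies m (omega_pow d) < (ncopies k (omega_pow d) :: 'k ordinal)"
    unfolding Suc using omega_pow_pos by (rule ncopies_less_Suc)
  then show ?thesis using Suc by auto
qed simp

section \<open>Comparison and uniqueness of Cantor normal forms\<close>

lemma ncopies_le_cnf_eval: "ncopies (a d) (omega_pow d) \<le> (cnf_eval a d :: 'k ordinal)"
  by (cases d) (auto simp: ordinal_le_add simp del: omega_pow.simps)

text \<open>The tail below the leading term never makes up another copy of
  \<open>omega_pow d\<close>: inductively it stays below a finite multiple of the previous
  power.\<close>

lemma cnf_eval_less_ncopies: "(cnf_eval a d :: 'k ordinal) < ncopies (Suc (a d)) (omega_pow d)"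
proof (induction d)
  case 0 then show ?case using ncopies_less_Suc[OF omega_pow_pos, of _ 0] by simp
next
  case (Suc d)
  have "(cnf_eval a d :: 'k ordinal) < omega_pow (Suc d)"
    using Suc ncopies_less_omega_pow_Suc by (rule less_trans)
  then show ?case using ordinal_add_strict_mono_right by (simp del: omega_pow.simps)
qed

text \<open>At the highest differing index the smaller side stays below one more copy of that power,
  whatever its lower coefficients are.\<close>

lemma cnf_eval_less:
  assumes "i \<le> d" "a i < b i" "\<And>j. i < j \<Longrightarrow> j \<le> d \<Longrightarrow> a j = b j"
  shows "(cnf_eval a d :: 'k ordinal) < cnf_eval b d"
  using assms
proof (induction d)
  case 0
  have "(cnf_eval a 0 :: 'k ordinal) < ncopies (Suc (a 0)) (omega_pow 0)" by (rule cnf_eval_less_ncopies)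
  also have "\<dots> \<le> ncopies (b 0) (omega_pow 0)" using 0 by (intro ncopies_mono) simp
  finally show ?case by simp
next
  case (Suc d)
  show ?case
  proof (cases "i = Suc d")
    case True
    have "(cnf_eval a (Suc d) :: 'k ordinal) < ncopies (Suc (a (Suc d))) (omega_pow (Suc d))" by (rule cnf_eval_less_ncopies)
    also have "\<dots> \<le> ncopies (b (Suc d)) (omega_pow (Suc d))" using Suc True by (intro ncopies_mono) simp
    also have "\<dots> \<le> cnf_eval b (Suc d)" by (rule ncopies_le_cnf_eval)
    finally show ?thesis .
  next
    case False
    then have "(cnf_eval a d :: 'k ordinal) < cnf_eval b d" using Suc by simp
    then show ?thesis using Suc(4)[of "Suc d"] Suc(2) False
      by (simp add: ordinal_add_strict_mono_right del: omega_pow.simps)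
  qed
qed

text \<open>A fundamental sequence in disguise. Reading the normal form from the top,
  \<open>i\<close> is the term at which \<beta> falls short; one copy of \<open>omega_pow i\<close>
  is traded for \<open>n\<close> copies of the next lower power. Both \<open>i\<close> and
  \<open>n\<close> are fixed before \<open>a\<close>, and nothing is asked of \<open>a\<close> below
  \<open>i - 1\<close>, which matches the control available for submodules.\<close>

lemma less_cnf_evalE:
  assumes "\<beta> < (cnf_eval b d :: 'k ordinal)"
  obtains i n where "i \<le> d" "0 < b i"
    "\<And>a. (\<And>j. i < j \<Longrightarrow> j \<le> d \<Longrightarrow> a j = b j) \<Longrightarrow> Suc (a i) = b i \<Longrightarrow> (0 < i \<Longrightarrow> n \<le> a (i - 1))
      \<Longrightarrow> \<beta> \<le> cnf_eval a d"
proof -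
  have "\<exists>i\<le>d. \<exists>n. 0 < b i \<and> (\<forall>a. (\<forall>j. i < j \<and> j \<le> d \<longrightarrow> a j = b j) \<and> Suc (a i) = b i \<and> (0 < i \<longrightarrow> n \<le> a (i - 1))
      \<longrightarrow> \<beta> \<le> cnf_eval a d)"
    using assms
  proof (induction d arbitrary: \<beta>)
    case 0
    then obtain B where B: "b 0 = Suc B" by (cases "b 0") auto
    have "\<beta> < ncopies B 1 + 1" using 0 B by simp
    then have "\<beta> \<le> ncopies B 1"
      by (auto dest!: less_ordinal_addD less_one_ordinal)
    then show ?case using B by auto
  next
    case (Suc d)
    let ?w = "omega_pow (Suc d) :: 'k ordinal"
    have "\<beta> < ncopies (b (Suc d)) ?w + cnf_eval b d" using Suc(2) by simp
    then consider "\<beta> < ncopies (b (Suc d)) ?w"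
      | \<gamma> where "\<gamma> < cnf_eval b d" "\<beta> \<le> ncopies (b (Suc d)) ?w + \<gamma>"
      using less_ordinal_addD by blast
    then show ?case
    proof cases
      case 1
      then obtain B where B: "b (Suc d) = Suc B" by (cases "b (Suc d)") auto
      have bw: "\<beta> < ncopies B ?w + ?w" using 1 B by simp
      have "\<exists>\<gamma><?w. \<beta> \<le> ncopies B ?w + \<gamma>"
        using less_ordinal_addD[OF bw]
      proof
        assume "\<beta> < ncopies B ?w"
        then have "\<beta> \<le> ncopies B ?w + 0" by simp
        then show ?thesis using omega_pow_pos by blast
      qed
      then obtain \<gamma> where g: "\<gamma> < ?w" "\<beta> \<le> ncopies B ?w + \<gamma>" by blast
      \<comment> \<open>This \<open>k\<close> becomes the bound \<open>n\<close>: \<gamma> lies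
        below the limit \<open>omega_pow (Suc d)\<close>, hence below one of the multiples of which
        it is the supremum.\<close>
      from g(1) obtain k where k: "\<gamma> < ncopies k (omega_pow d)" by (auto dest: less_osupD)
      have "\<beta> \<le> cnf_eval a (Suc d)" if "Suc (a (Suc d)) = b (Suc d)" "k \<le> a d" for a
      proof -
        have "\<gamma> \<le> ncopies k (omega_pow d)" using k by simp
        also have "\<dots> \<le> ncopies (a d) (omega_pow d)" using that(2) by (rule ncopies_mono)
        also have "\<dots> \<le> cnf_eval a d" by (rule ncopies_le_cnf_eval)
        finally have "\<gamma> \<le> cnf_eval a d" .
        then have "ncopies B ?w + \<gamma> \<le> cnf_eval a (Suc d)"
          using that(1) B by (simp add: ordinal_add_mono_right del: omega_pow.simps)
        with g(2) show ?thesis by order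
      qed
      then show ?thesis using B by (intro exI[of _ "Suc d"]) auto
    next
      case 2
      then obtain i n where i: "i \<le> d" "0 < b i"
        "\<And>a. (\<forall>j. i < j \<and> j \<le> d \<longrightarrow> a j = b j) \<and> Suc (a i) = b i \<and> (0 < i \<longrightarrow> n \<le> a (i - 1)) \<Longrightarrow> \<gamma> \<le> cnf_eval a d"
        using Suc.IH by blast
      have "\<beta> \<le> cnf_eval a (Suc d)"
        if a: "(\<forall>j. i < j \<and> j \<le> Suc d \<longrightarrow> a j = b j) \<and> Suc (a i) = b i \<and> (0 < i \<longrightarrow> n \<le> a (i - 1))" for a
      proof -
        have "\<gamma> \<le> cnf_eval a d" using i(3) a by simp
        moreover have "a (Suc d) = b (Suc d)" using a i(1) by simp
        ultimately have "ncopies (b (Suc d)) ?w + \<gamma> \<le> cnf_eval a (Suc d)"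
          by (simp add: ordinal_add_mono_right del: omega_pow.simps)
        with 2(2) show ?thesis by order
      qed
      then have "\<forall>a. (\<forall>j. i < j \<and> j \<le> Suc d \<longrightarrow> a j = b j) \<and> Suc (a i) = b i \<and> (0 < i \<longrightarrow> n \<le> a (i - 1))
        \<longrightarrow> \<beta> \<le> cnf_eval a (Suc d)" by blast
      with i(1,2) le_SucI[OF i(1)] show ?thesis by blast
    qed
  qed
  then obtain i n where "i \<le> d" "0 < b i"
    and *: "\<forall>a. (\<forall>j. i < j \<and> j \<le> d \<longrightarrow> a j = b j) \<and> Suc (a i) = b i \<and> (0 < i \<longrightarrow> n \<le> a (i - 1))
      \<longrightarrow> \<beta> \<le> cnf_eval a d"
    by blast
  show ?thesis
  proof (rule that[OF \<open>i \<le> d\<close> \<open>0 < b i\<close>, of n])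
    fix a assume "\<And>j. i < j \<Longrightarrow> j \<le> d \<Longrightarrow> a j = b j" "Suc (a i) = b i" "0 < i \<Longrightarrow> n \<le> a (i - 1)"
    then show "\<beta> \<le> cnf_eval a d" using *[rule_format, of a] by simp
  qed
qed

lemma cnf_eval_extend:
  assumes "d \<le> d'" "\<And>i. d < i \<Longrightarrow> a i = 0"
  shows "cnf_eval a d' = (cnf_eval a d :: 'k ordinal)"
  using assms(1)
proof (induction d' rule: dec_induct)
  case (step n)
  then show ?case using assms(2)[of "Suc n"] by (simp del: omega_pow.simps)
qed simp

lemma cnf_eval_inj:
  assumes "cnf_eval a d = (cnf_eval b d :: 'k ordinal)" "i \<le> d"
  shows "a i = b i"
proof (rule ccontr)
  assume ne: "a i \<noteq> b i"
  define S where "S = {i. i \<le> d \<and> a i \<noteq> b i}"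
  have S: "finite S" "i \<in> S" using ne assms(2) by (auto simp: S_def)
  define m where "m = Max S"
  have m: "m \<in> S" unfolding m_def using S by (auto intro: Max_in)
  have eq: "a j = b j" if "m < j" "j \<le> d" for j
  proof (rule ccontr)
    assume "a j \<noteq> b j"
    then have "j \<le> m" unfolding m_def using S that by (intro Max_ge) (auto simp: S_def)
    with that show False by simp
  qed
  have "m \<le> d" "a m \<noteq> b m" using m by (auto simp: S_def)
  then consider "a m < b m" | "b m < a m" by linarith
  then show False
  proof cases
    case 1
    have "(cnf_eval a d :: 'k ordinal) < cnf_eval b d" by (rule cnf_eval_less[of m]) (use 1 \<open>m \<le> d\<close> eq in auto)
    with assms(1) show False by simp
  next
    case 2
    have "(cnf_eval b d :: 'k ordinal) < cnf_eval a d" by (rule cnf_eval_less[of m]) (use 2 \<open>m \<le> d\<close> eq in auto)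
    with assms(1) show False by simp
  qed
qed

text \<open>Padding with zeros brings both expansions to a common degree, where
  \<open>cnf_eval_inj\<close> applies. This makes the description in \<open>cnf_coeff\<close>
  determinate.\<close>

lemma is_cnf_unique: 
  assumes "is_cnf a (\<alpha> :: 'k ordinal)" "is_cnf b \<alpha>"
  shows "a = b"
proof
  fix i
  obtain d e where d: "\<forall>i>d. a i = 0" "\<alpha> = cnf_eval a d" and e: "\<forall>i>e. b i = 0" "\<alpha> = cnf_eval b e"
    using assms by (auto simp: is_cnf_def)
  define m where "m = max i (max d e)"
  have "cnf_eval a m = \<alpha>" unfolding d(2) by (rule cnf_eval_extend) (use d(1) in \<open>auto simp: m_def\<close>)
  moreover have "cnf_eval b m = \<alpha>" unfolding e(2) by (rule cnf_eval_extend) (use e(1) in \<open>auto simp: m_def\<close>)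
  ultimately have "cnf_eval a m = (cnf_eval b m :: 'k ordinal)" by simp
  then show "a i = b i" by (rule cnf_eval_inj) (simp add: m_def)
qed

lemma cnf_coeff_eq: "is_cnf a \<alpha> \<Longrightarrow> cnf_coeff \<alpha> = a"
  unfolding cnf_coeff_def by (rule the_equality) (auto intro: is_cnf_unique)

lemma is_cnf_unique_ordinal:
  assumes "is_cnf a (\<alpha> :: 'k ordinal)" "is_cnf a \<beta>"
  shows "\<alpha> = \<beta>"
proof -
  obtain d e where d: "\<forall>i>d. a i = 0" "\<alpha> = cnf_eval a d" and e: "\<forall>i>e. a i = 0" "\<beta> = cnf_eval a e"
    using assms by (auto simp: is_cnf_def)
  have "cnf_eval a (max d e) = \<alpha>" unfolding d(2) by (rule cnf_eval_extend) (use d(1) in auto)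
  moreover have "cnf_eval a (max d e) = \<beta>" unfolding e(2) by (rule cnf_eval_extend) (use e(1) in auto)
  ultimately show ?thesis by simp
qed

section \<open>Shuffle sums of monomials\<close>

lemma is_cnf_monomial:
  "is_cnf (\<lambda>n. if n = d then k else 0) (ncopies k (omega_pow d) :: 'k ordinal)"
proof -
  have z: "cnf_eval (\<lambda>n. if n = d then k else 0) e = (0 :: 'k ordinal)" if "e < d" for e
    using that by (induction e) (simp_all del: omega_pow.simps)
  have "cnf_eval (\<lambda>n. if n = d then k else 0) d = (ncopies k (omega_pow d) :: 'k ordinal)"
    using z by (cases d) (simp_all del: omega_pow.simps)
  then show ?thesis unfolding is_cnf_def by (intro exI[of _ d]) auto
qed

text \<open>A member contributes only in degree \<open>k i\<close>, and it is nonzero exactly when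
  \<open>e i\<close> is, so the coefficientwise sum groups the members by degree. The ordinal
  \<gamma> supplies the existence that the definite description needs.\<close>

lemma shuffle_sum_monomials:
  fixes e k :: "'i \<Rightarrow> nat"
  assumes "\<And>n. c n = (\<Sum>i | i \<in> I \<and> k i = n \<and> e i \<noteq> 0. e i)"
    and "finite {i \<in> I. e i \<noteq> 0}"
    and "is_cnf c (\<gamma> :: 'k ordinal)"
  shows "shuffle_sum (\<lambda>i. ncopies (e i) (omega_pow (k i)) :: 'k ordinal) I = \<gamma>"
proof -
  have "(\<Sum>i | i \<in> I \<and> (ncopies (e i) (omega_pow (k i)) :: 'k ordinal) \<noteq> 0.
      cnf_coeff (ncopies (e i) (omega_pow (k i)) :: 'k ordinal) n) = c n" for n
  proof -
    have "(\<Sum>i | i \<in> I \<and> (ncopies (e i) (omega_pow (k i)) :: 'k ordinal) \<noteq> 0.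
      cnf_coeff (ncopies (e i) (omega_pow (k i)) :: 'k ordinal) n)
      = (\<Sum>i | i \<in> I \<and> e i \<noteq> 0. if n = k i then e i else 0)"
      by (simp add: ncopies_omega_pow_eq_0_iff cnf_coeff_eq[OF is_cnf_monomial])
    also have "\<dots> = sum e ({i. i \<in> I \<and> e i \<noteq> 0} \<inter> {i. n = k i})"
      using assms(2) by (subst sum.inter_restrict) auto
    also have "\<dots> = c n" unfolding assms(1) by (rule sum.cong) auto
    finally show ?thesis .
  qed
  then show ?thesis
    unfolding shuffle_sum_def by (simp add: the_equality[of "is_cnf c"] assms(3) is_cnf_unique_ordinal[OF _ assms(3)])
qed

section \<open>Noetherian modules\<close>

text \<open>In a Noetherian ring the union of a nonempty chain of ideals belongs to the chain, so
  Zorn's lemma gives every nonempty set of ideals a maximal member.\<close>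

lemma (in noetherian_ring) wf_ideals: "wf {(J, I). ideal I R \<and> ideal J R \<and> I \<subset> J}"
proof (rule wfI_min)
  fix I and Q :: "'a set set" assume I: "I \<in> Q"
  let ?r = "{(J, I). ideal I R \<and> ideal J R \<and> I \<subset> J}"
  show "\<exists>z\<in>Q. \<forall>y. (y, z) \<in> ?r \<longrightarrow> y \<notin> Q"
  proof (cases "ideal I R")
    case False then show ?thesis using I by auto
  next
    case True
    define A where "A = {J \<in> Q. ideal J R}"
    have "\<exists>J\<in>A. \<forall>X\<in>A. J \<subseteq> X \<longrightarrow> X = J"
    proof (rule subset_Zorn_nonempty)
      show "A \<noteq> {}" using I True by (auto simp: A_def)
      fix C assume C: "C \<noteq> {}" "subset.chain A C"
      then have "\<Union>C \<in> C"
        by (intro ideal_chain_is_trivial) (auto simp: subset.chain_def A_def)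
      then show "\<Union>C \<in> A" using C(2) by (auto simp: subset.chain_def)
    qed
    then obtain J where "J \<in> A" "\<forall>X\<in>A. J \<subseteq> X \<longrightarrow> X = J" by blast
    then show ?thesis unfolding A_def by (intro bexI[of _ J]) auto
  qed
qed

context module
begin

section \<open>Colon ideals, sums and cyclic extensions of submodules\<close>

abbreviation subm :: "'c set \<Rightarrow> bool" where "subm N \<equiv> submodule N R M"

text \<open>The annihilator of the class of \<open>x\<close> in M/N; it stands in for computations
  in the quotient.\<close>

definition colon :: "'c set \<Rightarrow> 'c \<Rightarrow> 'a set" where
  "colon N x = {r \<in> carrier R. r \<odot>\<^bsub>M\<^esub> x \<in> N}"

definition adjoin :: "'c set \<Rightarrow> 'c \<Rightarrow> 'c set" where
  "adjoin N x = {n \<oplus>\<^bsub>M\<^esub> r \<odot>\<^bsub>M\<^esub> x | n r. n \<in> N \<and> r \<in> carrier R}"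

definition submodule_sum :: "'c set \<Rightarrow> 'c set \<Rightarrow> 'c set" where
  "submodule_sum A B = {a \<oplus>\<^bsub>M\<^esub> b | a b. a \<in> A \<and> b \<in> B}"

lemma subm_closed:
  assumes "subm N"
  shows "x \<in> N \<Longrightarrow> x \<in> carrier M" "\<zero>\<^bsub>M\<^esub> \<in> N" "x \<in> N \<Longrightarrow> y \<in> N \<Longrightarrow> x \<oplus>\<^bsub>M\<^esub> y \<in> N"
    "a \<in> carrier R \<Longrightarrow> x \<in> N \<Longrightarrow> a \<odot>\<^bsub>M\<^esub> x \<in> N" "x \<in> N \<Longrightarrow> \<ominus>\<^bsub>M\<^esub> x \<in> N"
  using submoduleE[OF assms] subgroup.one_closed[OF submodule.axioms(1)[OF assms]]
  by auto

lemma subm_add_cancel: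
  assumes "subm N" "x \<in> N" "y \<in> carrier M" "x \<oplus>\<^bsub>M\<^esub> y \<in> N"
  shows "y \<in> N"
proof -
  have "\<ominus>\<^bsub>M\<^esub> x \<oplus>\<^bsub>M\<^esub> (x \<oplus>\<^bsub>M\<^esub> y) \<in> N" by (rule subm_closed(3)[OF assms(1) subm_closed(5)[OF assms(1,2)] assms(4)])
  moreover have "\<ominus>\<^bsub>M\<^esub> x \<oplus>\<^bsub>M\<^esub> (x \<oplus>\<^bsub>M\<^esub> y) = y"
    using assms(3) subm_closed(1)[OF assms(1,2)] by (simp add: M.a_assoc[symmetric] M.l_neg)
  ultimately show ?thesis by simp
qed

lemma smult_commute:
  "a \<in> carrier R \<Longrightarrow> b \<in> carrier R \<Longrightarrow> x \<in> carrier M \<Longrightarrow> a \<odot>\<^bsub>M\<^esub> (b \<odot>\<^bsub>M\<^esub> x) = b \<odot>\<^bsub>M\<^esub> (a \<odot>\<^bsub>M\<^esub> x)"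
  by (simp add: smult_assoc1[symmetric] R.m_comm)

lemma subm_Int: "subm A \<Longrightarrow> subm B \<Longrightarrow> subm (A \<inter> B)"
  by (rule submoduleI) (auto dest: subm_closed)

lemma subm_zero: "subm {\<zero>\<^bsub>M\<^esub>}"
  by (rule submoduleI) auto

lemma subm_submodule_sum:
  assumes A: "subm A" and B: "subm B"
  shows "subm (submodule_sum A B)"
proof (rule submoduleI)
  show "submodule_sum A B \<subseteq> carrier M" using subm_closed[OF A] subm_closed[OF B] by (auto simp: submodule_sum_def)
  have "\<zero>\<^bsub>M\<^esub> = \<zero>\<^bsub>M\<^esub> \<oplus>\<^bsub>M\<^esub> \<zero>\<^bsub>M\<^esub>" by simp
  then show "\<zero>\<^bsub>M\<^esub> \<in> submodule_sum A B" using subm_closed[OF A] subm_closed[OF B] unfolding submodule_sum_def by blast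
next
  fix x assume "x \<in> submodule_sum A B"
  then obtain a b where x: "x = a \<oplus>\<^bsub>M\<^esub> b" "a \<in> A" "b \<in> B" by (auto simp: submodule_sum_def)
  then have "\<ominus>\<^bsub>M\<^esub> x = \<ominus>\<^bsub>M\<^esub> a \<oplus>\<^bsub>M\<^esub> \<ominus>\<^bsub>M\<^esub> b" 
    using subm_closed(1)[OF A] subm_closed(1)[OF B] by (simp add: M.minus_add)
  then show "\<ominus>\<^bsub>M\<^esub> x \<in> submodule_sum A B" using x subm_closed(5)[OF A] subm_closed(5)[OF B] by (auto simp: submodule_sum_def)
  fix y assume "y \<in> submodule_sum A B"
  then obtain c d where y: "y = c \<oplus>\<^bsub>M\<^esub> d" "c \<in> A" "d \<in> B" by (auto simp: submodule_sum_def)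
  have "x \<oplus>\<^bsub>M\<^esub> y = (a \<oplus>\<^bsub>M\<^esub> c) \<oplus>\<^bsub>M\<^esub> (b \<oplus>\<^bsub>M\<^esub> d)"
    using x y subm_closed(1)[OF A] subm_closed(1)[OF B] by (simp add: M.a_ac)
  then show "x \<oplus>\<^bsub>M\<^esub> y \<in> submodule_sum A B" using x y subm_closed(3)[OF A] subm_closed(3)[OF B] unfolding submodule_sum_def by blast
next
  fix r x assume r: "r \<in> carrier R" and "x \<in> submodule_sum A B"
  then obtain a b where x: "x = a \<oplus>\<^bsub>M\<^esub> b" "a \<in> A" "b \<in> B" by (auto simp: submodule_sum_def)
  then have "r \<odot>\<^bsub>M\<^esub> x = r \<odot>\<^bsub>M\<^esub> a \<oplus>\<^bsub>M\<^esub> r \<odot>\<^bsub>M\<^esub> b"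
    using r subm_closed(1)[OF A] subm_closed(1)[OF B] by (simp add: smult_r_distr)
  then show "r \<odot>\<^bsub>M\<^esub> x \<in> submodule_sum A B" using x r subm_closed(4)[OF A] subm_closed(4)[OF B] unfolding submodule_sum_def by blast
qed

lemma submodule_sum_upper:
  assumes "subm A" "subm B"
  shows "A \<subseteq> submodule_sum A B" "B \<subseteq> submodule_sum A B"
proof -
  have "x = x \<oplus>\<^bsub>M\<^esub> \<zero>\<^bsub>M\<^esub>" if "x \<in> A" for x using subm_closed(1)[OF assms(1) that] by simp
  then show "A \<subseteq> submodule_sum A B" using subm_closed(2)[OF assms(2)] unfolding submodule_sum_def by blast
  have "x = \<zero>\<^bsub>M\<^esub> \<oplus>\<^bsub>M\<^esub> x" if "x \<in> B" for x using subm_closed(1)[OF assms(2) that] by simp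
  then show "B \<subseteq> submodule_sum A B" using subm_closed(2)[OF assms(1)] unfolding submodule_sum_def by blast
qed

lemma submodule_sum_least: "subm C \<Longrightarrow> A \<subseteq> C \<Longrightarrow> B \<subseteq> C \<Longrightarrow> submodule_sum A B \<subseteq> C"
  using subm_closed(3)[of C] unfolding submodule_sum_def by blast

lemma submodule_sum_mono: "A \<subseteq> A' \<Longrightarrow> B \<subseteq> B' \<Longrightarrow> submodule_sum A B \<subseteq> submodule_sum A' B'"
  unfolding submodule_sum_def by blast

lemma subm_cyclic: "x \<in> carrier M \<Longrightarrow> subm {r \<odot>\<^bsub>M\<^esub> x | r. r \<in> carrier R}"
proof (rule submoduleI)
  assume x: "x \<in> carrier M"
  show "{r \<odot>\<^bsub>M\<^esub> x | r. r \<in> carrier R} \<subseteq> carrier M" using x by auto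
  have "\<zero>\<^bsub>M\<^esub> = \<zero> \<odot>\<^bsub>M\<^esub> x" using x by simp
  then show "\<zero>\<^bsub>M\<^esub> \<in> {r \<odot>\<^bsub>M\<^esub> x | r. r \<in> carrier R}" by blast
  fix a assume "a \<in> {r \<odot>\<^bsub>M\<^esub> x | r. r \<in> carrier R}"
  then obtain r where r: "r \<in> carrier R" "a = r \<odot>\<^bsub>M\<^esub> x" by blast
  then have "\<ominus>\<^bsub>M\<^esub> a = (\<ominus> r) \<odot>\<^bsub>M\<^esub> x" using x by (simp add: smult_l_minus)
  then show "\<ominus>\<^bsub>M\<^esub> a \<in> {r \<odot>\<^bsub>M\<^esub> x | r. r \<in> carrier R}" using r by blast
  { fix b assume "b \<in> {r \<odot>\<^bsub>M\<^esub> x | r. r \<in> carrier R}"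
    then obtain t where t: "t \<in> carrier R" "b = t \<odot>\<^bsub>M\<^esub> x" by blast
    then have "a \<oplus>\<^bsub>M\<^esub> b = (r \<oplus> t) \<odot>\<^bsub>M\<^esub> x" using r x by (simp add: smult_l_distr)
    then show "a \<oplus>\<^bsub>M\<^esub> b \<in> {r \<odot>\<^bsub>M\<^esub> x | r. r \<in> carrier R}" using r t by blast }
  fix c assume c: "c \<in> carrier R"
  then have "c \<odot>\<^bsub>M\<^esub> a = (c \<otimes> r) \<odot>\<^bsub>M\<^esub> x" using r x by (simp add: smult_assoc1)
  then show "c \<odot>\<^bsub>M\<^esub> a \<in> {r \<odot>\<^bsub>M\<^esub> x | r. r \<in> carrier R}" using r c by blast
qed

lemma adjoin_eq_submodule_sum: "adjoin N x = submodule_sum N {r \<odot>\<^bsub>M\<^esub> x | r. r \<in> carrier R}"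
  unfolding adjoin_def submodule_sum_def by blast

lemma subm_adjoin: "subm N \<Longrightarrow> x \<in> carrier M \<Longrightarrow> subm (adjoin N x)"
  unfolding adjoin_eq_submodule_sum by (intro subm_submodule_sum subm_cyclic)

lemma adjoin_upper:
  assumes "subm N" "x \<in> carrier M"
  shows "N \<subseteq> adjoin N x" "x \<in> adjoin N x"
proof -
  have "\<one> \<odot>\<^bsub>M\<^esub> x \<in> {r \<odot>\<^bsub>M\<^esub> x | r. r \<in> carrier R}" by blast
  then show "N \<subseteq> adjoin N x" "x \<in> adjoin N x"
    unfolding adjoin_eq_submodule_sum using submodule_sum_upper[OF assms(1) subm_cyclic[OF assms(2)]] assms(2) by auto
qed

lemma adjoin_least: "subm C \<Longrightarrow> N \<subseteq> C \<Longrightarrow> x \<in> C \<Longrightarrow> adjoin N x \<subseteq> C"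
  using subm_closed(4)[of C _ x] unfolding adjoin_eq_submodule_sum by (intro submodule_sum_least) auto

lemma ideal_colon:
  assumes N: "subm N" and x: "x \<in> carrier M"
  shows "ideal (colon N x) R"
proof (rule idealI)
  show "ring R" by (rule R.ring_axioms)
  show "subgroup (colon N x) (add_monoid R)"
    using subm_closed[OF N] x unfolding colon_def
    by (intro subgroup.intro) (auto simp: smult_l_distr smult_l_minus simp flip: a_inv_def)
  fix a r assume a: "a \<in> colon N x" and r: "r \<in> carrier R"
  then show "r \<otimes> a \<in> colon N x" using subm_closed[OF N] x by (auto simp: colon_def smult_assoc1)
  then show "a \<otimes> r \<in> colon N x" using a r by (simp add: R.m_comm colon_def)
qed

lemma colon_one: "x \<in> carrier M \<Longrightarrow> \<one> \<in> colon N x \<longleftrightarrow> x \<in> N"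
  by (simp add: colon_def)

lemma colon_mono: "N \<subseteq> N' \<Longrightarrow> colon N x \<subseteq> colon N' x"
  unfolding colon_def by blast

lemma colon_smult:
  assumes "subm N" "x \<in> carrier M" "r \<in> carrier R"
  shows "colon N (r \<odot>\<^bsub>M\<^esub> x) = {a \<in> carrier R. a \<otimes> r \<in> colon N x}"
  using assms by (auto simp: colon_def smult_assoc1)

lemma colon_smult_mono: 
  assumes "subm N" "x \<in> carrier M" "r \<in> carrier R"
  shows "colon N x \<subseteq> colon N (r \<odot>\<^bsub>M\<^esub> x)"
  using assms ideal.I_r_closed[OF ideal_colon[OF assms(1,2)]]
  by (auto simp: colon_smult) (simp add: colon_def)

text \<open>The modular law: the summand in \<open>L\<close> of an element of \<open>B\<close> lies
  in \<open>B\<close> too. Hence enlarging a submodule changes its trace on \<open>L\<close> or its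
  image modulo \<open>L\<close>.\<close>

lemma subm_modular:
  assumes "subm A" "subm B" "subm L" "A \<subseteq> B" "B \<inter> L \<subseteq> A" "B \<subseteq> submodule_sum A L"
  shows "B \<subseteq> A"
proof
  fix b assume b: "b \<in> B"
  then obtain a l where al: "b = a \<oplus>\<^bsub>M\<^esub> l" "a \<in> A" "l \<in> L" using assms(6) by (auto simp: submodule_sum_def)
  then have "l \<in> B" using subm_add_cancel[OF assms(2), of a l] b assms(4) subm_closed(1)[OF assms(3)] by auto
  then show "b \<in> A" using al assms(5) subm_closed(3)[OF assms(1)] by blast
qed

end

section \<open>Ascending chain condition for finitely generated modules\<close>

locale noetherian_module = module R M + noetherian_ring R for R (structure) and M (structure) +
  assumes fin_gen: "fin_gen_module R M"
begin

text \<open>A submodule of L + Rx is measured by its image in the cyclic module (L + Rx)/L, encoded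
  as the ideal \<open>colon (submodule_sum N L) x\<close>, and by its trace on L. By the modular law
  one of the two grows strictly, and both kinds of growth are well-founded.\<close>

lemma wf_submodules_of_adjoin:
  assumes L: "subm L" and x: "x \<in> carrier M"
    and wf: "wf {(N', N). subm N \<and> subm N' \<and> N \<subset> N' \<and> N' \<subseteq> L}"
  shows "wf {(N', N). subm N \<and> subm N' \<and> N \<subset> N' \<and> N' \<subseteq> adjoin L x}" (is "wf ?r")
proof -
  define f where "f N = (colon (submodule_sum N L) x, N \<inter> L)" for N
  let ?s = "{(J, I). ideal I R \<and> ideal J R \<and> I \<subset> J} <*lex*> {(N', N). subm N \<and> subm N' \<and> N \<subset> N' \<and> N' \<subseteq> L}"
  have "?r \<subseteq> inv_image ?s f"
  proof (rule subrelI)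
    fix N' N assume "(N', N) \<in> ?r"
    then have N: "subm N" and N': "subm N'" and less: "N \<subset> N'" and le: "N' \<subseteq> adjoin L x" by auto
    have 1: "ideal (colon (submodule_sum N L) x) R" "ideal (colon (submodule_sum N' L) x) R" "colon (submodule_sum N L) x \<subseteq> colon (submodule_sum N' L) x"
      using submodule_sum_mono[of N N' L L] less by (auto intro!: ideal_colon subm_submodule_sum N N' L x colon_mono)
    have 2: "subm (N \<inter> L)" "subm (N' \<inter> L)" "N \<inter> L \<subseteq> N' \<inter> L" using less by (auto intro!: subm_Int N N' L)
    \<comment> \<open>Both components are weakly monotone, so a lexicographic decrease only requires
      that they do not both stay put.\<close>
    have "\<not> (colon (submodule_sum N' L) x \<subseteq> colon (submodule_sum N L) x \<and> N' \<inter> L \<subseteq> N \<inter> L)"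
    proof
      assume as: "colon (submodule_sum N' L) x \<subseteq> colon (submodule_sum N L) x \<and> N' \<inter> L \<subseteq> N \<inter> L"
      have "N' \<subseteq> submodule_sum N L"
      proof
        fix y assume y: "y \<in> N'"
        then obtain l r where lr: "l \<in> L" "r \<in> carrier R" "y = l \<oplus>\<^bsub>M\<^esub> r \<odot>\<^bsub>M\<^esub> x" using le by (auto simp: adjoin_def)
        have "y \<in> submodule_sum N' L" "l \<in> submodule_sum N' L" using submodule_sum_upper[OF N' L] y lr by auto
        then have "r \<odot>\<^bsub>M\<^esub> x \<in> submodule_sum N' L" using lr x by (auto intro: subm_add_cancel[OF subm_submodule_sum[OF N' L], of l])
        then have "r \<odot>\<^bsub>M\<^esub> x \<in> submodule_sum N L" using as lr(2) by (auto simp: colon_def)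
        then show "y \<in> submodule_sum N L" using lr submodule_sum_upper[OF N L] by (auto intro!: subm_closed subm_submodule_sum N L)
      qed
      then have "N' \<subseteq> N" using as less by (intro subm_modular[OF N N' L]) auto
      then show False using less by blast
    qed
    then show "(N', N) \<in> inv_image ?s f"
      using 1 2 unfolding f_def by auto
  qed
  moreover have "wf (inv_image ?s f)" using wf_ideals wf by (intro wf_inv_image wf_lex_prod)
  ultimately show ?thesis by (rule wf_subset[rotated])
qed

text \<open>The generators are adjoined one at a time, starting from the zero submodule; a submodule
  containing all of them is the whole module.\<close>

lemma wf_supermodule_rel: "wf (supermodule_rel R M)"
proof -
  obtain A where A: "A \<subseteq> carrier M" "finite A" "\<And>N. subm N \<Longrightarrow> A \<subseteq> N \<Longrightarrow> N = carrier M"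
    using fin_gen by (auto simp: fin_gen_module_def)
  have "\<exists>L. subm L \<and> A \<subseteq> L \<and> wf {(N', N). subm N \<and> subm N' \<and> N \<subset> N' \<and> N' \<subseteq> L}"
    using A(2,1)
  proof (induction A rule: finite_induct)
    case empty
    have "{(N', N). subm N \<and> subm N' \<and> N \<subset> N' \<and> N' \<subseteq> {\<zero>\<^bsub>M\<^esub>}} = {}" using subm_closed(2) by auto
    then have "wf {(N', N). subm N \<and> subm N' \<and> N \<subset> N' \<and> N' \<subseteq> {\<zero>\<^bsub>M\<^esub>}}" by (simp only: wf_on_bot)
    then show ?case using subm_zero by blast
  next
    case (insert x A)
    then obtain L where L: "subm L" "A \<subseteq> L" "wf {(N', N). subm N \<and> subm N' \<and> N \<subset> N' \<and> N' \<subseteq> L}" by auto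
    have x: "x \<in> carrier M" using insert by simp
    show ?case
      using wf_submodules_of_adjoin[OF L(1) x L(3)] subm_adjoin[OF L(1) x] adjoin_upper[OF L(1) x] L(2)
      by (intro exI[of _ "adjoin L x"]) auto
  qed
  then obtain L where L: "subm L" "A \<subseteq> L" "wf {(N', N). subm N \<and> subm N' \<and> N \<subset> N' \<and> N' \<subseteq> L}" by blast
  have "supermodule_rel R M \<subseteq> {(N', N). subm N \<and> subm N' \<and> N \<subset> N' \<and> N' \<subseteq> L}"
    using A(3)[OF L(1,2)] subm_closed(1) unfolding supermodule_rel_def by auto
  with L(3) show ?thesis by (rule wf_subset)
qed

lemma maximal_submodule:
  assumes "subm N" "P N"
  obtains N' where "subm N'" "P N'" "\<And>X. subm X \<Longrightarrow> P X \<Longrightarrow> N' \<subseteq> X \<Longrightarrow> X = N'"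
proof -
  obtain N' where "subm N' \<and> P N'" "\<And>X. (X, N') \<in> supermodule_rel R M \<Longrightarrow> \<not> (subm X \<and> P X)"
    using wfE_min[OF wf_supermodule_rel, of N "{N. subm N \<and> P N}"] assms by auto
  then show ?thesis using that[of N'] unfolding supermodule_rel_def by blast
qed

lemma maximal_ideal_property:
  assumes "ideal I R" "P I"
  obtains J where "ideal J R" "P J" "\<And>X. ideal X R \<Longrightarrow> P X \<Longrightarrow> J \<subseteq> X \<Longrightarrow> X = J"
proof -
  obtain J where "ideal J R \<and> P J" "\<And>X. (X, J) \<in> {(J, I). ideal I R \<and> ideal J R \<and> I \<subset> J} \<Longrightarrow> \<not> (ideal X R \<and> P X)"
    using wfE_min[OF wf_ideals, of I "{I. ideal I R \<and> P I}"] assms by auto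
  then show ?thesis using that[of J] by blast
qed

end

section \<open>Lengths at a prime\<close>

context noetherian_module
begin

abbreviation prm :: "'a set \<Rightarrow> bool" where "prm \<pp> \<equiv> primeideal \<pp> R"

text \<open>The kernel of the map from M to (M/N)_\<pp>. For A \<subseteq> B, the inclusion
  \<open>B \<subseteq> saturation \<pp> A\<close> says that (B/A)_\<pp> vanishes.\<close>

definition saturation :: "'a set \<Rightarrow> 'c set \<Rightarrow> 'c set" where
  "saturation \<pp> N = {x \<in> carrier M. \<exists>s \<in> carrier R - \<pp>. s \<odot>\<^bsub>M\<^esub> x \<in> N}"

text \<open>
  The maximal \<open>n\<close> with \<open>chain_at \<pp> n A B\<close> is the length of the localization \<open>(B/A)\<^sub>\<pp>\<close>: the chains counted are
  those whose successive quotients do not vanish at \<open>\<pp>\<close>.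
\<close>

primrec chain_at :: "'a set \<Rightarrow> nat \<Rightarrow> 'c set \<Rightarrow> 'c set \<Rightarrow> bool" where
  "chain_at \<pp> 0 A B \<longleftrightarrow> A \<subseteq> B"
| "chain_at \<pp> (Suc n) A B \<longleftrightarrow> (\<exists>C. subm C \<and> chain_at \<pp> n A C \<and> C \<subseteq> B \<and> \<not> B \<subseteq> saturation \<pp> C)"

definition has_length_at :: "'a set \<Rightarrow> 'c set \<Rightarrow> 'c set \<Rightarrow> nat \<Rightarrow> bool" where
  "has_length_at \<pp> A B n \<longleftrightarrow> chain_at \<pp> n A B \<and> \<not> chain_at \<pp> (Suc n) A B"

text \<open>
  The preimage in \<open>M\<close> of \<open>H\<^sup>0\<^sub>\<pp>(M/N)\<close>: an element of \<open>(M/N)\<^sub>\<pp>\<close> is killed by a power of \<open>\<pp>\<close> iff it vanishes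
  at every prime properly below \<open>\<pp>\<close>.
\<close>

definition local_part :: "'a set \<Rightarrow> 'c set \<Rightarrow> 'c set" where
  "local_part \<pp> N = {x \<in> carrier M. \<forall>\<qq>. prm \<qq> \<and> \<qq> \<subset> \<pp> \<longrightarrow> x \<in> saturation \<qq> N}"

text \<open>This is e_\<pp>(M/N); \<open>has_length_at_mult_at\<close> shows that the length is
  finite, which gives the description its meaning.\<close>

definition mult_at :: "'a set \<Rightarrow> 'c set \<Rightarrow> nat" where
  "mult_at \<pp> N = (THE n. has_length_at \<pp> N (local_part \<pp> N) n)"

definition Ass_quot :: "'c set \<Rightarrow> 'a set set" where
  "Ass_quot N = {\<pp>. prm \<pp> \<and> (\<exists>x \<in> carrier M. \<pp> = colon N x)}"

section \<open>Saturation as vanishing after localization\<close>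

lemma prm_one: "prm \<pp> \<Longrightarrow> \<one> \<in> carrier R - \<pp>"
  using ideal.one_imp_carrier[of \<pp> R] primeideal.I_notcarr[of \<pp> R] primeideal.axioms(1)[of \<pp> R] by auto

lemma prm_mult: "prm \<pp> \<Longrightarrow> s \<in> carrier R - \<pp> \<Longrightarrow> t \<in> carrier R - \<pp> \<Longrightarrow> s \<otimes> t \<in> carrier R - \<pp>"
  using primeideal.I_prime[of \<pp> R s t] by auto

lemma prm_pow: "prm \<pp> \<Longrightarrow> s \<in> carrier R - \<pp> \<Longrightarrow> s [^] (k :: nat) \<in> carrier R - \<pp>"
proof (induction k)
  case 0
  then show ?case using prm_one by simp
next
  case (Suc k)
  then show ?case using prm_mult[of \<pp> "s [^] k" s] by simp
qed

lemma prm_subset: "prm \<pp> \<Longrightarrow> \<pp> \<subseteq> carrier R"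
  using ideal.Icarr[of \<pp> R] primeideal.axioms(1)[of \<pp> R] by auto

lemma saturation_upper: "prm \<pp> \<Longrightarrow> subm N \<Longrightarrow> N \<subseteq> saturation \<pp> N"
  using prm_one[of \<pp>] subm_closed(1)[of N] smult_one unfolding saturation_def by (auto intro!: bexI[of _ \<one>])

lemma saturation_mono: "N \<subseteq> N' \<Longrightarrow> saturation \<pp> N \<subseteq> saturation \<pp> N'"
  unfolding saturation_def by blast

lemma subm_saturation:
  assumes p: "prm \<pp>" and N: "subm N"
  shows "subm (saturation \<pp> N)"
proof (rule submoduleI)
  show "saturation \<pp> N \<subseteq> carrier M" by (auto simp: saturation_def)
  show "\<zero>\<^bsub>M\<^esub> \<in> saturation \<pp> N" using saturation_upper[OF p N] subm_closed(2)[OF N] by blast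
next
  fix x assume "x \<in> saturation \<pp> N"
  then obtain s where s: "x \<in> carrier M" "s \<in> carrier R - \<pp>" "s \<odot>\<^bsub>M\<^esub> x \<in> N" by (auto simp: saturation_def)
  then show "\<ominus>\<^bsub>M\<^esub> x \<in> saturation \<pp> N"
    using subm_closed(5)[OF N s(3)] by (auto simp: saturation_def smult_r_minus intro!: bexI[of _ s])
  fix y assume "y \<in> saturation \<pp> N"
  then obtain t where t: "y \<in> carrier M" "t \<in> carrier R - \<pp>" "t \<odot>\<^bsub>M\<^esub> y \<in> N" by (auto simp: saturation_def)
  have "(s \<otimes> t) \<odot>\<^bsub>M\<^esub> (x \<oplus>\<^bsub>M\<^esub> y) = t \<odot>\<^bsub>M\<^esub> (s \<odot>\<^bsub>M\<^esub> x) \<oplus>\<^bsub>M\<^esub> s \<odot>\<^bsub>M\<^esub> (t \<odot>\<^bsub>M\<^esub> y)"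
    using s t by (simp add: smult_r_distr smult_assoc1 smult_commute)
  moreover have "\<dots> \<in> N" using s(2) t(2) by (intro subm_closed(3)[OF N] subm_closed(4)[OF N _ s(3)] subm_closed(4)[OF N _ t(3)]) auto
  ultimately have "(s \<otimes> t) \<odot>\<^bsub>M\<^esub> (x \<oplus>\<^bsub>M\<^esub> y) \<in> N" by simp
  then show "x \<oplus>\<^bsub>M\<^esub> y \<in> saturation \<pp> N"
    using prm_mult[OF p s(2) t(2)] s t unfolding saturation_def by blast
next
  fix a x assume a: "a \<in> carrier R" "x \<in> saturation \<pp> N"
  then obtain s where s: "x \<in> carrier M" "s \<in> carrier R - \<pp>" "s \<odot>\<^bsub>M\<^esub> x \<in> N" by (auto simp: saturation_def)
  then have "s \<odot>\<^bsub>M\<^esub> (a \<odot>\<^bsub>M\<^esub> x) \<in> N" using a subm_closed(4)[OF N, of a "s \<odot>\<^bsub>M\<^esub> x"] by (simp add: smult_commute)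
  then show "a \<odot>\<^bsub>M\<^esub> x \<in> saturation \<pp> N" using s a unfolding saturation_def by blast
qed

lemma saturation_cancel:
  assumes p: "prm \<pp>" and s: "s \<in> carrier R - \<pp>" and x: "x \<in> carrier M" "s \<odot>\<^bsub>M\<^esub> x \<in> saturation \<pp> N"
  shows "x \<in> saturation \<pp> N"
proof -
  obtain t where t: "t \<in> carrier R - \<pp>" "t \<odot>\<^bsub>M\<^esub> (s \<odot>\<^bsub>M\<^esub> x) \<in> N" using x by (auto simp: saturation_def)
  then have "(t \<otimes> s) \<odot>\<^bsub>M\<^esub> x \<in> N" using s x by (simp add: smult_assoc1)
  then show ?thesis using prm_mult[OF p t(1) s] x unfolding saturation_def by blast
qed

lemma saturation_least:
  assumes p: "prm \<pp>" and "N' \<subseteq> saturation \<pp> N"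
  shows "saturation \<pp> N' \<subseteq> saturation \<pp> N"
proof
  fix x assume "x \<in> saturation \<pp> N'"
  then obtain s where "x \<in> carrier M" "s \<in> carrier R - \<pp>" "s \<odot>\<^bsub>M\<^esub> x \<in> N'" by (auto simp: saturation_def)
  with assms(2) show "x \<in> saturation \<pp> N" using saturation_cancel[OF p] by blast
qed

text \<open>The class of \<open>x\<close> survives at \<pp> when nothing outside \<pp> annihilates
  it; this turns questions about localizations into inclusions of ideals.\<close>

lemma not_in_saturation_iff: "x \<in> carrier M \<Longrightarrow> x \<notin> saturation \<pp> N \<longleftrightarrow> colon N x \<subseteq> \<pp>"
  unfolding saturation_def colon_def by auto

section \<open>Length at a prime and its additivity\<close>

lemma chain_at_subset: "chain_at \<pp> n A B \<Longrightarrow> A \<subseteq> B"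
  by (induction n arbitrary: B) auto

lemma chain_at_mono: "chain_at \<pp> n A B \<Longrightarrow> B \<subseteq> B' \<Longrightarrow> chain_at \<pp> n A B'"
  by (cases n) (auto, blast)

lemma chain_at_Suc: "chain_at \<pp> (Suc n) A B \<Longrightarrow> chain_at \<pp> n A B"
  by (auto intro: chain_at_mono)

lemma chain_at_le: "chain_at \<pp> n A B \<Longrightarrow> m \<le> n \<Longrightarrow> chain_at \<pp> m A B"
  by (induction n) (auto simp: le_Suc_eq simp del: chain_at.simps dest: chain_at_Suc)

lemma chain_at_append: "chain_at \<pp> n A B \<Longrightarrow> chain_at \<pp> m B C \<Longrightarrow> chain_at \<pp> (n + m) A C"
  by (induction m arbitrary: C) (auto intro: chain_at_mono)

text \<open>Intersecting a chain with B and adding B to it yields a chain on either side of B. By a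
  localized modular law each step that is strict at \<pp> stays strict on at least one side, so no
  length is lost.\<close>

lemma chain_at_split:
  assumes p: "prm \<pp>" and A: "subm A" and B: "subm B" and X: "subm X" and "A \<subseteq> B" "B \<subseteq> X" "chain_at \<pp> n A X"
  shows "\<exists>i j. n \<le> i + j \<and> chain_at \<pp> i A B \<and> chain_at \<pp> j B X"
proof -
  \<comment> \<open>Members of the chain need not contain B, so the induction runs over an arbitrary
    X, with X \<inter> B and X + B as upper ends.\<close>
  have "\<exists>i j. n \<le> i + j \<and> chain_at \<pp> i A (X \<inter> B) \<and> chain_at \<pp> j B (submodule_sum X B)" if "subm X" "chain_at \<pp> n A X" for X
    using that
  proof (induction n arbitrary: X)
    case 0
    then show ?case using \<open>A \<subseteq> B\<close> submodule_sum_upper[OF 0(1) B] by (intro exI[of _ 0]) auto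
  next
    case (Suc n)
    then obtain C where C: "subm C" "chain_at \<pp> n A C" "C \<subseteq> X" "\<not> X \<subseteq> saturation \<pp> C" by auto
    then obtain i j where ij: "n \<le> i + j" "chain_at \<pp> i A (C \<inter> B)" "chain_at \<pp> j B (submodule_sum C B)" using Suc.IH by blast
    have le: "C \<inter> B \<subseteq> X \<inter> B" "submodule_sum C B \<subseteq> submodule_sum X B" using C(3) submodule_sum_mono[of C X B B] by auto
    have sub: "subm (C \<inter> B)" "subm (submodule_sum C B)" using C(1) B by (auto intro: subm_Int subm_submodule_sum)
    show ?case
    proof (cases "X \<inter> B \<subseteq> saturation \<pp> (C \<inter> B)")
      case False
      then have "chain_at \<pp> (Suc i) A (X \<inter> B)" using ij sub le by auto
      moreover have "chain_at \<pp> j B (submodule_sum X B)" using ij(3) le(2) by (rule chain_at_mono)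
      ultimately show ?thesis using ij(1) by (intro exI[of _ "Suc i"] exI[of _ j]) (simp del: chain_at.simps)
    next
      case True
      have "\<not> submodule_sum X B \<subseteq> saturation \<pp> (submodule_sum C B)"
      proof
        assume as: "submodule_sum X B \<subseteq> saturation \<pp> (submodule_sum C B)"
        \<comment> \<open>If neither side is strict, then s x = c + b with b in X \<inter> B; both
          summands vanish modulo C at \<pp>, hence so does x.\<close>
        have "X \<subseteq> saturation \<pp> C"
        proof
          fix x assume x: "x \<in> X"
          then have xc: "x \<in> carrier M" using subm_closed(1)[OF Suc(2)] by blast
          have "x \<in> saturation \<pp> (submodule_sum C B)" using x as submodule_sum_upper[OF Suc(2) B] by blast
          then obtain s c b where s: "s \<in> carrier R - \<pp>" "s \<odot>\<^bsub>M\<^esub> x = c \<oplus>\<^bsub>M\<^esub> b" "c \<in> C" "b \<in> B"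
            by (auto simp: saturation_def submodule_sum_def)
          have bX: "b \<in> X"
            using subm_add_cancel[OF Suc(2), of c b] s x C(3) subm_closed(1)[OF B s(4)] subm_closed(4)[OF Suc(2), of s x]
            by auto
          then have "b \<in> saturation \<pp> C" using True s(4) saturation_mono[of "C \<inter> B" C \<pp>] by blast
          moreover have "c \<in> saturation \<pp> C" using s(3) saturation_upper[OF p C(1)] by blast
          ultimately have "s \<odot>\<^bsub>M\<^esub> x \<in> saturation \<pp> C" using s(2) subm_closed(3)[OF subm_saturation[OF p C(1)]] by simp
          then show "x \<in> saturation \<pp> C" using saturation_cancel[OF p s(1) xc] by blast
        qed
        with C(4) show False ..
      qed
      then have "chain_at \<pp> (Suc j) B (submodule_sum X B)" using ij sub le by auto
      moreover have "chain_at \<pp> i A (X \<inter> B)" using ij(2) le(1) by (rule chain_at_mono)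
      ultimately show ?thesis using ij(1) by (intro exI[of _ i] exI[of _ "Suc j"]) (simp del: chain_at.simps)
    qed
  qed
  from this[OF X assms(7)] obtain i j where ij: "n \<le> i + j" "chain_at \<pp> i A (X \<inter> B)" "chain_at \<pp> j B (submodule_sum X B)" by blast
  have "X \<inter> B = B" using assms(6) by blast
  moreover have "submodule_sum X B = X" using submodule_sum_least[OF X _ assms(6), of X] submodule_sum_upper[OF X B] by blast
  ultimately show ?thesis using ij by auto
qed

lemma has_length_at_unique: "has_length_at \<pp> A B i \<Longrightarrow> has_length_at \<pp> A B j \<Longrightarrow> i = j"
  unfolding has_length_at_def using chain_at_le by (metis linorder_neqE_nat Suc_leI)

lemma chain_at_bounded_has_length_at:
  assumes "A \<subseteq> B" "\<not> chain_at \<pp> n A B"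
  shows "\<exists>i. has_length_at \<pp> A B i"
proof (rule ccontr)
  assume *: "\<not> ?thesis"
  have "chain_at \<pp> n A B" for n
  proof (induction n)
    case (Suc n) then show ?case using * unfolding has_length_at_def by blast
  qed (use assms in simp)
  then show False using assms by blast
qed

text \<open>Concatenating chains gives one inequality, \<open>chain_at_split\<close> the
  other.\<close>

lemma has_length_at_add:
  assumes p: "prm \<pp>" and A: "subm A" and B: "subm B" and C: "subm C"
    and i: "has_length_at \<pp> A B i" and j: "has_length_at \<pp> B C j"
  shows "has_length_at \<pp> A C (i + j)"
  unfolding has_length_at_def
proof
  show "chain_at \<pp> (i + j) A C" using i j chain_at_append unfolding has_length_at_def by blast
  have AB: "A \<subseteq> B" "B \<subseteq> C" using i j chain_at_subset unfolding has_length_at_def by blast+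
  show "\<not> chain_at \<pp> (Suc (i + j)) A C"
  proof
    assume "chain_at \<pp> (Suc (i + j)) A C"
    then obtain i' j' where *: "Suc (i + j) \<le> i' + j'" "chain_at \<pp> i' A B" "chain_at \<pp> j' B C"
      using chain_at_split[OF p A B C AB] by blast
    have "i' \<le> i" using i chain_at_le[OF *(2), of "Suc i"] unfolding has_length_at_def by (meson not_less_eq_eq)
    moreover have "j' \<le> j" using j chain_at_le[OF *(3), of "Suc j"] unfolding has_length_at_def by (meson not_less_eq_eq)
    ultimately show False using *(1) by simp
  qed
qed

lemma has_length_at_split:
  assumes p: "prm \<pp>" and A: "subm A" and B: "subm B" and C: "subm C" and AB: "A \<subseteq> B" "B \<subseteq> C"
    and n: "has_length_at \<pp> A C n"
  obtains i j where "has_length_at \<pp> A B i" "has_length_at \<pp> B C j" "n = i + j"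
proof -
  have "\<not> chain_at \<pp> (Suc n) A B" using n chain_at_mono[OF _ AB(2)] unfolding has_length_at_def by blast
  then obtain i where i: "has_length_at \<pp> A B i" using chain_at_bounded_has_length_at[OF AB(1)] by blast
  have "\<not> chain_at \<pp> (Suc n) B C"
    using n chain_at_append[of \<pp> 0 A B "Suc n" C] AB unfolding has_length_at_def by (auto simp del: chain_at.simps(2))
  then obtain j where j: "has_length_at \<pp> B C j" using chain_at_bounded_has_length_at[OF AB(2)] by blast
  show thesis using that[OF i j] has_length_at_unique[OF n has_length_at_add[OF p A B C i j]] by blast
qed

lemma has_length_at_0_iff:
  assumes "prm \<pp>" "subm A" "A \<subseteq> B"
  shows "has_length_at \<pp> A B 0 \<longleftrightarrow> B \<subseteq> saturation \<pp> A"
proof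
  assume "has_length_at \<pp> A B 0"
  then have "\<not> chain_at \<pp> (Suc 0) A B" by (simp add: has_length_at_def)
  then show "B \<subseteq> saturation \<pp> A" using assms by auto
next
  assume *: "B \<subseteq> saturation \<pp> A"
  have "B \<subseteq> saturation \<pp> C" if "A \<subseteq> C" for C using * saturation_mono[OF that] by (rule subset_trans)
  then show "has_length_at \<pp> A B 0" using assms(3) by (simp add: has_length_at_def)
qed

section \<open>Associated primes and finiteness of the multiplicities\<close>

lemma subm_local_part: 
  assumes "subm N"
  shows "subm (local_part \<pp> N)"
  using subm_closed[OF subm_saturation[OF _ assms]] unfolding local_part_def by (intro submoduleI) auto

lemma local_part_upper: "subm N \<Longrightarrow> N \<subseteq> local_part \<pp> N"
  unfolding local_part_def using saturation_upper subm_closed(1) by blast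

text \<open>A maximal annihilator of a nonzero class is prime: if \<open>b\<close> does not kill the
  class of \<open>x\<close>, then b x has the same annihilator by maximality, so \<open>a\<close>
  with \<open>a \<otimes> b\<close> in it kills \<open>x\<close> already.\<close>

lemma exists_prime_colon:
  assumes N: "subm N" and H: "subm H" "\<not> H \<subseteq> N"
  obtains x where "x \<in> H" "prm (colon N x)"
proof -
  from H(2) obtain x0 where x0: "x0 \<in> H" "x0 \<notin> N" by blast
  let ?P = "\<lambda>I. \<exists>x. x \<in> H \<and> x \<notin> N \<and> I = colon N x"
  have c: "x \<in> carrier M" if "x \<in> H" for x using that subm_closed(1)[OF H(1)] by blast
  obtain J where J: "?P J" and max: "\<And>X. ideal X R \<Longrightarrow> ?P X \<Longrightarrow> J \<subseteq> X \<Longrightarrow> X = J"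
    by (rule maximal_ideal_property[of "colon N x0" ?P]) (use x0 c ideal_colon[OF N] in auto)
  then obtain x where x: "x \<in> H" "x \<notin> N" "J = colon N x" by blast
  have "prm (colon N x)"
  proof (rule primeidealI)
    show "ideal (colon N x) R" using ideal_colon[OF N] c x(1) by blast
    show "cring R" by (rule R.is_cring)
    show "carrier R \<noteq> colon N x" using colon_one[of x N] c x by auto
    fix a b assume ab: "a \<in> carrier R" "b \<in> carrier R" "a \<otimes> b \<in> colon N x"
    show "a \<in> colon N x \<or> b \<in> colon N x"
    proof (cases "b \<odot>\<^bsub>M\<^esub> x \<in> N")
      case False
      have bx: "b \<odot>\<^bsub>M\<^esub> x \<in> H" using x ab subm_closed(4)[OF H(1)] by blast
      have "colon N (b \<odot>\<^bsub>M\<^esub> x) = J"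
        by (rule max) (use False bx c x ab ideal_colon[OF N] colon_smult_mono[OF N] in auto)
      then show ?thesis using ab x c[OF x(1)] by (auto simp: colon_smult[OF N])
    qed (use ab in \<open>simp add: colon_def\<close>)
  qed
  then show thesis using that x by blast
qed

text \<open>The quotient (N + Rx)/N is R/\<qq> with \<qq> = \<open>colon N x\<close>. At \<pp> it
  becomes zero if \<qq> is not inside \<pp>, and the residue field if \<qq> = \<pp>; the case of
  infinite length, \<qq> properly inside \<pp>, is excluded.\<close>

lemma has_length_at_adjoin:
  assumes p: "prm \<pp>" and N: "subm N" and x: "x \<in> carrier M" and q: "prm (colon N x)" "\<not> colon N x \<subset> \<pp>"
  shows "has_length_at \<pp> N (adjoin N x) (if colon N x = \<pp> then 1 else 0)"
proof -
  note sub = subm_adjoin[OF N x] and up = adjoin_upper[OF N x]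
  have in_saturation: "adjoin N x \<subseteq> saturation \<pp> C" if "subm C" "N \<subseteq> C" "x \<in> saturation \<pp> C" for C
    using that saturation_upper[OF p that(1)] by (intro adjoin_least subm_saturation p) auto
  show ?thesis
  proof (cases "colon N x = \<pp>")
    case False
    then have "x \<in> saturation \<pp> N" using q(2) not_in_saturation_iff[OF x] by blast
    then show ?thesis using False in_saturation[OF N] has_length_at_0_iff[OF p N up(1)] by simp
  next
    case True
    then have nx: "x \<notin> saturation \<pp> N" using not_in_saturation_iff[OF x] by blast
    then have "chain_at \<pp> 1 N (adjoin N x)" using N up by auto
    moreover have "\<not> chain_at \<pp> (Suc 1) N (adjoin N x)"
    proof
      assume "chain_at \<pp> (Suc 1) N (adjoin N x)"
      then obtain C B where C: "subm C" "subm B" "N \<subseteq> B" "B \<subseteq> C" "C \<subseteq> adjoin N x"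
        "\<not> C \<subseteq> saturation \<pp> B" "\<not> adjoin N x \<subseteq> saturation \<pp> C" by auto
      \<comment> \<open>A submodule in between that is nonzero at \<pp> contains some r x with r
        outside \<pp>, hence x up to saturation; no second step fits above it.\<close>
      then obtain c where c: "c \<in> C" "c \<notin> saturation \<pp> N" using saturation_mono by blast
      then obtain n r where r: "n \<in> N" "r \<in> carrier R" "c = n \<oplus>\<^bsub>M\<^esub> r \<odot>\<^bsub>M\<^esub> x"
        using C(5) unfolding adjoin_def by blast
      have "r \<notin> \<pp>"
      proof
        assume "r \<in> \<pp>"
        then have "r \<odot>\<^bsub>M\<^esub> x \<in> N" using True by (auto simp: colon_def)
        then have "c \<in> N" using r subm_closed(3)[OF N] by simp
        with c show False using saturation_upper[OF p N] by blast
      qed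
      moreover have "r \<odot>\<^bsub>M\<^esub> x \<in> C" 
        using subm_add_cancel[OF C(1), of n "r \<odot>\<^bsub>M\<^esub> x"] C(3,4) r c x by auto
      ultimately have "x \<in> saturation \<pp> C" using r(2) x unfolding saturation_def by blast
      then show False using in_saturation[of C] C by blast
    qed
    ultimately show ?thesis using True unfolding has_length_at_def by simp
  qed
qed

text \<open>Finiteness comes from maximality: take X maximal of finite length over N inside the
  local part. If X were smaller, an element with prime annihilator modulo X could be adjoined,
  adding at most one to the length.\<close>

lemma has_length_at_mult_at:
  assumes p: "prm \<pp>" and N: "subm N"
  shows "has_length_at \<pp> N (local_part \<pp> N) (mult_at \<pp> N)"
proof -
  let ?H = "local_part \<pp> N"
  note H = subm_local_part[OF N, of \<pp>]
  let ?P = "\<lambda>X. N \<subseteq> X \<and> X \<subseteq> ?H \<and> (\<exists>n. has_length_at \<pp> N X n)"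
  have "?P N" using local_part_upper[OF N] has_length_at_0_iff[OF p N, of N] saturation_upper[OF p N] by auto
  then obtain X where X: "subm X" "?P X" and max: "\<And>Y. subm Y \<Longrightarrow> ?P Y \<Longrightarrow> X \<subseteq> Y \<Longrightarrow> Y = X"
    using maximal_submodule[OF N, of ?P] by blast
  have "?H \<subseteq> X"
  proof (rule ccontr)
    assume "\<not> ?H \<subseteq> X"
    then obtain x where x: "x \<in> ?H" "prm (colon X x)" using exists_prime_colon[OF X(1) H] by blast
    then have xc: "x \<in> carrier M" by (simp add: local_part_def)
    \<comment> \<open>Elements of the local part vanish at every prime \<qq> properly below \<pp>,
      so \<open>colon N x\<close> is not inside \<qq>; but it is inside
      \<open>colon X x\<close>.\<close>
    have "\<not> colon X x \<subset> \<pp>"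
    proof
      assume "colon X x \<subset> \<pp>"
      then have "x \<in> saturation (colon X x) N" using x by (auto simp: local_part_def)
      then have "\<not> colon N x \<subseteq> colon X x" using not_in_saturation_iff[OF xc] by blast
      then show False using colon_mono[of N X x] X(2) by blast
    qed
    from has_length_at_adjoin[OF p X(1) xc x(2) this] obtain k where k: "has_length_at \<pp> X (adjoin X x) k" by blast
    note sub = subm_adjoin[OF X(1) xc] and up = adjoin_upper[OF X(1) xc]
    obtain n where "has_length_at \<pp> N X n" using X(2) by blast
    then have "has_length_at \<pp> N (adjoin X x) (n + k)" using has_length_at_add[OF p N X(1) sub _ k] by blast
    moreover have "adjoin X x \<subseteq> ?H" using X(2) x(1) by (intro adjoin_least[OF H]) auto
    ultimately have "adjoin X x = X" using X(2) up by (intro max sub) auto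
    then have "x \<in> X" using up by auto
    then have "\<one> \<in> colon X x" using colon_one[OF xc] by blast
    then show False using prm_one[OF x(2)] by blast
  qed
  then have "X = ?H" using X(2) by blast
  then obtain n where n: "has_length_at \<pp> N ?H n" using X(2) by blast
  then show ?thesis unfolding mult_at_def by (rule theI) (rule has_length_at_unique[OF _ n])
qed

lemma mult_at_eqI: "prm \<pp> \<Longrightarrow> subm N \<Longrightarrow> has_length_at \<pp> N (local_part \<pp> N) n \<Longrightarrow> mult_at \<pp> N = n"
  using has_length_at_mult_at has_length_at_unique by blast

lemma mult_at_geI:
  assumes "prm \<pp>" "subm N" "chain_at \<pp> n N (local_part \<pp> N)"
  shows "n \<le> mult_at \<pp> N"
  using has_length_at_mult_at[OF assms(1,2)] chain_at_le[OF assms(3), of "Suc (mult_at \<pp> N)"]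
  unfolding has_length_at_def by (meson not_less_eq_eq)

text \<open>Under the hypothesis, M/N and M/N' have the same localizations at the primes properly
  below \<pp>, so the two local parts are the same submodule of M. The length from N up to it splits
  at N'.\<close>

lemma mult_at_add:
  assumes p: "prm \<pp>" and N: "subm N" and N': "subm N'" and le: "N \<subseteq> N'"
    and small: "\<And>\<qq>. prm \<qq> \<Longrightarrow> \<qq> \<subset> \<pp> \<Longrightarrow> N' \<subseteq> saturation \<qq> N"
  obtains k where "has_length_at \<pp> N N' k" "mult_at \<pp> N = k + mult_at \<pp> N'"
proof -
  have "saturation \<qq> N' = saturation \<qq> N" if "prm \<qq>" "\<qq> \<subset> \<pp>" for \<qq>
    using saturation_least[OF that(1) small[OF that]] saturation_mono[OF le] by blast
  then have eq: "local_part \<pp> N' = local_part \<pp> N" unfolding local_part_def by blast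
  then have le': "N' \<subseteq> local_part \<pp> N" using local_part_upper[OF N'] by blast
  obtain i j where ij: "has_length_at \<pp> N N' i" "has_length_at \<pp> N' (local_part \<pp> N) j" "mult_at \<pp> N = i + j"
    using has_length_at_split[OF p N N' subm_local_part[OF N] le le' has_length_at_mult_at[OF p N]] by blast
  then have "mult_at \<pp> N' = j" using eq by (intro mult_at_eqI p N') simp
  then show thesis using that ij by blast
qed

text \<open>Among the multiples of an element of the local part that survive at \<pp>, one with
  maximal annihilator is chosen. Survival forces this annihilator into \<pp>, and membership in the
  local part keeps it from being a smaller prime.\<close>

lemma mult_at_nonzero_Ass_quot:
  assumes p: "prm \<pp>" and N: "subm N" and e: "mult_at \<pp> N \<noteq> 0"
  shows "\<pp> \<in> Ass_quot N"
proof -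
  have "\<not> local_part \<pp> N \<subseteq> saturation \<pp> N"
    using e mult_at_eqI[OF p N, of 0] has_length_at_0_iff[OF p N local_part_upper[OF N, of \<pp>]] by auto
  then obtain x where x: "x \<in> local_part \<pp> N" "x \<notin> saturation \<pp> N" by blast
  then have xc: "x \<in> carrier M" by (simp add: local_part_def)
  let ?P = "\<lambda>I. \<exists>r \<in> carrier R. r \<odot>\<^bsub>M\<^esub> x \<notin> saturation \<pp> N \<and> I = colon N (r \<odot>\<^bsub>M\<^esub> x)"
  have P: "?P (colon N x)" using x xc by (intro bexI[of _ \<one>]) simp_all
  obtain J where J: "?P J" and max: "\<And>X. ideal X R \<Longrightarrow> ?P X \<Longrightarrow> J \<subseteq> X \<Longrightarrow> X = J"
    by (rule maximal_ideal_property[OF ideal_colon[OF N xc], of ?P, OF P]) simp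
  then obtain r where r: "r \<in> carrier R" "r \<odot>\<^bsub>M\<^esub> x \<notin> saturation \<pp> N" "J = colon N (r \<odot>\<^bsub>M\<^esub> x)" by blast
  define y where "y = r \<odot>\<^bsub>M\<^esub> x"
  have y: "y \<in> carrier M" "y \<notin> saturation \<pp> N" "J = colon N y" using r xc by (auto simp: y_def)
  have max': "colon N (b \<odot>\<^bsub>M\<^esub> y) = J" if "b \<in> carrier R" "b \<odot>\<^bsub>M\<^esub> y \<notin> saturation \<pp> N" for b
  proof (rule max)
    show "ideal (colon N (b \<odot>\<^bsub>M\<^esub> y)) R" using that y by (intro ideal_colon[OF N]) auto
    have "b \<odot>\<^bsub>M\<^esub> y = (b \<otimes> r) \<odot>\<^bsub>M\<^esub> x" using that r xc by (simp add: y_def smult_assoc1)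
    then show "?P (colon N (b \<odot>\<^bsub>M\<^esub> y))" using that r by (intro bexI[of _ "b \<otimes> r"]) auto
    show "J \<subseteq> colon N (b \<odot>\<^bsub>M\<^esub> y)" using y that colon_smult_mono[OF N] by auto
  qed
  have "prm (colon N y)"
  proof (rule primeidealI)
    show "ideal (colon N y) R" using ideal_colon[OF N y(1)] .
    show "cring R" by (rule R.is_cring)
    have "\<one> \<notin> colon N y" using colon_one[OF y(1)] y(2) saturation_upper[OF p N] by blast
    then show "carrier R \<noteq> colon N y" by auto
    fix a b assume ab: "a \<in> carrier R" "b \<in> carrier R" "a \<otimes> b \<in> colon N y"
    show "a \<in> colon N y \<or> b \<in> colon N y"
    proof (cases "b \<odot>\<^bsub>M\<^esub> y \<in> saturation \<pp> N")
      case False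
      then have "colon N (b \<odot>\<^bsub>M\<^esub> y) = colon N y" using max' ab y(3) by blast
      then show ?thesis using ab y(1) by (auto simp: colon_smult[OF N])
    next
      case True
      \<comment> \<open>Although b y dies at \<pp>, the multiple s y survives and by maximality has
        the annihilator of y; that annihilator contains b.\<close>
      then obtain s where s: "s \<in> carrier R - \<pp>" "s \<odot>\<^bsub>M\<^esub> (b \<odot>\<^bsub>M\<^esub> y) \<in> N" by (auto simp: saturation_def)
      have "s \<odot>\<^bsub>M\<^esub> y \<notin> saturation \<pp> N" using saturation_cancel[OF p s(1) y(1)] y(2) by blast
      then have "colon N (s \<odot>\<^bsub>M\<^esub> y) = colon N y" using max' s y(3) by blast
      moreover have "b \<in> colon N (s \<odot>\<^bsub>M\<^esub> y)" using s ab y(1) by (simp add: colon_def smult_commute)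
      ultimately show ?thesis by blast
    qed
  qed
  moreover have "colon N y \<subseteq> \<pp>" using not_in_saturation_iff[OF y(1)] y(2) by blast
  moreover have "\<not> colon N y \<subset> \<pp>"
  proof
    assume "colon N y \<subset> \<pp>"
    then have "x \<in> saturation (colon N y) N" using x(1) \<open>prm (colon N y)\<close> by (auto simp: local_part_def)
    then have "\<not> colon N x \<subseteq> colon N y" using not_in_saturation_iff[OF xc] by blast
    then show False using colon_smult_mono[OF N xc r(1)] by (simp add: y_def)
  qed
  ultimately show ?thesis using y(1) p unfolding Ass_quot_def by blast
qed

text \<open>In the domain R/\<qq> every nonzero element has annihilator \<qq>.\<close>

lemma colon_smult_prime:
  assumes N: "subm N" and x: "x \<in> carrier M" and q: "prm (colon N x)" and r: "r \<in> carrier R" "r \<notin> colon N x"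
  shows "colon N (r \<odot>\<^bsub>M\<^esub> x) = colon N x"
proof
  show "colon N (r \<odot>\<^bsub>M\<^esub> x) \<subseteq> colon N x"
    using primeideal.I_prime[OF q, of _ r] r by (auto simp: colon_smult[OF N x])
  show "colon N x \<subseteq> colon N (r \<odot>\<^bsub>M\<^esub> x)" using colon_smult_mono[OF N x r(1)] .
qed

text \<open>Noetherian induction from above: if Rx modulo N is R/\<qq>, passing from M/(N + Rx) to
  M/N adds at most the associated prime \<qq>.\<close>

lemma finite_Ass_quot: "subm N \<Longrightarrow> finite (Ass_quot N)"
proof (induction N rule: wf_induct_rule[OF wf_supermodule_rel])
  case (1 N)
  note N = 1(2)
  show ?case
  proof (cases "carrier M \<subseteq> N")
    case True
    then have "colon N x = carrier R" if "x \<in> carrier M" for x using that by (auto simp: colon_def)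
    then have "Ass_quot N = {}" using prm_one unfolding Ass_quot_def by fastforce
    then show ?thesis by simp
  next
    case False
    then obtain x where x: "x \<in> carrier M" and q: "prm (colon N x)"
      using exists_prime_colon[OF N carrier_is_submodule] by blast
    let ?N' = "adjoin N x"
    note N' = subm_adjoin[OF N x] and up = adjoin_upper[OF N x]
    have "x \<notin> N" using prm_one[OF q] colon_one[OF x] by blast
    then have "(?N', N) \<in> supermodule_rel R M" using N N' up by (auto simp: supermodule_rel_def)
    then have fin: "finite (Ass_quot ?N')" using 1(1) N' by blast
    have "Ass_quot N \<subseteq> insert (colon N x) (Ass_quot ?N')"
    proof
      fix \<pp> assume "\<pp> \<in> Ass_quot N"
      then obtain y where p: "prm \<pp>" and y: "y \<in> carrier M" "\<pp> = colon N y" by (auto simp: Ass_quot_def)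
      show "\<pp> \<in> insert (colon N x) (Ass_quot ?N')"
      proof (cases "\<exists>r\<in>carrier R. r \<odot>\<^bsub>M\<^esub> y \<in> ?N' - N")
        case True
        then obtain r where r: "r \<in> carrier R" "r \<odot>\<^bsub>M\<^esub> y \<in> ?N'" "r \<odot>\<^bsub>M\<^esub> y \<notin> N" by blast
        \<comment> \<open>Modulo N the nonzero class of r y is that of t x. As a multiple of y it
          has annihilator \<pp>, as a multiple of x it has annihilator
          \<open>colon N x\<close>.\<close>
        then obtain n t where t: "r \<odot>\<^bsub>M\<^esub> y = n \<oplus>\<^bsub>M\<^esub> t \<odot>\<^bsub>M\<^esub> x" "n \<in> N" "t \<in> carrier R" by (auto simp: adjoin_def)
        have nc: "n \<in> carrier M" using subm_closed(1)[OF N t(2)] .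
        have tx: "t \<notin> colon N x" using t r subm_closed(3)[OF N] by (auto simp: colon_def)
        have "a \<odot>\<^bsub>M\<^esub> (r \<odot>\<^bsub>M\<^esub> y) \<in> N \<longleftrightarrow> a \<odot>\<^bsub>M\<^esub> (t \<odot>\<^bsub>M\<^esub> x) \<in> N" if a: "a \<in> carrier R" for a
        proof -
          have "a \<odot>\<^bsub>M\<^esub> (r \<odot>\<^bsub>M\<^esub> y) = a \<odot>\<^bsub>M\<^esub> n \<oplus>\<^bsub>M\<^esub> a \<odot>\<^bsub>M\<^esub> (t \<odot>\<^bsub>M\<^esub> x)"
            unfolding t(1) using a nc t x by (simp add: smult_r_distr)
          moreover have "a \<odot>\<^bsub>M\<^esub> n \<in> N" using subm_closed(4)[OF N a t(2)] .
          moreover have "a \<odot>\<^bsub>M\<^esub> (t \<odot>\<^bsub>M\<^esub> x) \<in> carrier M" using a t x by simp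
          ultimately show ?thesis
            using subm_add_cancel[OF N, of "a \<odot>\<^bsub>M\<^esub> n" "a \<odot>\<^bsub>M\<^esub> (t \<odot>\<^bsub>M\<^esub> x)"]
              subm_closed(3)[OF N, of "a \<odot>\<^bsub>M\<^esub> n" "a \<odot>\<^bsub>M\<^esub> (t \<odot>\<^bsub>M\<^esub> x)"] by auto
        qed
        then have "colon N (r \<odot>\<^bsub>M\<^esub> y) = colon N (t \<odot>\<^bsub>M\<^esub> x)" by (auto simp: colon_def)
        moreover have "colon N (t \<odot>\<^bsub>M\<^esub> x) = colon N x" using colon_smult_prime[OF N x q t(3) tx] .
        moreover have "colon N (r \<odot>\<^bsub>M\<^esub> y) = \<pp>"
          unfolding y(2) by (rule colon_smult_prime[OF N y(1)]) (use p y r in \<open>auto simp: colon_def\<close>)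
        ultimately show ?thesis by blast
      next
        case False
        then have "colon ?N' y = colon N y" using up(1) by (auto simp: colon_def)
        then show ?thesis using p y unfolding Ass_quot_def by blast
      qed
    qed
    then show ?thesis using fin finite_subset by blast
  qed
qed

end

section \<open>Krull dimension of quotients\<close>

context cring
begin

definition prime_chain :: "nat \<Rightarrow> 'a set \<Rightarrow> bool" where
  "prime_chain n \<pp> \<longleftrightarrow> (\<exists>P. P 0 = \<pp> \<and> (\<forall>i\<le>n. primeideal (P i) R) \<and> (\<forall>i<n. P i \<subset> P (Suc i)))"

lemma quot_mult:
  "ideal I R \<Longrightarrow> a \<in> carrier R \<Longrightarrow> b \<in> carrier R \<Longrightarrow> (I +> a) \<otimes>\<^bsub>R Quot I\<^esub> (I +> b) = I +> (a \<otimes> b)"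
  using ring_hom_mult[OF ideal.rcos_ring_hom] by metis

lemma carrier_quot: "x \<in> carrier (R Quot I) \<longleftrightarrow> (\<exists>a\<in>carrier R. x = I +> a)"
  unfolding FactRing_def A_RCOSETS_def' by auto

text \<open>Ideals of the quotient are sets of cosets, so \<open>\<Union>J\<close> is the preimage
  of J in R.\<close>

lemma primeideal_quot_vimage:
  assumes I: "ideal I R" and J: "primeideal J (R Quot I)"
  shows "primeideal (\<Union>J) R" "I \<subseteq> \<Union>J" "(+>) I ` \<Union>J = J"
proof -
  have J': "ideal J (R Quot I)" using J by (rule primeideal.axioms(1))
  have sub: "J \<subseteq> carrier (R Quot I)" using ideal.Icarr[OF J'] by blast
  note bij = quot_ideal_correspondence[OF I]
  obtain K where K: "ideal K R" "I \<subseteq> K" "J = (+>) I ` K" using bij J' unfolding bij_betw_def by blast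
  have "\<Union>J = K" using ideal_incl_iff[OF I K(1)] K(2,3) by auto
  then show "I \<subseteq> \<Union>J" "(+>) I ` \<Union>J = J" using K by auto
  have mem: "a \<in> \<Union>J \<longleftrightarrow> I +> a \<in> J" if "a \<in> carrier R" for a
    using canonical_proj_vimage_mem_iff[OF I sub that] .
  show "primeideal (\<Union>J) R"
  proof (rule primeidealI)
    show "ideal (\<Union>J) R" using K \<open>\<Union>J = K\<close> by simp
    show "cring R" by (rule is_cring)
    show "carrier R \<noteq> \<Union>J"
    proof
      assume *: "carrier R = \<Union>J"
      have "carrier (R Quot I) \<subseteq> J" using mem * unfolding subset_iff carrier_quot by blast
      then show False using sub primeideal.I_notcarr[OF J] by blast
    qed
    fix a b assume ab: "a \<in> carrier R" "b \<in> carrier R" "a \<otimes> b \<in> \<Union>J"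
    then have "(I +> a) \<otimes>\<^bsub>R Quot I\<^esub> (I +> b) \<in> J" using mem[of "a \<otimes> b"] by (simp add: quot_mult[OF I])
    then have "I +> a \<in> J \<or> I +> b \<in> J"
      using primeideal.I_prime[OF J, of "I +> a" "I +> b"] ab by (auto simp: carrier_quot)
    then show "a \<in> \<Union>J \<or> b \<in> \<Union>J" using mem ab by blast
  qed
qed

lemma primeideal_quot_image:
  assumes I: "ideal I R" and K: "primeideal K R" "I \<subseteq> K"
  shows "primeideal ((+>) I ` K) (R Quot I)" "\<Union>((+>) I ` K) = K"
proof -
  have K': "ideal K R" using K(1) by (rule primeideal.axioms(1))
  show U: "\<Union>((+>) I ` K) = K" using ideal_incl_iff[OF I K'] K(2) by auto
  have sub: "(+>) I ` K \<subseteq> carrier (R Quot I)"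
  proof
    fix x assume "x \<in> (+>) I ` K"
    then obtain a where "a \<in> K" "x = I +> a" by blast
    then show "x \<in> carrier (R Quot I)" unfolding carrier_quot using ideal.Icarr[OF K'] by blast
  qed
  have mem: "I +> a \<in> (+>) I ` K \<longleftrightarrow> a \<in> K" if "a \<in> carrier R" for a
    using canonical_proj_vimage_mem_iff[OF I sub that] U by simp
  show "primeideal ((+>) I ` K) (R Quot I)"
  proof (rule primeidealI)
    show "ideal ((+>) I ` K) (R Quot I)" using ring_ideal_imp_quot_ideal[OF I K'] .
    show "cring (R Quot I)" using ideal.quotient_is_cring[OF I is_cring] .
    show "carrier (R Quot I) \<noteq> (+>) I ` K"
    proof
      assume *: "carrier (R Quot I) = (+>) I ` K"
      have "carrier R \<subseteq> K"
      proof
        fix a assume a: "a \<in> carrier R"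
        then have "I +> a \<in> carrier (R Quot I)" unfolding carrier_quot by blast
        then show "a \<in> K" using mem[OF a] * by simp
      qed
      then show False using primeideal.I_notcarr[OF K(1)] ideal.Icarr[OF K'] by blast
    qed
    fix x y assume "x \<in> carrier (R Quot I)" "y \<in> carrier (R Quot I)" and xy: "x \<otimes>\<^bsub>R Quot I\<^esub> y \<in> (+>) I ` K"
    then obtain a b where ab: "a \<in> carrier R" "b \<in> carrier R" "x = I +> a" "y = I +> b" by (auto simp: carrier_quot)
    then have "a \<otimes> b \<in> K" using xy mem[of "a \<otimes> b"] by (simp add: quot_mult[OF I])
    then have "a \<in> K \<or> b \<in> K" by (rule primeideal.I_prime[OF K(1) ab(1,2)])
    then show "x \<in> (+>) I ` K \<or> y \<in> (+>) I ` K" unfolding ab(3,4) by blast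
  qed
qed

lemma prime_chain_quot:
  assumes p: "primeideal \<pp> R"
  shows "prime_chain n \<pp> \<longleftrightarrow>
    (\<exists>P. (\<forall>i\<le>n. P i \<in> Spec (R Quot \<pp>)) \<and> (\<forall>i<n. P i \<subset> P (Suc i)))"
proof
  have I: "ideal \<pp> R" using p by (rule primeideal.axioms(1))
  assume "prime_chain n \<pp>"
  then obtain P where P: "P 0 = \<pp>" "\<And>i. i \<le> n \<Longrightarrow> primeideal (P i) R" "\<And>i. i < n \<Longrightarrow> P i \<subset> P (Suc i)"
    by (auto simp: prime_chain_def)
  have le: "\<pp> \<subseteq> P i" if "i \<le> n" for i
    using that
  proof (induction i)
    case (Suc i)
    then have "\<pp> \<subseteq> P i" "P i \<subset> P (Suc i)" using P(3)[of i] by simp_all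
    then show ?case by blast
  qed (simp add: P(1))
  show "\<exists>P. (\<forall>i\<le>n. P i \<in> Spec (R Quot \<pp>)) \<and> (\<forall>i<n. P i \<subset> P (Suc i))"
  proof (intro exI[of _ "\<lambda>i. (+>) \<pp> ` P i"] conjI allI impI)
    fix i assume i: "i \<le> n"
    show "(+>) \<pp> ` P i \<in> Spec (R Quot \<pp>)"
      unfolding Spec_def using primeideal_quot_image(1)[OF I P(2)[OF i] le[OF i]] by blast
  next
    fix i assume i: "i < n"
    then have i': "i \<le> n" "Suc i \<le> n" by simp_all
    have "(+>) \<pp> ` P i \<noteq> (+>) \<pp> ` P (Suc i)"
    proof
      assume "(+>) \<pp> ` P i = (+>) \<pp> ` P (Suc i)"
      then have "\<Union>((+>) \<pp> ` P i) = \<Union>((+>) \<pp> ` P (Suc i))" by (rule arg_cong)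
      then have "P i = P (Suc i)"
        unfolding primeideal_quot_image(2)[OF I P(2)[OF i'(1)] le[OF i'(1)]]
          primeideal_quot_image(2)[OF I P(2)[OF i'(2)] le[OF i'(2)]] .
      with P(3)[OF i] show False by blast
    qed
    moreover have "(+>) \<pp> ` P i \<subseteq> (+>) \<pp> ` P (Suc i)" using P(3)[OF i] by (intro image_mono) blast
    ultimately show "(+>) \<pp> ` P i \<subset> (+>) \<pp> ` P (Suc i)" by (rule psubsetI[rotated])
  qed
next
  have I: "ideal \<pp> R" using p by (rule primeideal.axioms(1))
  assume "\<exists>P. (\<forall>i\<le>n. P i \<in> Spec (R Quot \<pp>)) \<and> (\<forall>i<n. P i \<subset> P (Suc i))"
  then obtain P where P: "\<And>i. i \<le> n \<Longrightarrow> primeideal (P i) (R Quot \<pp>)" "\<And>i. i < n \<Longrightarrow> P i \<subset> P (Suc i)"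
    by (auto simp: Spec_def)
  \<comment> \<open>A chain in the quotient need not begin with the zero ideal; replacing its first
    member by \<pp> keeps the length and the strict inclusions.\<close>
  define Q where "Q i = (if i = 0 then \<pp> else \<Union>(P i))" for i
  note im = primeideal_quot_vimage[OF I P(1)]
  have step: "\<Union>(P i) \<subset> \<Union>(P (Suc i))" if "i < n" for i
  proof -
    have "(+>) \<pp> ` \<Union>(P i) = P i" "(+>) \<pp> ` \<Union>(P (Suc i)) = P (Suc i)" using that im(3) by simp_all
    then have "\<Union>(P i) \<noteq> \<Union>(P (Suc i))" using P(2)[OF that] by (metis psubset_imp_subset less_irrefl)
    moreover have "\<Union>(P i) \<subseteq> \<Union>(P (Suc i))" using P(2)[OF that] by (intro Union_mono) simp
    ultimately show ?thesis by (rule psubsetI[rotated])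
  qed
  have "Q i \<subset> Q (Suc i)" if "i < n" for i
  proof (cases i)
    case 0
    have "\<pp> \<subseteq> \<Union>(P 0)" using im(2) by simp
    then show ?thesis using step[OF that] 0 by (auto simp: Q_def)
  qed (use step[OF that] in \<open>simp add: Q_def\<close>)
  moreover have "primeideal (Q i) R" if "i \<le> n" for i
    using p im(1)[OF that] by (simp add: Q_def)
  moreover have "Q 0 = \<pp>" by (simp add: Q_def)
  ultimately show "prime_chain n \<pp>" unfolding prime_chain_def by blast
qed

lemma prime_chain_Suc: "prime_chain (Suc n) \<pp> \<Longrightarrow> prime_chain n \<pp>"
proof -
  assume "prime_chain (Suc n) \<pp>"
  then obtain P where "P 0 = \<pp>" "\<forall>i\<le>Suc n. primeideal (P i) R" "\<forall>i<Suc n. P i \<subset> P (Suc i)"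
    by (auto simp: prime_chain_def)
  then show ?thesis unfolding prime_chain_def by (intro exI[of _ P]) simp
qed

lemma prime_chain_le: "prime_chain n \<pp> \<Longrightarrow> m \<le> n \<Longrightarrow> prime_chain m \<pp>"
  by (induction n) (auto simp: le_Suc_eq dest: prime_chain_Suc)

lemma krull_dim_quot:
  assumes "krull_dim R < \<infinity>" and p: "primeideal \<pp> R"
  shows "prime_chain n \<pp> \<longleftrightarrow> n \<le> the_enat (krull_dim (R Quot \<pp>))"
    and "the_enat (krull_dim (R Quot \<pp>)) \<le> the_enat (krull_dim R)"
proof -
  have K: "krull_dim (R Quot \<pp>) = Sup {enat n | n. prime_chain n \<pp>}"
    unfolding krull_dim_def prime_chain_quot[OF p] ..
  obtain D where D: "krull_dim R = enat D" using assms(1) by (cases "krull_dim R") auto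
  have bound: "n \<le> D" if "prime_chain n \<pp>" for n
  proof -
    have "enat n \<le> krull_dim R" unfolding krull_dim_def
      using that by (intro Sup_upper) (auto simp: prime_chain_def Spec_def)
    then show ?thesis by (simp add: D)
  qed
  have "prime_chain 0 \<pp>" using p unfolding prime_chain_def by (intro exI[of _ "\<lambda>_. \<pp>"]) auto
  \<comment> \<open>The dimension of R bounds the lengths, so the supremum is attained and
    \<open>the_enat\<close> loses nothing.\<close>
  define d where "d = (GREATEST n. prime_chain n \<pp>)"
  have d: "prime_chain d \<pp>" "\<And>n. prime_chain n \<pp> \<Longrightarrow> n \<le> d"
    unfolding d_def using GreatestI_nat[of "\<lambda>n. prime_chain n \<pp>", OF \<open>prime_chain 0 \<pp>\<close> bound]
      Greatest_le_nat[of "\<lambda>n. prime_chain n \<pp>", OF _ bound] by blast+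
  have "krull_dim (R Quot \<pp>) = enat d" unfolding K
    by (intro antisym Sup_least Sup_upper) (use d in auto)
  then have e: "the_enat (krull_dim (R Quot \<pp>)) = d" by simp
  show "prime_chain n \<pp> \<longleftrightarrow> n \<le> the_enat (krull_dim (R Quot \<pp>))" unfolding e using d prime_chain_le by blast
  show "the_enat (krull_dim (R Quot \<pp>)) \<le> the_enat (krull_dim R)" unfolding e D using bound[OF d(1)] by simp
qed

end

section \<open>The height rank\<close>

locale finite_dim_noetherian_module = noetherian_module R M for R (structure) and M (structure) +
  assumes fin_dim: "krull_dim R < \<infinity>"
begin

definition coheight :: "'a set \<Rightarrow> nat" where
  "coheight \<pp> = the_enat (krull_dim (R Quot \<pp>))"

text \<open>Restricting the index set to nonzero multiplicities keeps it finite; over an infinite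
  set \<open>sum\<close> would return 0.\<close>

definition mult_of_dim :: "'c set \<Rightarrow> nat \<Rightarrow> nat" where
  "mult_of_dim N n = (\<Sum>\<pp> | prm \<pp> \<and> coheight \<pp> = n \<and> mult_at \<pp> N \<noteq> 0. mult_at \<pp> N)"

section \<open>Coheight of primes\<close>

lemma prime_chain_iff: "prm \<pp> \<Longrightarrow> R.prime_chain n \<pp> \<longleftrightarrow> n \<le> coheight \<pp>"
  unfolding coheight_def by (rule R.krull_dim_quot(1)[OF fin_dim])

lemma coheight_le: "prm \<pp> \<Longrightarrow> coheight \<pp> \<le> the_enat (krull_dim R)"
  unfolding coheight_def by (rule R.krull_dim_quot(2)[OF fin_dim])

lemma coheight_strict_antimono:
  assumes p: "prm \<pp>" and q: "prm \<qq>" and "\<pp> \<subset> \<qq>"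
  shows "coheight \<qq> < coheight \<pp>"
proof -
  obtain P where P: "P 0 = \<qq>" "\<forall>i\<le>coheight \<qq>. prm (P i)" "\<forall>i<coheight \<qq>. P i \<subset> P (Suc i)"
    using prime_chain_iff[OF q, of "coheight \<qq>"] by (auto simp: R.prime_chain_def)
  have "R.prime_chain (Suc (coheight \<qq>)) \<pp>" unfolding R.prime_chain_def
    using P p assms(3) by (intro exI[of _ "case_nat \<pp> P"]) (auto split: nat.split simp: less_Suc_eq_0_disj)
  then show ?thesis using prime_chain_iff[OF p] by simp
qed

text \<open>The second member of a longest chain from \<pp> works: the rest of the chain bounds its
  coheight below, strict antitonicity bounds it above.\<close>

lemma coheight_Suc:
  assumes p: "prm \<pp>" and d: "coheight \<pp> = Suc i"
  obtains \<qq> where "prm \<qq>" "\<pp> \<subset> \<qq>" "coheight \<qq> = i"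
proof -
  obtain P where P: "P 0 = \<pp>" "\<forall>j\<le>Suc i. prm (P j)" "\<forall>j<Suc i. P j \<subset> P (Suc j)"
    using prime_chain_iff[OF p, of "Suc i"] d by (auto simp: R.prime_chain_def)
  have q: "prm (P 1)" "\<pp> \<subset> P 1" using P(1,2) P(3)[rule_format, of 0] by auto
  have "R.prime_chain i (P 1)" unfolding R.prime_chain_def
    using P by (intro exI[of _ "\<lambda>j. P (Suc j)"]) auto
  then have "coheight (P 1) = i"
    using prime_chain_iff[OF q(1)] coheight_strict_antimono[OF p q] d by simp
  then show thesis using that q by blast
qed

section \<open>Change of the coefficients when the submodule grows\<close>

lemma finite_mult_at_support: "subm N \<Longrightarrow> finite {\<pp>. prm \<pp> \<and> mult_at \<pp> N \<noteq> 0}"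
  by (rule finite_subset[OF _ finite_Ass_quot]) (auto dest: mult_at_nonzero_Ass_quot)

lemma mult_of_dim_eq_sum:
  assumes "finite F" "\<And>\<pp>. \<pp> \<in> F \<Longrightarrow> prm \<pp>" "\<And>\<pp>. prm \<pp> \<Longrightarrow> mult_at \<pp> N \<noteq> 0 \<Longrightarrow> \<pp> \<in> F"
  shows "mult_of_dim N n = (\<Sum>\<pp> | \<pp> \<in> F \<and> coheight \<pp> = n. mult_at \<pp> N)"
  unfolding mult_of_dim_def using assms by (intro sum.mono_neutral_left) auto

text \<open>\<open>T\<close> is the support of N'/N and \<open>d\<close> the largest coheight in it.
  A prime of coheight at least \<open>d\<close> has no member of \<open>T\<close> properly below it,
  so its multiplicity drops by exactly the length of N'/N there, which is nonzero precisely on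
  \<open>T\<close>.\<close>

lemma mult_of_dim_decreases:
  assumes N: "subm N" and N': "subm N'" and less: "N \<subset> N'"
  obtains d where "d \<le> the_enat (krull_dim R)" "mult_of_dim N' d < mult_of_dim N d" "\<And>i. d < i \<Longrightarrow> mult_of_dim N' i = mult_of_dim N i"
proof -
  define T where "T = {\<qq>. prm \<qq> \<and> \<not> N' \<subseteq> saturation \<qq> N}"
  obtain x where x: "x \<in> N'" "prm (colon N x)" using exists_prime_colon[OF N N'] less by blast
  have xc: "x \<in> carrier M" using subm_closed(1)[OF N' x(1)] .
  have "x \<notin> saturation (colon N x) N" using not_in_saturation_iff[OF xc] by blast
  then have T: "colon N x \<in> T" using x by (auto simp: T_def)
  have cT: "coheight ` T \<subseteq> {..the_enat (krull_dim R)}" using coheight_le by (auto simp: T_def)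
  then have fin: "finite (coheight ` T)" using finite_subset by blast
  define d where "d = Max (coheight ` T)"
  have "d \<in> coheight ` T" unfolding d_def using fin T by (intro Max_in) auto
  then obtain q0 where q0: "q0 \<in> T" "coheight q0 = d" by blast
  have max: "coheight \<qq> \<le> d" if "\<qq> \<in> T" for \<qq> unfolding d_def using fin that by (intro Max_ge) auto
  have *: "if \<pp> \<in> T then mult_at \<pp> N' < mult_at \<pp> N else mult_at \<pp> N' = mult_at \<pp> N"
    if p: "prm \<pp>" and "d \<le> coheight \<pp>" for \<pp>
  proof -
    have "N' \<subseteq> saturation \<qq> N" if "prm \<qq>" "\<qq> \<subset> \<pp>" for \<qq>
      using max[of \<qq>] coheight_strict_antimono[OF that(1) p that(2)] that \<open>d \<le> coheight \<pp>\<close> by (auto simp: T_def)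
    then obtain k where k: "has_length_at \<pp> N N' k" "mult_at \<pp> N = k + mult_at \<pp> N'"
      using mult_at_add[OF p N N'] less by blast
    have "has_length_at \<pp> N N' 0 \<longleftrightarrow> \<pp> \<notin> T"
      using has_length_at_0_iff[OF p N, of N'] less p by (simp add: T_def psubset_imp_subset)
    then have "k = 0 \<longleftrightarrow> \<pp> \<notin> T" using k(1) has_length_at_unique[OF k(1), of 0] by metis
    then show ?thesis using k(2) by (cases "\<pp> \<in> T") simp_all
  qed
  define F where "F = {\<pp>. prm \<pp> \<and> mult_at \<pp> N \<noteq> 0} \<union> {\<pp>. prm \<pp> \<and> mult_at \<pp> N' \<noteq> 0}"
  have F: "finite F" using finite_mult_at_support N N' by (simp add: F_def)
  have c: "mult_of_dim N n = (\<Sum>\<pp> | \<pp> \<in> F \<and> coheight \<pp> = n. mult_at \<pp> N)" "mult_of_dim N' n = (\<Sum>\<pp> | \<pp> \<in> F \<and> coheight \<pp> = n. mult_at \<pp> N')" for n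
    by ((rule mult_of_dim_eq_sum[OF F]; auto simp: F_def)+)
  show thesis
  proof (rule that)
    show "d \<le> the_enat (krull_dim R)" using q0 coheight_le by (auto simp: T_def)
    show "mult_of_dim N' i = mult_of_dim N i" if "d < i" for i
      unfolding c
    proof (rule sum.cong)
      fix \<pp> assume "\<pp> \<in> {\<pp>. \<pp> \<in> F \<and> coheight \<pp> = i}"
      then have "prm \<pp>" "d < coheight \<pp>" using that by (auto simp: F_def)
      then show "mult_at \<pp> N' = mult_at \<pp> N" using *[of \<pp>] max[of \<pp>] by (auto split: if_splits)
    qed simp
    show "mult_of_dim N' d < mult_of_dim N d"
      unfolding c
    proof (rule sum_strict_mono_ex1)
      show "finite {\<pp>. \<pp> \<in> F \<and> coheight \<pp> = d}" using F by simp
      show "\<forall>\<pp>\<in>{\<pp>. \<pp> \<in> F \<and> coheight \<pp> = d}. mult_at \<pp> N' \<le> mult_at \<pp> N"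
      proof
        fix \<pp> assume "\<pp> \<in> {\<pp>. \<pp> \<in> F \<and> coheight \<pp> = d}"
        then have "prm \<pp>" "d \<le> coheight \<pp>" by (auto simp: F_def)
        then show "mult_at \<pp> N' \<le> mult_at \<pp> N" using *[of \<pp>] by (auto split: if_splits)
      qed
      have "mult_at q0 N' < mult_at q0 N" using *[of q0] q0 by (simp add: T_def)
      moreover have "q0 \<in> F" using q0 calculation by (auto simp: F_def T_def)
      ultimately show "\<exists>\<pp>\<in>{\<pp>. \<pp> \<in> F \<and> coheight \<pp> = d}. mult_at \<pp> N' < mult_at \<pp> N" using q0 by blast
    qed
  qed
qed

text \<open>The quotient (N + Rx)/N is R/\<pp> with \<pp> = \<open>colon N x\<close>, of dimension
  \<open>i\<close>. Among primes of coheight at least \<open>i\<close> it is nonzero only at \<pp>,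
  with length one.\<close>

lemma mult_of_dim_adjoin:
  assumes N: "subm N" and x: "x \<in> carrier M" and p: "prm (colon N x)" and i: "coheight (colon N x) = i"
  shows "Suc (mult_of_dim (adjoin N x) i) = mult_of_dim N i" "\<And>j. i < j \<Longrightarrow> mult_of_dim (adjoin N x) j = mult_of_dim N j"
proof -
  let ?N' = "adjoin N x"
  let ?p = "colon N x"
  note N' = subm_adjoin[OF N x] and up = adjoin_upper[OF N x]
  have *: "mult_at \<qq> N = (if \<qq> = ?p then 1 else 0) + mult_at \<qq> ?N'" if q: "prm \<qq>" and ci: "i \<le> coheight \<qq>" for \<qq>
  proof -
    have "?N' \<subseteq> saturation \<qq>' N" if q': "prm \<qq>'" "\<qq>' \<subset> \<qq>" for \<qq>'
    proof -
      \<comment> \<open>A prime containing \<open>?p\<close> has coheight at most \<open>i\<close>,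
        whereas one properly below \<qq> has coheight more than \<open>i\<close>.\<close>
      have "\<not> ?p \<subseteq> \<qq>'"
        using coheight_strict_antimono[OF q'(1) q q'(2)] ci i coheight_strict_antimono[OF p q'(1)] by (cases "?p = \<qq>'") auto
      then have "x \<in> saturation \<qq>' N" using not_in_saturation_iff[OF x] by blast
      then show ?thesis using saturation_upper[OF q'(1) N] by (intro adjoin_least subm_saturation q' N) auto
    qed
    then obtain k where k: "has_length_at \<qq> N ?N' k" "mult_at \<qq> N = k + mult_at \<qq> ?N'"
      using mult_at_add[OF q N N' up(1)] by blast
    have "\<not> ?p \<subset> \<qq>" using coheight_strict_antimono[OF p q] ci i by auto
    then have "k = (if \<qq> = ?p then 1 else 0)" using has_length_at_unique[OF k(1) has_length_at_adjoin[OF q N x p]] by auto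
    then show ?thesis using k by simp
  qed
  define F where "F = {\<pp>. prm \<pp> \<and> mult_at \<pp> N \<noteq> 0} \<union> {\<pp>. prm \<pp> \<and> mult_at \<pp> ?N' \<noteq> 0}"
  have F: "finite F" using finite_mult_at_support N N' by (simp add: F_def)
  have c: "mult_of_dim N n = (\<Sum>\<pp> | \<pp> \<in> F \<and> coheight \<pp> = n. mult_at \<pp> N)" "mult_of_dim ?N' n = (\<Sum>\<pp> | \<pp> \<in> F \<and> coheight \<pp> = n. mult_at \<pp> ?N')" for n
    by ((rule mult_of_dim_eq_sum[OF F]; auto simp: F_def)+)
  have pF: "?p \<in> F" using *[OF p] i p by (simp add: F_def)
  have "mult_of_dim N i = (\<Sum>\<pp> | \<pp> \<in> F \<and> coheight \<pp> = i. (if \<pp> = ?p then 1 else 0) + mult_at \<pp> ?N')"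
    unfolding c by (rule sum.cong[OF refl], rule *) (auto simp: F_def)
  also have "\<dots> = Suc (mult_of_dim ?N' i)"
    unfolding c using F pF i by (simp add: sum.distrib sum.delta)
  finally show "Suc (mult_of_dim ?N' i) = mult_of_dim N i" by simp
  show "mult_of_dim ?N' j = mult_of_dim N j" if "i < j" for j
    unfolding c
  proof (rule sum.cong)
    fix \<pp> assume "\<pp> \<in> {\<pp>. \<pp> \<in> F \<and> coheight \<pp> = j}"
    then have "prm \<pp>" "i \<le> coheight \<pp>" "\<pp> \<noteq> ?p" using that i by (auto simp: F_def)
    then show "mult_at \<pp> ?N' = mult_at \<pp> N" using *[of \<pp>] by auto
  qed simp
qed

text \<open>Modulo N the class of z = f^m y has annihilator \<pp> = \<open>colon N y\<close>, so (N
  + Rz)/(N + R f z) is R/(\<pp> + fR), which is nonzero at \<qq> because \<qq> contains \<pp> and f.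
  After \<open>k\<close> steps the exponent has come down from \<open>n\<close> to
  \<open>n - k\<close>.\<close>

lemma chain_at_powers:
  assumes N: "subm N" and y: "y \<in> carrier M" and p: "prm (colon N y)" and q: "prm \<qq>" "colon N y \<subset> \<qq>"
    and f: "f \<in> \<qq>" "f \<notin> colon N y" and "k \<le> n"
  shows "chain_at \<qq> k (adjoin N ((f [^] n) \<odot>\<^bsub>M\<^esub> y)) (adjoin N ((f [^] (n - k)) \<odot>\<^bsub>M\<^esub> y))"
  using \<open>k \<le> n\<close>
proof (induction k)
  case (Suc k)
  have fc: "f \<in> carrier R" using f prm_subset[OF q(1)] by blast
  define m where "m = n - Suc k"
  have m: "n - k = Suc m" using Suc(2) by (simp add: m_def)
  let ?z = "(f [^] m) \<odot>\<^bsub>M\<^esub> y"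
  have z: "?z \<in> carrier M" using fc y by simp
  have fz: "(f [^] Suc m) \<odot>\<^bsub>M\<^esub> y = f \<odot>\<^bsub>M\<^esub> ?z" using fc y by (simp add: smult_assoc1[symmetric] R.m_comm)
  let ?C = "adjoin N (f \<odot>\<^bsub>M\<^esub> ?z)"
  have C: "subm ?C" using N fc z by (intro subm_adjoin) auto
  have "?C \<subseteq> adjoin N ?z"
    using adjoin_upper[OF N z] subm_closed(4)[OF subm_adjoin[OF N z] fc] by (intro adjoin_least subm_adjoin N z) auto
  moreover have "?z \<notin> saturation \<qq> ?C"
  proof
    assume "?z \<in> saturation \<qq> ?C"
    then obtain s u r where s: "s \<in> carrier R - \<qq>" "s \<odot>\<^bsub>M\<^esub> ?z = u \<oplus>\<^bsub>M\<^esub> r \<odot>\<^bsub>M\<^esub> (f \<odot>\<^bsub>M\<^esub> ?z)" "u \<in> N" "r \<in> carrier R"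
      by (auto simp: saturation_def adjoin_def)
    have u: "u \<in> carrier M" using subm_closed(1)[OF N s(3)] .
    \<comment> \<open>The relation s z = u + r f z puts s - r f into the annihilator of z modulo N,
      hence into \<qq>; so s would lie in \<qq>.\<close>
    have "(s \<ominus> r \<otimes> f) \<odot>\<^bsub>M\<^esub> ?z = s \<odot>\<^bsub>M\<^esub> ?z \<ominus>\<^bsub>M\<^esub> r \<odot>\<^bsub>M\<^esub> (f \<odot>\<^bsub>M\<^esub> ?z)"
      using s(1,4) fc z by (simp add: a_minus_def smult_l_distr smult_l_minus smult_assoc1)
    also have "\<dots> = u" unfolding s(2) using u s(4) fc z by (simp add: a_minus_def M.a_assoc M.r_neg)
    finally have "(s \<ominus> r \<otimes> f) \<odot>\<^bsub>M\<^esub> ?z \<in> N" using s(3) by simp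
    then have "s \<ominus> r \<otimes> f \<in> colon N ?z" using s fc by (simp add: colon_def)
    moreover have "f [^] m \<notin> colon N y" using prm_pow[OF p, of f m] fc f by blast
    ultimately have "s \<ominus> r \<otimes> f \<in> \<qq>" using colon_smult_prime[OF N y p, of "f [^] m"] fc q(2) by auto
    moreover have "r \<otimes> f \<in> \<qq>" using ideal.I_l_closed[OF primeideal.axioms(1)[OF q(1)]] s f by blast
    ultimately have "(s \<ominus> r \<otimes> f) \<oplus> r \<otimes> f \<in> \<qq>"
      using additive_subgroup.a_closed[OF ideal.axioms(1)[OF primeideal.axioms(1)[OF q(1)]]] by blast
    moreover have "(s \<ominus> r \<otimes> f) \<oplus> r \<otimes> f = s" using s fc by (simp add: a_minus_def R.a_assoc R.l_neg)
    ultimately show False using s by simp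
  qed
  then have "\<not> adjoin N ?z \<subseteq> saturation \<qq> ?C" using adjoin_upper(2)[OF N z] by blast
  moreover have "chain_at \<qq> k (adjoin N ((f [^] n) \<odot>\<^bsub>M\<^esub> y)) ?C" using Suc m fz by simp
  ultimately show ?case using C unfolding m_def[symmetric] by auto
qed simp

text \<open>The element x = f^n y has the annihilator of y for every \<open>n\<close>, so the effect
  in degrees \<ge> \<open>i\<close> is independent of \<open>n\<close>. What remains is to place the
  chain up to N + Ry inside the local part at \<qq>, so that it counts in degree
  \<open>i - 1\<close>.\<close>

lemma exists_mult_of_dim_drop:
  assumes N: "subm N" and "0 < mult_of_dim N i"
  obtains N' where "subm N'" "N \<subset> N'" "Suc (mult_of_dim N' i) = mult_of_dim N i" "\<And>j. i < j \<Longrightarrow> mult_of_dim N' j = mult_of_dim N j"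
    "0 < i \<Longrightarrow> n \<le> mult_of_dim N' (i - 1)"
proof -
  have "\<exists>\<pp>. prm \<pp> \<and> coheight \<pp> = i \<and> mult_at \<pp> N \<noteq> 0"
  proof (rule ccontr)
    assume *: "\<not> ?thesis"
    then have "{\<pp>. prm \<pp> \<and> coheight \<pp> = i \<and> mult_at \<pp> N \<noteq> 0} = {}" by blast
    then have "mult_of_dim N i = 0" unfolding mult_of_dim_def by (metis sum.empty)
    with assms(2) show False by simp
  qed
  then obtain \<pp> where "prm \<pp>" "coheight \<pp> = i" "mult_at \<pp> N \<noteq> 0" by blast
  then obtain y where y: "y \<in> carrier M" and p: "prm (colon N y)" and i: "coheight (colon N y) = i"
    using mult_at_nonzero_Ass_quot[OF _ N] unfolding Ass_quot_def by blast
  have new: "N \<subset> adjoin N x" if "x \<in> carrier M" "prm (colon N x)" for x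
    using adjoin_upper[OF N that(1)] prm_one[OF that(2)] colon_one[OF that(1)] by blast
  show thesis
  proof (cases i)
    case 0
    show thesis
      by (rule that[of "adjoin N y"]) (use mult_of_dim_adjoin[OF N y p i] subm_adjoin[OF N y] new[OF y p] 0 in auto)
  next
    case (Suc d)
    then obtain \<qq> where q: "prm \<qq>" "colon N y \<subset> \<qq>" "coheight \<qq> = d" using coheight_Suc[OF p] i by blast
    then obtain f where f: "f \<in> \<qq>" "f \<notin> colon N y" by blast
    have fc: "f \<in> carrier R" using f prm_subset[OF q(1)] by blast
    have fn: "f [^] k \<notin> colon N y" for k :: nat using prm_pow[OF p, of f k] fc f by blast
    define x where "x = (f [^] n) \<odot>\<^bsub>M\<^esub> y"
    have x: "x \<in> carrier M" using fc y by (simp add: x_def)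
    have cx: "colon N x = colon N y" unfolding x_def using colon_smult_prime[OF N y p _ fn] fc by simp
    let ?N' = "adjoin N x"
    note N' = subm_adjoin[OF N x] and up = adjoin_upper[OF N x]
    \<comment> \<open>A prime properly below \<qq> at which y survives would contain f^n, hence f,
      and so contain \<open>colon N y\<close> properly; its coheight would lie strictly between d
      and d + 1.\<close>
    have "y \<in> saturation \<qq>' ?N'" if q': "prm \<qq>'" "\<qq>' \<subset> \<qq>" for \<qq>'
    proof (rule ccontr)
      assume "y \<notin> saturation \<qq>' ?N'"
      then have le: "colon ?N' y \<subseteq> \<qq>'" using not_in_saturation_iff[OF y] by blast
      have "f [^] n \<in> colon ?N' y" using up(2) fc by (simp add: colon_def x_def)
      then have fnq: "f [^] n \<in> \<qq>'" using le by blast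
      have "f \<in> \<qq>'" using prm_pow[OF q'(1), of f n] fnq fc by blast
      then have "colon N y \<subset> \<qq>'" using le colon_mono[OF up(1), of y] f by blast
      then have "coheight \<qq>' < Suc d" using coheight_strict_antimono[OF p q'(1)] i Suc by simp
      moreover have "d < coheight \<qq>'" using coheight_strict_antimono[OF q'(1) q(1) q'(2)] q(3) by simp
      ultimately show False by simp
    qed
    then have "y \<in> local_part \<qq> ?N'" using y by (simp add: local_part_def)
    then have "adjoin N y \<subseteq> local_part \<qq> ?N'" using up local_part_upper[OF N'] by (intro adjoin_least subm_local_part N') auto
    moreover have "chain_at \<qq> n ?N' (adjoin N y)"
      using chain_at_powers[OF N y p q(1,2) f, of n n] y by (simp add: x_def)
    ultimately have "chain_at \<qq> n ?N' (local_part \<qq> ?N')" using chain_at_mono by blast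
    then have n: "n \<le> mult_at \<qq> ?N'" using mult_at_geI[OF q(1) N'] by blast
    have "mult_at \<qq> ?N' \<le> mult_of_dim ?N' d"
    proof (cases "mult_at \<qq> ?N' = 0")
      case False
      show ?thesis unfolding mult_of_dim_def
        by (rule member_le_sum) (use False q in \<open>auto intro: finite_subset[OF _ finite_mult_at_support[OF N']]\<close>)
    qed simp
    then have "n \<le> mult_of_dim ?N' d" using n by simp
    then show thesis
      using that[of ?N'] mult_of_dim_adjoin[OF N x, unfolded cx, OF p i] N' new[OF x] p cx Suc by auto
  qed
qed

theorem height_rank_eq_cnf:
  assumes "subm N"
  shows "height_rank R M N = cnf_eval (mult_of_dim N) (the_enat (krull_dim R))"
  using assms
proof (induction N rule: wf_induct_rule[OF wf_supermodule_rel])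
  case (1 N)
  note N = 1(2)
  let ?D = "the_enat (krull_dim R)"
  let ?A = "{osucc (height_rank R M N') | N'. subm N' \<and> N \<subset> N'}"
  have IH: "height_rank R M N' = cnf_eval (mult_of_dim N') ?D" if "subm N'" "N \<subset> N'" for N'
    using 1(1)[of N'] that N by (simp add: supermodule_rel_def)
  have bound: "\<alpha> \<le> cnf_eval (mult_of_dim N) ?D" if \<alpha>: "\<alpha> \<in> ?A" for \<alpha>
  proof -
    obtain N' where N': "subm N'" "N \<subset> N'" "\<alpha> = osucc (height_rank R M N')" using \<alpha> by blast
    note N'(3)[unfolded IH[OF N'(1,2)]]
    note N' = N'(1,2) this
    obtain d where "d \<le> ?D" "mult_of_dim N' d < mult_of_dim N d" "\<And>i. d < i \<Longrightarrow> mult_of_dim N' i = mult_of_dim N i"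
      using mult_of_dim_decreases[OF N N'(1,2)] by blast
    then have "(cnf_eval (mult_of_dim N') ?D :: 'c set ordinal) < cnf_eval (mult_of_dim N) ?D" by (intro cnf_eval_less) auto
    then show ?thesis unfolding N'(3) by (rule osucc_least(2))
  qed
  \<comment> \<open>The bound just found also guarantees that a least upper bound of the family
    exists.\<close>
  have upper: "\<forall>\<alpha>\<in>?A. \<alpha> \<le> osup ?A"
    unfolding osup_def by (rule LeastI[of "\<lambda>\<beta>. \<forall>\<alpha>\<in>?A. \<alpha> \<le> \<beta>"]) (use bound in blast)
  have "osup ?A = cnf_eval (mult_of_dim N) ?D"
  proof (rule antisym)
    show "osup ?A \<le> cnf_eval (mult_of_dim N) ?D" using bound by (rule osup_least)
    show "cnf_eval (mult_of_dim N) ?D \<le> osup ?A"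
    proof (rule ccontr)
      assume "\<not> ?thesis"
      then have "osup ?A < cnf_eval (mult_of_dim N) ?D" by simp
      \<comment> \<open>The pair \<open>i\<close>, \<open>n\<close> tells which coefficient to lower
        and how large the next one must become. A submodule realizing this has rank at least
        \<open>osup ?A\<close>, while the successor of its rank belongs to
        \<open>?A\<close>.\<close>
      then obtain i n where i: "i \<le> ?D" "0 < mult_of_dim N i"
        and le: "\<And>a. (\<And>j. i < j \<Longrightarrow> j \<le> ?D \<Longrightarrow> a j = mult_of_dim N j) \<Longrightarrow> Suc (a i) = mult_of_dim N i \<Longrightarrow>
          (0 < i \<Longrightarrow> n \<le> a (i - 1)) \<Longrightarrow> osup ?A \<le> cnf_eval a ?D"
        by (rule less_cnf_evalE) blast
      obtain N' where N': "subm N'" "N \<subset> N'" and c: "Suc (mult_of_dim N' i) = mult_of_dim N i"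
        "\<And>j. i < j \<Longrightarrow> mult_of_dim N' j = mult_of_dim N j" "0 < i \<Longrightarrow> n \<le> mult_of_dim N' (i - 1)"
        using exists_mult_of_dim_drop[OF N i(2), of n] by blast
      have "osup ?A \<le> cnf_eval (mult_of_dim N') ?D" by (rule le) (use c in auto)
      also have "\<dots> < osucc (cnf_eval (mult_of_dim N') ?D)" by (rule osucc_least(1))
      also have "\<dots> \<le> osup ?A" using upper N' IH[OF N'] by auto
      finally show False by simp
    qed
  qed
  then show ?case using height_rank_unfold[OF wf_supermodule_rel N] by simp
qed

lemma is_cnf_mult_of_dim: "is_cnf (mult_of_dim N) (cnf_eval (mult_of_dim N) (the_enat (krull_dim R)))"
proof -
  have "mult_of_dim N i = 0" if i: "the_enat (krull_dim R) < i" for i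
  proof -
    have "{\<pp>. prm \<pp> \<and> coheight \<pp> = i \<and> mult_at \<pp> N \<noteq> 0} = {}" using coheight_le i by fastforce
    then show ?thesis unfolding mult_of_dim_def by (metis sum.empty)
  qed
  then show ?thesis unfolding is_cnf_def by blast
qed

end

section \<open>Local cohomology in the localization\<close>

locale noetherian_module_at_prime = noetherian_module R M for R (structure) and M (structure) +
  fixes \<pp>
  assumes prime: "primeideal \<pp> R"
begin

abbreviation S :: "'a set" where "S \<equiv> carrier R - \<pp>"
abbreviation fr :: "'c \<Rightarrow> 'a \<Rightarrow> ('c \<times> 'a) set" where "fr m s \<equiv> module_frac R S M m s"
abbreviation rf :: "'a \<Rightarrow> 'a \<Rightarrow> ('a \<times> 'a) set" where "rf a s \<equiv> ring_frac R S a s"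
abbreviation (input) Mp where "Mp \<equiv> loc_module R S M"
abbreviation (input) Rp where "Rp \<equiv> loc_ring R S"

lemmas S_one = prm_one[OF prime]
lemmas S_mult = prm_mult[OF prime]

lemma S_carrier: "s \<in> S \<Longrightarrow> s \<in> carrier R" by simp

lemmas smult_ac = smult_assoc1[symmetric] R.m_ac

section \<open>Fractions and operations in the localization\<close>

lemma equiv_module_frac_rel: "equiv (carrier M \<times> S) (module_frac_rel R S M)"
proof (rule equivI)
  show "module_frac_rel R S M \<subseteq> (carrier M \<times> S) \<times> (carrier M \<times> S)"
    by (auto simp: module_frac_rel_def)
  show "refl_on (carrier M \<times> S) (module_frac_rel R S M)"
    using S_one by (auto simp: refl_on_def module_frac_rel_def)
  show "sym (module_frac_rel R S M)"
    unfolding sym_def module_frac_rel_def by (auto intro: sym)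
  show "trans (module_frac_rel R S M)"
  proof (rule transI)
    fix x y z assume "(x, y) \<in> module_frac_rel R S M" "(y, z) \<in> module_frac_rel R S M"
    then obtain m s n t k r u v where xyz: "x = (m, s)" "y = (n, t)" "z = (k, r)"
      and mem: "m \<in> carrier M" "n \<in> carrier M" "k \<in> carrier M" "s \<in> S" "t \<in> S" "r \<in> S" "u \<in> S" "v \<in> S"
      and u: "u \<odot>\<^bsub>M\<^esub> (t \<odot>\<^bsub>M\<^esub> m) = u \<odot>\<^bsub>M\<^esub> (s \<odot>\<^bsub>M\<^esub> n)"
      and v: "v \<odot>\<^bsub>M\<^esub> (r \<odot>\<^bsub>M\<^esub> n) = v \<odot>\<^bsub>M\<^esub> (t \<odot>\<^bsub>M\<^esub> k)"
      unfolding module_frac_rel_def by auto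
    note c = mem(1-3) mem(4-8)[THEN S_carrier]
    \<comment> \<open>The middle denominator t joins the two given multipliers: it multiplies m in
      one relation and k in the other.\<close>
    have "(u \<otimes> v \<otimes> t) \<odot>\<^bsub>M\<^esub> (r \<odot>\<^bsub>M\<^esub> m) = (v \<otimes> r) \<odot>\<^bsub>M\<^esub> (u \<odot>\<^bsub>M\<^esub> (t \<odot>\<^bsub>M\<^esub> m))"
      using c by (simp add: smult_ac)
    also have "\<dots> = (u \<otimes> s) \<odot>\<^bsub>M\<^esub> (v \<odot>\<^bsub>M\<^esub> (r \<odot>\<^bsub>M\<^esub> n))" unfolding u using c by (simp add: smult_ac)
    also have "\<dots> = (u \<otimes> v \<otimes> t) \<odot>\<^bsub>M\<^esub> (s \<odot>\<^bsub>M\<^esub> k)" unfolding v using c by (simp add: smult_ac)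
    finally show "(x, z) \<in> module_frac_rel R S M"
      using mem S_mult[OF S_mult[OF mem(7,8)] mem(5)] unfolding xyz module_frac_rel_def by blast
  qed
qed

lemma fr_eq_iff:
  assumes "m \<in> carrier M" "s \<in> S" "n \<in> carrier M" "t \<in> S"
  shows "fr m s = fr n t \<longleftrightarrow> (\<exists>u\<in>S. u \<odot>\<^bsub>M\<^esub> (t \<odot>\<^bsub>M\<^esub> m) = u \<odot>\<^bsub>M\<^esub> (s \<odot>\<^bsub>M\<^esub> n))"
proof -
  have "fr m s = fr n t \<longleftrightarrow> ((m, s), (n, t)) \<in> module_frac_rel R S M"
    unfolding module_frac_def by (rule eq_equiv_class_iff[OF equiv_module_frac_rel]) (use assms in auto)
  then show ?thesis using assms by (simp add: module_frac_rel_def)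
qed

lemma fr_eqI:
  "m \<in> carrier M \<Longrightarrow> s \<in> S \<Longrightarrow> n \<in> carrier M \<Longrightarrow> t \<in> S \<Longrightarrow> u \<in> S \<Longrightarrow>
    u \<odot>\<^bsub>M\<^esub> (t \<odot>\<^bsub>M\<^esub> m) = u \<odot>\<^bsub>M\<^esub> (s \<odot>\<^bsub>M\<^esub> n) \<Longrightarrow> fr m s = fr n t"
  using fr_eq_iff by blast

lemma fr_cancel: "m \<in> carrier M \<Longrightarrow> s \<in> S \<Longrightarrow> t \<in> S \<Longrightarrow> fr (t \<odot>\<^bsub>M\<^esub> m) (s \<otimes> t) = fr m s"
  by (rule fr_eqI[of _ _ _ _ \<one>]) (use S_one S_mult in \<open>auto simp: smult_ac\<close>)

lemma mem_frD:
  assumes "(n, t) \<in> fr m s"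
  shows "m \<in> carrier M" "s \<in> S" "n \<in> carrier M" "t \<in> S"
    "\<exists>u\<in>S. u \<odot>\<^bsub>M\<^esub> (t \<odot>\<^bsub>M\<^esub> m) = u \<odot>\<^bsub>M\<^esub> (s \<odot>\<^bsub>M\<^esub> n)"
  using assms by (auto simp: module_frac_def module_frac_rel_def)

lemma mem_fr_self: "m \<in> carrier M \<Longrightarrow> s \<in> S \<Longrightarrow> (m, s) \<in> fr m s"
  using S_one by (auto simp: module_frac_def module_frac_rel_def)

lemma mem_rfD:
  assumes "(b, t) \<in> rf a s"
  shows "b \<in> carrier R" "t \<in> S" "\<exists>u\<in>S. u \<otimes> (t \<otimes> a) = u \<otimes> (s \<otimes> b)"
  using assms by (auto simp: ring_frac_def ring_frac_rel_def)

lemma mem_rf_self: "a \<in> carrier R \<Longrightarrow> s \<in> S \<Longrightarrow> (a, s) \<in> rf a s"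
  using S_one by (auto simp: ring_frac_def ring_frac_rel_def)

text \<open>The operations of the localization are unions over all representatives. If every choice
  yields the same class, the union is that class; well-definedness thus becomes a computation with
  fractions.\<close>

lemma UN2_const:
  assumes "(a, s) \<in> x" "(b, t) \<in> y"
    and "\<And>a' s' b' t'. (a', s') \<in> x \<Longrightarrow> (b', t') \<in> y \<Longrightarrow> f a' s' b' t' = c"
  shows "(\<Union>(a, s)\<in>x. \<Union>(b, t)\<in>y. f a s b t) = c"
proof -
  have "(\<Union>(a, s)\<in>x. \<Union>(b, t)\<in>y. f a s b t) = (\<Union>(a, s)\<in>x. \<Union>(b, t)\<in>y. c)"
    using assms(3) by (intro SUP_cong refl) auto
  then show ?thesis using assms(1,2) by auto
qed

lemma add_fr:
  assumes m: "m \<in> carrier M" "s \<in> S" and n: "n \<in> carrier M" "t \<in> S"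
  shows "fr m s \<oplus>\<^bsub>Mp\<^esub> fr n t = fr (t \<odot>\<^bsub>M\<^esub> m \<oplus>\<^bsub>M\<^esub> s \<odot>\<^bsub>M\<^esub> n) (s \<otimes> t)"
proof -
  have "fr m s \<oplus>\<^bsub>Mp\<^esub> fr n t = (\<Union>(m, s)\<in>fr m s. \<Union>(n, t)\<in>fr n t. fr (t \<odot>\<^bsub>M\<^esub> m \<oplus>\<^bsub>M\<^esub> s \<odot>\<^bsub>M\<^esub> n) (s \<otimes> t))"
    by (simp add: loc_module_def)
  also have "\<dots> = fr (t \<odot>\<^bsub>M\<^esub> m \<oplus>\<^bsub>M\<^esub> s \<odot>\<^bsub>M\<^esub> n) (s \<otimes> t)"
  proof (rule UN2_const[OF mem_fr_self[OF m] mem_fr_self[OF n]])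
    fix m' s' n' t' assume m'': "(m', s') \<in> fr m s" and n'': "(n', t') \<in> fr n t"
    note m' = mem_frD(3,4)[OF m''] and n' = mem_frD(3,4)[OF n'']
    obtain u where u: "u \<in> S" "u \<odot>\<^bsub>M\<^esub> (s' \<odot>\<^bsub>M\<^esub> m) = u \<odot>\<^bsub>M\<^esub> (s \<odot>\<^bsub>M\<^esub> m')" using mem_frD(5)[OF m''] by blast
    obtain v where v: "v \<in> S" "v \<odot>\<^bsub>M\<^esub> (t' \<odot>\<^bsub>M\<^esub> n) = v \<odot>\<^bsub>M\<^esub> (t \<odot>\<^bsub>M\<^esub> n')" using mem_frD(5)[OF n''] by blast
    note c = m(1) n(1) m'(1) n'(1) m(2)[THEN S_carrier] n(2)[THEN S_carrier] m'(2)[THEN S_carrier] n'(2)[THEN S_carrier]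
      u(1)[THEN S_carrier] v(1)[THEN S_carrier]
    have 1: "(u \<otimes> v \<otimes> t \<otimes> t') \<odot>\<^bsub>M\<^esub> (s \<odot>\<^bsub>M\<^esub> m') = (u \<otimes> v \<otimes> t \<otimes> t') \<odot>\<^bsub>M\<^esub> (s' \<odot>\<^bsub>M\<^esub> m)"
    proof -
      have "(u \<otimes> v \<otimes> t \<otimes> t') \<odot>\<^bsub>M\<^esub> (s \<odot>\<^bsub>M\<^esub> m') = (v \<otimes> t \<otimes> t') \<odot>\<^bsub>M\<^esub> (u \<odot>\<^bsub>M\<^esub> (s \<odot>\<^bsub>M\<^esub> m'))" using c by (simp add: smult_ac)
      then show ?thesis unfolding u(2)[symmetric] using c by (simp add: smult_ac)
    qed
    have 2: "(u \<otimes> v \<otimes> s \<otimes> s') \<odot>\<^bsub>M\<^esub> (t \<odot>\<^bsub>M\<^esub> n') = (u \<otimes> v \<otimes> s \<otimes> s') \<odot>\<^bsub>M\<^esub> (t' \<odot>\<^bsub>M\<^esub> n)"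
    proof -
      have "(u \<otimes> v \<otimes> s \<otimes> s') \<odot>\<^bsub>M\<^esub> (t \<odot>\<^bsub>M\<^esub> n') = (u \<otimes> s \<otimes> s') \<odot>\<^bsub>M\<^esub> (v \<odot>\<^bsub>M\<^esub> (t \<odot>\<^bsub>M\<^esub> n'))" using c by (simp add: smult_ac)
      then show ?thesis unfolding v(2)[symmetric] using c by (simp add: smult_ac)
    qed
    show "fr (t' \<odot>\<^bsub>M\<^esub> m' \<oplus>\<^bsub>M\<^esub> s' \<odot>\<^bsub>M\<^esub> n') (s' \<otimes> t') = fr (t \<odot>\<^bsub>M\<^esub> m \<oplus>\<^bsub>M\<^esub> s \<odot>\<^bsub>M\<^esub> n) (s \<otimes> t)"
    proof (rule fr_eqI[of _ _ _ _ "u \<otimes> v"])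
      have "(u \<otimes> v) \<odot>\<^bsub>M\<^esub> ((s \<otimes> t) \<odot>\<^bsub>M\<^esub> (t' \<odot>\<^bsub>M\<^esub> m' \<oplus>\<^bsub>M\<^esub> s' \<odot>\<^bsub>M\<^esub> n'))
        = (u \<otimes> v \<otimes> t \<otimes> t') \<odot>\<^bsub>M\<^esub> (s \<odot>\<^bsub>M\<^esub> m') \<oplus>\<^bsub>M\<^esub> (u \<otimes> v \<otimes> s \<otimes> s') \<odot>\<^bsub>M\<^esub> (t \<odot>\<^bsub>M\<^esub> n')"
        using c by (simp add: smult_r_distr smult_ac)
      also have "\<dots> = (u \<otimes> v) \<odot>\<^bsub>M\<^esub> ((s' \<otimes> t') \<odot>\<^bsub>M\<^esub> (t \<odot>\<^bsub>M\<^esub> m \<oplus>\<^bsub>M\<^esub> s \<odot>\<^bsub>M\<^esub> n))"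
        unfolding 1 2 using c by (simp add: smult_r_distr smult_ac)
      finally show "(u \<otimes> v) \<odot>\<^bsub>M\<^esub> ((s \<otimes> t) \<odot>\<^bsub>M\<^esub> (t' \<odot>\<^bsub>M\<^esub> m' \<oplus>\<^bsub>M\<^esub> s' \<odot>\<^bsub>M\<^esub> n')) =
        (u \<otimes> v) \<odot>\<^bsub>M\<^esub> ((s' \<otimes> t') \<odot>\<^bsub>M\<^esub> (t \<odot>\<^bsub>M\<^esub> m \<oplus>\<^bsub>M\<^esub> s \<odot>\<^bsub>M\<^esub> n))" .
      show "s' \<otimes> t' \<in> S" "s \<otimes> t \<in> S" "u \<otimes> v \<in> S" using S_mult m n m' n' u(1) v(1) by blast+
    qed (use c in auto)
  qed
  finally show ?thesis .
qed

lemma smult_fr: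
  assumes a: "a \<in> carrier R" "s \<in> S" and m: "m \<in> carrier M" "t \<in> S"
  shows "rf a s \<odot>\<^bsub>Mp\<^esub> fr m t = fr (a \<odot>\<^bsub>M\<^esub> m) (s \<otimes> t)"
proof -
  have "rf a s \<odot>\<^bsub>Mp\<^esub> fr m t = (\<Union>(a, s)\<in>rf a s. \<Union>(m, t)\<in>fr m t. fr (a \<odot>\<^bsub>M\<^esub> m) (s \<otimes> t))"
    by (simp add: loc_module_def)
  also have "\<dots> = fr (a \<odot>\<^bsub>M\<^esub> m) (s \<otimes> t)"
  proof (rule UN2_const[OF mem_rf_self[OF a] mem_fr_self[OF m]])
    fix a' s' m' t' assume a'': "(a', s') \<in> rf a s" and m'': "(m', t') \<in> fr m t"
    note a' = mem_rfD(1,2)[OF a''] and m' = mem_frD(3,4)[OF m'']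
    obtain u where u: "u \<in> S" "u \<otimes> (s' \<otimes> a) = u \<otimes> (s \<otimes> a')" using mem_rfD(3)[OF a''] by blast
    obtain v where v: "v \<in> S" "v \<odot>\<^bsub>M\<^esub> (t' \<odot>\<^bsub>M\<^esub> m) = v \<odot>\<^bsub>M\<^esub> (t \<odot>\<^bsub>M\<^esub> m')" using mem_frD(5)[OF m''] by blast
    note c = a(1) a'(1) m(1) m'(1) a(2)[THEN S_carrier] a'(2)[THEN S_carrier] m(2)[THEN S_carrier] m'(2)[THEN S_carrier]
      u(1)[THEN S_carrier] v(1)[THEN S_carrier]
    show "fr (a' \<odot>\<^bsub>M\<^esub> m') (s' \<otimes> t') = fr (a \<odot>\<^bsub>M\<^esub> m) (s \<otimes> t)"
    proof (rule fr_eqI[of _ _ _ _ "u \<otimes> v"])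
      have "(u \<otimes> v) \<odot>\<^bsub>M\<^esub> ((s \<otimes> t) \<odot>\<^bsub>M\<^esub> (a' \<odot>\<^bsub>M\<^esub> m')) = (u \<otimes> (s \<otimes> a')) \<odot>\<^bsub>M\<^esub> (v \<odot>\<^bsub>M\<^esub> (t \<odot>\<^bsub>M\<^esub> m'))"
        using c by (simp add: smult_ac)
      also have "\<dots> = (u \<otimes> v) \<odot>\<^bsub>M\<^esub> ((s' \<otimes> t') \<odot>\<^bsub>M\<^esub> (a \<odot>\<^bsub>M\<^esub> m))"
        unfolding u(2)[symmetric] v(2)[symmetric] using c by (simp add: smult_ac)
      finally show "(u \<otimes> v) \<odot>\<^bsub>M\<^esub> ((s \<otimes> t) \<odot>\<^bsub>M\<^esub> (a' \<odot>\<^bsub>M\<^esub> m')) = (u \<otimes> v) \<odot>\<^bsub>M\<^esub> ((s' \<otimes> t') \<odot>\<^bsub>M\<^esub> (a \<odot>\<^bsub>M\<^esub> m))" .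
      show "s' \<otimes> t' \<in> S" "s \<otimes> t \<in> S" "u \<otimes> v \<in> S" using S_mult a m a' m' u(1) v(1) by blast+
    qed (use c in auto)
  qed
  finally show ?thesis .
qed

lemma zero_loc: "\<zero>\<^bsub>Mp\<^esub> = fr \<zero>\<^bsub>M\<^esub> \<one>"
  by (simp add: loc_module_def)

lemma fr_eq_zero_iff:
  assumes "m \<in> carrier M" "s \<in> S"
  shows "fr m s = \<zero>\<^bsub>Mp\<^esub> \<longleftrightarrow> (\<exists>u\<in>S. u \<odot>\<^bsub>M\<^esub> m = \<zero>\<^bsub>M\<^esub>)"
  unfolding zero_loc using assms S_one by (auto simp: fr_eq_iff)

lemma carrier_loc: "x \<in> carrier Mp \<longleftrightarrow> (\<exists>m s. m \<in> carrier M \<and> s \<in> S \<and> x = fr m s)"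
  unfolding loc_module_def module_frac_def by (auto simp: quotient_def)

lemma carrier_loc_ring: "x \<in> carrier Rp \<longleftrightarrow> (\<exists>a s. a \<in> carrier R \<and> s \<in> S \<and> x = rf a s)"
  unfolding loc_ring_def ring_frac_def by (auto simp: quotient_def)

section \<open>Powers of the prime and the local part\<close>

lemma ideal_ideal_power: "ideal (ideal_power R \<pp> k) R"
  using R.ideal_prod_is_ideal[OF primeideal.axioms(1)[OF prime]] R.oneideal by (induction k) auto

lemma ideal_power_add: "ideal_power R \<pp> (k + l) = ideal_prod R (ideal_power R \<pp> k) (ideal_power R \<pp> l)"
proof (induction k)
  case 0
  then show ?case
    using R.ideal_prod_one[OF ideal_ideal_power] R.ideal_prod_commute[OF R.oneideal ideal_ideal_power] by simp
next
  case (Suc k)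
  then show ?case
    using R.ideal_prod_assoc[OF primeideal.axioms(1)[OF prime] ideal_ideal_power ideal_ideal_power] by simp
qed

text \<open>
  An ideal maximal among those that contain no \<open>s \<pp>\<^sup>k\<close> with \<open>s \<notin> \<pp>\<close> is prime and lies properly below \<open>\<pp>\<close>.
\<close>

lemma local_part_annihilated:
  assumes m: "m \<in> local_part \<pp> {\<zero>\<^bsub>M\<^esub>}"
  shows "\<exists>s\<in>S. \<exists>k. \<forall>a\<in>ideal_power R \<pp> k. s \<odot>\<^bsub>M\<^esub> (a \<odot>\<^bsub>M\<^esub> m) = \<zero>\<^bsub>M\<^esub>"
proof -
  let ?I = "colon {\<zero>\<^bsub>M\<^esub>} m"
  let ?Q = "\<lambda>J. \<exists>s\<in>S. \<exists>k. \<forall>a\<in>ideal_power R \<pp> k. s \<otimes> a \<in> J"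
  have mc: "m \<in> carrier M" using m by (simp add: local_part_def)
  have pc: "a \<in> carrier R" if "a \<in> ideal_power R \<pp> k" for a k using that ideal.Icarr[OF ideal_ideal_power] by blast
  have "?Q ?I"
  proof (rule ccontr)
    assume "\<not> ?Q ?I"
    then have start: "?I \<subseteq> ?I \<and> \<not> ?Q ?I" by blast
    obtain J where J: "ideal J R" "?I \<subseteq> J \<and> \<not> ?Q J" and max: "\<And>X. ideal X R \<Longrightarrow> ?I \<subseteq> X \<and> \<not> ?Q X \<Longrightarrow> J \<subseteq> X \<Longrightarrow> X = J"
      by (rule maximal_ideal_property[OF ideal_colon[OF subm_zero mc], of "\<lambda>J. ?I \<subseteq> J \<and> \<not> ?Q J", OF start]) simp
    have nQ: False if "s \<in> S" "\<And>a. a \<in> ideal_power R \<pp> k \<Longrightarrow> s \<otimes> a \<in> J" for s k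
    proof -
      have "?Q J" by (rule bexI[OF _ that(1)], rule exI[of _ k], rule ballI, rule that(2))
      then show False by (rule notE[OF conjunct2[OF J(2)]])
    qed
    note J_add = additive_subgroup.a_closed[OF ideal.axioms(1)[OF J(1)]]
    note J_l = ideal.I_l_closed[OF J(1)] and J_r = ideal.I_r_closed[OF J(1)] and J_c = ideal.Icarr[OF J(1)]
    \<comment> \<open>By maximality of J, the ideal J + Ra already contains some s \<pp>^k; its
      elements are written out as j + r a.\<close>
    have ext: "\<exists>s\<in>S. \<exists>k. \<forall>x\<in>ideal_power R \<pp> k. \<exists>j\<in>J. \<exists>r\<in>carrier R. s \<otimes> x = j \<oplus> r \<otimes> a"
      if a: "a \<in> carrier R" "a \<notin> J" for a
    proof -
      let ?X = "set_add R J (PIdl a)"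
      have X: "ideal ?X R" by (rule R.add_ideals[OF J(1) R.cgenideal_ideal[OF a(1)]])
      have mem: "x \<in> ?X \<longleftrightarrow> (\<exists>j\<in>J. \<exists>r\<in>carrier R. x = j \<oplus> r \<otimes> a)" for x
        unfolding set_add_def set_mult_def cgenideal_def by auto
      have le: "J \<subseteq> ?X"
      proof
        fix j assume j: "j \<in> J"
        then have "j = j \<oplus> \<zero> \<otimes> a" using J_c a by simp
        then show "j \<in> ?X" unfolding mem using j R.zero_closed by blast
      qed
      have "\<zero> \<in> J" by (rule additive_subgroup.zero_closed[OF ideal.axioms(1)[OF J(1)]])
      moreover have "a = \<zero> \<oplus> \<one> \<otimes> a" using a by simp
      ultimately have "a \<in> ?X" unfolding mem by blast
      then have "?X \<noteq> J" using a by blast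
      then have "?Q ?X" using max[OF X] le J(2) by blast
      then show ?thesis unfolding mem .
    qed
    have "prm J"
    proof (rule primeidealI[OF J(1)])
      show "cring R" by (rule R.is_cring)
      show "carrier R \<noteq> J"
      proof
        assume *: "carrier R = J"
        show False
        proof (rule nQ[OF S_one, of 0])
          fix a assume "a \<in> ideal_power R \<pp> 0"
          then have "\<one> \<otimes> a \<in> carrier R" by simp
          then show "\<one> \<otimes> a \<in> J" unfolding * .
        qed
      qed
      fix a b assume ab: "a \<in> carrier R" "b \<in> carrier R" "a \<otimes> b \<in> J"
      show "a \<in> J \<or> b \<in> J"
      proof (rule ccontr)
        assume "\<not> ?thesis"
        then have n: "a \<notin> J" "b \<notin> J" by auto
        obtain s k where s: "s \<in> S" "\<And>x. x \<in> ideal_power R \<pp> k \<Longrightarrow> \<exists>j\<in>J. \<exists>r\<in>carrier R. s \<otimes> x = j \<oplus> r \<otimes> a"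
          using ext[OF ab(1) n(1)] by blast
        obtain t l where t: "t \<in> S" "\<And>x. x \<in> ideal_power R \<pp> l \<Longrightarrow> \<exists>j\<in>J. \<exists>r\<in>carrier R. t \<otimes> x = j \<oplus> r \<otimes> b"
          using ext[OF ab(2) n(2)] by blast
        \<comment> \<open>Expanding (j + r a)(i + q b) leaves only multiples of j, i and a b, all in
          J; so s t \<pp>^(k+l) would lie in J.\<close>
        have "(s \<otimes> t) \<otimes> x \<in> J" if "x \<in> ideal_power R \<pp> (k + l)" for x
          using that unfolding ideal_power_add
        proof (induction x rule: ideal_prod.induct)
          case (prod x y)
          obtain j r where j: "j \<in> J" "r \<in> carrier R" "s \<otimes> x = j \<oplus> r \<otimes> a" using s(2)[OF prod(1)] by blast
          obtain i q where i: "i \<in> J" "q \<in> carrier R" "t \<otimes> y = i \<oplus> q \<otimes> b" using t(2)[OF prod(2)] by blast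
          note c = s(1)[THEN S_carrier] t(1)[THEN S_carrier] pc[OF prod(1)] pc[OF prod(2)] J_c[OF j(1)] j(2) J_c[OF i(1)] i(2) ab(1,2)
          have "(s \<otimes> t) \<otimes> (x \<otimes> y) = (s \<otimes> x) \<otimes> (t \<otimes> y)" using c by (simp add: R.m_ac)
          also have "\<dots> = (t \<otimes> y) \<otimes> j \<oplus> ((r \<otimes> a) \<otimes> i \<oplus> (r \<otimes> q) \<otimes> (a \<otimes> b))"
          proof -
            have "(s \<otimes> x) \<otimes> (t \<otimes> y) = (t \<otimes> y) \<otimes> j \<oplus> (r \<otimes> a) \<otimes> (t \<otimes> y)"
              unfolding j(3) using c by (simp add: R.l_distr R.m_comm[of j])
            also have "(r \<otimes> a) \<otimes> (t \<otimes> y) = (r \<otimes> a) \<otimes> i \<oplus> (r \<otimes> q) \<otimes> (a \<otimes> b)"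
              unfolding i(3) using c by (simp add: R.r_distr R.m_ac)
            finally show ?thesis .
          qed
          also have "\<dots> \<in> J" by (intro J_add J_l[OF j(1)] J_l[OF i(1)] J_l[OF ab(3)]) (use c in auto)
          finally show ?case .
        next
          case (sum x y)
          have "x \<in> carrier R" "y \<in> carrier R"
            using sum(1,2) ideal.Icarr[OF R.ideal_prod_is_ideal[OF ideal_ideal_power ideal_ideal_power]] by blast+
          then have "(s \<otimes> t) \<otimes> (x \<oplus> y) = (s \<otimes> t) \<otimes> x \<oplus> (s \<otimes> t) \<otimes> y"
            using s(1) t(1) by (simp add: R.r_distr)
          then show ?case using J_add sum by simp
        qed
        then show False by (rule nQ[OF S_mult[OF s(1) t(1)]])
      qed
    qed
    \<comment> \<open>The zeroth power of \<pp> is R, so an element of J outside \<pp> would itself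
      be a forbidden s, with exponent 0. The next claim uses s = 1 and exponent 1.\<close>
    have "J \<subseteq> \<pp>"
    proof
      fix s assume s: "s \<in> J"
      show "s \<in> \<pp>"
      proof (rule ccontr)
        assume "s \<notin> \<pp>"
        then have "s \<in> S" using s J_c by simp
        then show False by (rule nQ[of s 0]) (use s J_r in simp)
      qed
    qed
    moreover have "\<not> \<pp> \<subseteq> J"
    proof
      assume le: "\<pp> \<subseteq> J"
      have "ideal_power R \<pp> 1 = \<pp>" using R.ideal_prod_one[OF primeideal.axioms(1)[OF prime]] by simp
      show False
      proof (rule nQ[OF S_one, of 1])
        fix a assume "a \<in> ideal_power R \<pp> 1"
        then have "a \<in> J" using le \<open>ideal_power R \<pp> 1 = \<pp>\<close> by blast
        then show "\<one> \<otimes> a \<in> J" using J_c by simp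
      qed
    qed
    ultimately have "J \<subset> \<pp>" by blast
    then have "m \<in> saturation J {\<zero>\<^bsub>M\<^esub>}" using m \<open>prm J\<close> by (simp add: local_part_def)
    then show False using not_in_saturation_iff[OF mc] J(2) by blast
  qed
  then obtain s k where s: "s \<in> S" "\<And>a. a \<in> ideal_power R \<pp> k \<Longrightarrow> s \<otimes> a \<in> ?I" by blast
  have "s \<odot>\<^bsub>M\<^esub> (a \<odot>\<^bsub>M\<^esub> m) = \<zero>\<^bsub>M\<^esub>" if "a \<in> ideal_power R \<pp> k" for a
    using s(2)[OF that] s(1)[THEN S_carrier] pc[OF that] mc by (simp add: colon_def smult_assoc1)
  then show ?thesis using s(1) by blast
qed

lemma power_mem_ideal_power: "b \<in> \<pp> \<Longrightarrow> b [^] k \<in> ideal_power R \<pp> k"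
proof (induction k)
  case 0 then show ?case by simp
next
  case (Suc k)
  have "b \<in> carrier R" using Suc prm_subset[OF prime] by blast
  then have "b [^] Suc k = b \<otimes> b [^] k" by (simp add: R.m_comm)
  then show ?case using ideal_prod.prod[OF Suc(2) Suc(1)[OF Suc(2)]] by simp
qed

abbreviation (input) H0 where "H0 \<equiv> local_cohomology_0 R M \<pp>"
abbreviation (input) HM where "HM \<equiv> Mp\<lparr>carrier := H0\<rparr>"

text \<open>For \<qq> properly below \<pp> and b in \<pp> outside \<qq>, some u b^k with u outside
  \<pp> kills m and avoids \<qq>. The converse is \<open>local_part_annihilated\<close>. The
  denominator s does not affect whether a multiple of m/s vanishes.\<close>

lemma mem_H0_iff:
  assumes m: "m \<in> carrier M" and s: "s \<in> S"
  shows "fr m s \<in> H0 \<longleftrightarrow> m \<in> local_part \<pp> {\<zero>\<^bsub>M\<^esub>}"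
proof -
  have pc: "a \<in> carrier R" if "a \<in> ideal_power R \<pp> k" for a k using that ideal.Icarr[OF ideal_ideal_power] by blast
  have eq: "rf a \<one> \<odot>\<^bsub>Mp\<^esub> fr m s = \<zero>\<^bsub>Mp\<^esub> \<longleftrightarrow> (\<exists>u\<in>S. u \<odot>\<^bsub>M\<^esub> (a \<odot>\<^bsub>M\<^esub> m) = \<zero>\<^bsub>M\<^esub>)" if "a \<in> carrier R" for a
    unfolding smult_fr[OF that S_one m s] using that m S_mult[OF S_one s] by (intro fr_eq_zero_iff) auto
  have "fr m s \<in> carrier Mp" using m s carrier_loc by blast
  then have "fr m s \<in> H0 \<longleftrightarrow> (\<exists>k. \<forall>a\<in>ideal_power R \<pp> k. \<exists>u\<in>S. u \<odot>\<^bsub>M\<^esub> (a \<odot>\<^bsub>M\<^esub> m) = \<zero>\<^bsub>M\<^esub>)"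
    unfolding local_cohomology_0_def using eq pc by simp
  also have "\<dots> \<longleftrightarrow> m \<in> local_part \<pp> {\<zero>\<^bsub>M\<^esub>}"
  proof
    assume "\<exists>k. \<forall>a\<in>ideal_power R \<pp> k. \<exists>u\<in>S. u \<odot>\<^bsub>M\<^esub> (a \<odot>\<^bsub>M\<^esub> m) = \<zero>\<^bsub>M\<^esub>"
    then obtain k where k: "\<And>a. a \<in> ideal_power R \<pp> k \<Longrightarrow> \<exists>u\<in>S. u \<odot>\<^bsub>M\<^esub> (a \<odot>\<^bsub>M\<^esub> m) = \<zero>\<^bsub>M\<^esub>" by blast
    have "m \<in> saturation \<qq> {\<zero>\<^bsub>M\<^esub>}" if q: "prm \<qq>" "\<qq> \<subset> \<pp>" for \<qq>
    proof -
      obtain b where b: "b \<in> \<pp>" "b \<notin> \<qq>" using q by blast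
      have bc: "b \<in> carrier R" using b prm_subset[OF prime] by blast
      obtain u where u: "u \<in> S" "u \<odot>\<^bsub>M\<^esub> ((b [^] k) \<odot>\<^bsub>M\<^esub> m) = \<zero>\<^bsub>M\<^esub>"
        using k[OF power_mem_ideal_power[OF b(1)]] by blast
      have bk: "b [^] k \<in> carrier R - \<qq>" using prm_pow[OF q(1), of b k] bc b by blast
      have "u \<otimes> b [^] k \<in> carrier R - \<qq>" using prm_mult[OF q(1) _ bk] u(1) q(2) by blast
      moreover have "(u \<otimes> b [^] k) \<odot>\<^bsub>M\<^esub> m \<in> {\<zero>\<^bsub>M\<^esub>}" using u bc m by (simp add: smult_assoc1)
      ultimately show ?thesis using m unfolding saturation_def by blast
    qed
    then show "m \<in> local_part \<pp> {\<zero>\<^bsub>M\<^esub>}" using m by (simp add: local_part_def)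
  next
    assume "m \<in> local_part \<pp> {\<zero>\<^bsub>M\<^esub>}"
    then show "\<exists>k. \<forall>a\<in>ideal_power R \<pp> k. \<exists>u\<in>S. u \<odot>\<^bsub>M\<^esub> (a \<odot>\<^bsub>M\<^esub> m) = \<zero>\<^bsub>M\<^esub>"
      using local_part_annihilated by blast
  qed
  finally show ?thesis .
qed

section \<open>Contraction and extension of submodules\<close>

lemma H0_subset: "x \<in> H0 \<Longrightarrow> \<exists>m s. m \<in> carrier M \<and> s \<in> S \<and> x = fr m s"
  using carrier_loc by (auto simp: local_cohomology_0_def)

definition contraction :: "('c \<times> 'a) set set \<Rightarrow> 'c set" where
  "contraction N = {m \<in> carrier M. fr m \<one> \<in> N}"

definition extension :: "'c set \<Rightarrow> ('c \<times> 'a) set set" where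
  "extension K = {fr m s | m s. m \<in> K \<and> s \<in> S}"

lemma submodule_HM_closed:
  assumes N: "submodule N Rp HM"
  shows "x \<in> N \<Longrightarrow> x \<in> H0" "fr \<zero>\<^bsub>M\<^esub> \<one> \<in> N" "x \<in> N \<Longrightarrow> y \<in> N \<Longrightarrow> x \<oplus>\<^bsub>Mp\<^esub> y \<in> N"
    "a \<in> carrier R \<Longrightarrow> s \<in> S \<Longrightarrow> x \<in> N \<Longrightarrow> rf a s \<odot>\<^bsub>Mp\<^esub> x \<in> N"
proof -
  note sg = submodule.axioms(1)[OF N]
  show "x \<in> N \<Longrightarrow> x \<in> H0" using subgroup.subset[OF sg] by auto
  show "fr \<zero>\<^bsub>M\<^esub> \<one> \<in> N" using subgroup.one_closed[OF sg] by (simp add: zero_loc)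
  show "x \<in> N \<Longrightarrow> y \<in> N \<Longrightarrow> x \<oplus>\<^bsub>Mp\<^esub> y \<in> N" using subgroup.m_closed[OF sg, of x y] by simp
  assume "a \<in> carrier R" "s \<in> S" "x \<in> N"
  then show "rf a s \<odot>\<^bsub>Mp\<^esub> x \<in> N"
    using submodule.smult_closed[OF N, of "rf a s" x] carrier_loc_ring by auto
qed

text \<open>Multiplication by s/1 and by 1/s passes between m/s and m/1, so a submodule of the
  localization is determined by its fractions with denominator 1.\<close>

lemma mem_contraction_iff:
  assumes N: "submodule N Rp HM" and m: "m \<in> carrier M" and s: "s \<in> S"
  shows "fr m s \<in> N \<longleftrightarrow> m \<in> contraction N"
proof
  assume "fr m s \<in> N"
  then have "rf s \<one> \<odot>\<^bsub>Mp\<^esub> fr m s \<in> N" using submodule_HM_closed(4)[OF N _ S_one] s by blast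
  moreover have "rf s \<one> \<odot>\<^bsub>Mp\<^esub> fr m s = fr m \<one>"
    using smult_fr[OF s[THEN S_carrier] S_one m s] fr_cancel[OF m S_one s] by simp
  ultimately show "m \<in> contraction N" using m by (simp add: contraction_def)
next
  assume "m \<in> contraction N"
  then have "rf \<one> s \<odot>\<^bsub>Mp\<^esub> fr m \<one> \<in> N" using submodule_HM_closed(4)[OF N _ s] by (simp add: contraction_def)
  moreover have "rf \<one> s \<odot>\<^bsub>Mp\<^esub> fr m \<one> = fr m s"
    using smult_fr[OF R.one_closed s m S_one] m s by simp
  ultimately show "fr m s \<in> N" by simp
qed

lemma subm_contraction:
  assumes N: "submodule N Rp HM"
  shows "subm (contraction N)"
proof -
  have smult: "a \<odot>\<^bsub>M\<^esub> m \<in> contraction N" if a: "a \<in> carrier R" and m: "m \<in> contraction N" for a m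
  proof -
    have mc: "m \<in> carrier M" "fr m \<one> \<in> N" using m by (auto simp: contraction_def)
    have "rf a \<one> \<odot>\<^bsub>Mp\<^esub> fr m \<one> \<in> N" using submodule_HM_closed(4)[OF N a S_one mc(2)] .
    then show ?thesis using smult_fr[OF a S_one mc(1) S_one] a mc by (simp add: contraction_def)
  qed
  show ?thesis
  proof (rule submoduleI)
    show "contraction N \<subseteq> carrier M" by (auto simp: contraction_def)
    show "\<zero>\<^bsub>M\<^esub> \<in> contraction N" using submodule_HM_closed(2)[OF N] by (simp add: contraction_def)
    show "\<ominus>\<^bsub>M\<^esub> m \<in> contraction N" if "m \<in> contraction N" for m
    proof -
      have "m \<in> carrier M" using that by (simp add: contraction_def)
      then have "\<ominus>\<^bsub>M\<^esub> m = (\<ominus> \<one>) \<odot>\<^bsub>M\<^esub> m" by (simp add: smult_l_minus)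
      then show ?thesis using smult[OF _ that, of "\<ominus> \<one>"] by simp
    qed
    show "m \<oplus>\<^bsub>M\<^esub> n \<in> contraction N" if "m \<in> contraction N" "n \<in> contraction N" for m n
    proof -
      have c: "m \<in> carrier M" "n \<in> carrier M" "fr m \<one> \<in> N" "fr n \<one> \<in> N" using that by (auto simp: contraction_def)
      have "fr m \<one> \<oplus>\<^bsub>Mp\<^esub> fr n \<one> \<in> N" using submodule_HM_closed(3)[OF N c(3,4)] .
      then show ?thesis using add_fr[OF c(1) S_one c(2) S_one] c by (simp add: contraction_def)
    qed
  qed (rule smult)
qed

lemma saturation_contraction:
  assumes N: "submodule N Rp HM"
  shows "saturation \<pp> (contraction N) \<subseteq> contraction N"
proof
  fix m assume "m \<in> saturation \<pp> (contraction N)"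
  then obtain t where t: "m \<in> carrier M" "t \<in> S" "t \<odot>\<^bsub>M\<^esub> m \<in> contraction N" by (auto simp: saturation_def)
  then have "fr (t \<odot>\<^bsub>M\<^esub> m) (\<one> \<otimes> t) \<in> N" using mem_contraction_iff[OF N] S_mult[OF S_one t(2)] by simp
  then show "m \<in> contraction N" using fr_cancel[OF t(1) S_one t(2)] t(1) by (simp add: contraction_def)
qed

lemma contraction_psubset:
  assumes N: "submodule N Rp HM" and N': "submodule N' Rp HM" and less: "N \<subset> N'"
  shows "contraction N \<subset> contraction N'"
proof -
  obtain x where x: "x \<in> N'" "x \<notin> N" using less by blast
  then obtain m s where m: "m \<in> carrier M" "s \<in> S" "x = fr m s"
    using H0_subset submodule_HM_closed(1)[OF N'] by blast
  then have "m \<in> contraction N'" "m \<notin> contraction N"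
    using x mem_contraction_iff[OF N m(1,2)] mem_contraction_iff[OF N' m(1,2)] by auto
  moreover have "contraction N \<subseteq> contraction N'" using less by (auto simp: contraction_def)
  ultimately show ?thesis by blast
qed

lemma submodule_extension:
  assumes K: "subm K" and le: "K \<subseteq> local_part \<pp> {\<zero>\<^bsub>M\<^esub>}"
  shows "submodule (extension K) Rp HM"
proof -
  have Kc: "m \<in> carrier M" if "m \<in> K" for m using subm_closed(1)[OF K that] .
  have sub: "extension K \<subseteq> H0" unfolding extension_def using mem_H0_iff Kc le by auto
  \<comment> \<open>The inverse in the additive monoid of \<open>HM\<close> is a definite
    description over H^0, so -m/s has to be shown to be an inverse and the only one.\<close>
  have neg: "inv\<^bsub>add_monoid HM\<^esub> (fr m s) = fr (\<ominus>\<^bsub>M\<^esub> m) s" if m: "m \<in> K" and s: "s \<in> S" for m s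
  proof -
    have c: "m \<in> carrier M" "\<ominus>\<^bsub>M\<^esub> m \<in> carrier M" "s \<in> carrier R" using Kc[OF m] s by auto
    have z: "fr \<zero>\<^bsub>M\<^esub> (s \<otimes> s) = \<zero>\<^bsub>Mp\<^esub>"
      using fr_eq_zero_iff[of "\<zero>\<^bsub>M\<^esub>" "s \<otimes> s"] S_mult[OF s s] S_one by auto
    have "s \<odot>\<^bsub>M\<^esub> m \<oplus>\<^bsub>M\<^esub> s \<odot>\<^bsub>M\<^esub> (\<ominus>\<^bsub>M\<^esub> m) = \<zero>\<^bsub>M\<^esub>" "s \<odot>\<^bsub>M\<^esub> (\<ominus>\<^bsub>M\<^esub> m) \<oplus>\<^bsub>M\<^esub> s \<odot>\<^bsub>M\<^esub> m = \<zero>\<^bsub>M\<^esub>"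
      using c by (simp_all add: smult_r_minus M.r_neg M.l_neg)
    then have 1: "fr m s \<oplus>\<^bsub>Mp\<^esub> fr (\<ominus>\<^bsub>M\<^esub> m) s = \<zero>\<^bsub>Mp\<^esub>" "fr (\<ominus>\<^bsub>M\<^esub> m) s \<oplus>\<^bsub>Mp\<^esub> fr m s = \<zero>\<^bsub>Mp\<^esub>"
      using add_fr[OF c(1) s c(2) s] add_fr[OF c(2) s c(1) s] z by simp_all
    have 2: "y = fr (\<ominus>\<^bsub>M\<^esub> m) s" if "y \<in> H0" "fr m s \<oplus>\<^bsub>Mp\<^esub> y = \<zero>\<^bsub>Mp\<^esub>" for y
    proof -
      obtain n t where n: "n \<in> carrier M" "t \<in> S" "y = fr n t" using H0_subset[OF \<open>y \<in> H0\<close>] by blast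
      have tc: "t \<in> carrier R" using n by simp
      have "fr (t \<odot>\<^bsub>M\<^esub> m \<oplus>\<^bsub>M\<^esub> s \<odot>\<^bsub>M\<^esub> n) (s \<otimes> t) = \<zero>\<^bsub>Mp\<^esub>" using that(2) add_fr[OF c(1) s n(1,2)] n(3) by simp
      then obtain u where u: "u \<in> S" "u \<odot>\<^bsub>M\<^esub> (t \<odot>\<^bsub>M\<^esub> m \<oplus>\<^bsub>M\<^esub> s \<odot>\<^bsub>M\<^esub> n) = \<zero>\<^bsub>M\<^esub>"
        using fr_eq_zero_iff[OF _ S_mult[OF s n(2)]] c n tc by auto
      have uc: "u \<in> carrier R" using u by simp
      have "u \<odot>\<^bsub>M\<^esub> (s \<odot>\<^bsub>M\<^esub> n) \<oplus>\<^bsub>M\<^esub> u \<odot>\<^bsub>M\<^esub> (t \<odot>\<^bsub>M\<^esub> m) = \<zero>\<^bsub>M\<^esub>"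
        using u(2) uc c n tc by (simp add: smult_r_distr M.a_comm)
      then have "\<ominus>\<^bsub>M\<^esub> (u \<odot>\<^bsub>M\<^esub> (t \<odot>\<^bsub>M\<^esub> m)) = u \<odot>\<^bsub>M\<^esub> (s \<odot>\<^bsub>M\<^esub> n)"
        by (rule M.minus_equality) (use uc c n tc in auto)
      then have "u \<odot>\<^bsub>M\<^esub> (s \<odot>\<^bsub>M\<^esub> n) = u \<odot>\<^bsub>M\<^esub> (t \<odot>\<^bsub>M\<^esub> (\<ominus>\<^bsub>M\<^esub> m))"
        using uc c n tc by (simp add: smult_r_minus)
      then show ?thesis unfolding n(3) by (intro fr_eqI[OF n(1,2) c(2) s u(1)])
    qed
    have H: "fr (\<ominus>\<^bsub>M\<^esub> m) s \<in> H0" using sub subm_closed(5)[OF K m] s unfolding extension_def by blast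
    have inv: "inv\<^bsub>add_monoid HM\<^esub> x = (THE y. y \<in> H0 \<and> x \<oplus>\<^bsub>Mp\<^esub> y = \<zero>\<^bsub>Mp\<^esub> \<and> y \<oplus>\<^bsub>Mp\<^esub> x = \<zero>\<^bsub>Mp\<^esub>)" for x
      by (simp add: m_inv_def)
    show ?thesis unfolding inv
    proof (rule the_equality)
      show "fr (\<ominus>\<^bsub>M\<^esub> m) s \<in> H0 \<and> fr m s \<oplus>\<^bsub>Mp\<^esub> fr (\<ominus>\<^bsub>M\<^esub> m) s = \<zero>\<^bsub>Mp\<^esub> \<and> fr (\<ominus>\<^bsub>M\<^esub> m) s \<oplus>\<^bsub>Mp\<^esub> fr m s = \<zero>\<^bsub>Mp\<^esub>"
        using H 1 by (intro conjI)
    qed (elim conjE, rule 2)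
  qed
  show ?thesis
  proof (rule submodule.intro)
    show "subgroup (extension K) (add_monoid HM)"
    proof (rule subgroup.intro)
      show "extension K \<subseteq> carrier (add_monoid HM)" using sub by simp
      show "\<one>\<^bsub>add_monoid HM\<^esub> \<in> extension K"
        using subm_closed(2)[OF K] S_one by (auto simp: extension_def zero_loc)
      fix x assume "x \<in> extension K"
      then obtain m s where x: "m \<in> K" "s \<in> S" "x = fr m s" by (auto simp: extension_def)
      show "inv\<^bsub>add_monoid HM\<^esub> x \<in> extension K"
        unfolding x(3) neg[OF x(1,2)] using subm_closed(5)[OF K x(1)] x(2) by (auto simp: extension_def)
      fix y assume "y \<in> extension K"
      then obtain n t where y: "n \<in> K" "t \<in> S" "y = fr n t" by (auto simp: extension_def)
      have "t \<odot>\<^bsub>M\<^esub> m \<oplus>\<^bsub>M\<^esub> s \<odot>\<^bsub>M\<^esub> n \<in> K"         using x y by (intro subm_closed(3)[OF K subm_closed(4)[OF K _ x(1)] subm_closed(4)[OF K _ y(1)]]) auto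
      then have "fr m s \<oplus>\<^bsub>Mp\<^esub> fr n t \<in> extension K"
        unfolding add_fr[OF Kc[OF x(1)] x(2) Kc[OF y(1)] y(2)] extension_def using S_mult[OF x(2) y(2)] by blast
      then show "x \<otimes>\<^bsub>add_monoid HM\<^esub> y \<in> extension K" unfolding x(3) y(3) by simp
    qed
    show "submodule_axioms (extension K) Rp HM"
    proof (rule submodule_axioms.intro)
      fix a x assume "a \<in> carrier Rp" "x \<in> extension K"
      then obtain b s m t where x: "b \<in> carrier R" "s \<in> S" "a = rf b s" "m \<in> K" "t \<in> S" "x = fr m t"
        by (auto simp: extension_def carrier_loc_ring)
      have "rf b s \<odot>\<^bsub>Mp\<^esub> fr m t \<in> extension K"
        unfolding smult_fr[OF x(1,2) Kc[OF x(4)] x(5)] extension_def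
        using S_mult[OF x(2,5)] subm_closed(4)[OF K x(1,4)] by blast
      then show "a \<odot>\<^bsub>HM\<^esub> x \<in> extension K" unfolding x by simp
    qed
  qed
qed

text \<open>An equation x/1 = m/s with m in K gives u s x = u m in K with u s outside \<pp>,
  contrary to x lying outside the saturation of K.\<close>

lemma extension_psubset:
  assumes K: "subm K" and K': "subm K'" and "K \<subseteq> K'" "\<not> K' \<subseteq> saturation \<pp> K"
  shows "extension K \<subset> extension K'"
proof -
  obtain x where x: "x \<in> K'" "x \<notin> saturation \<pp> K" using assms(4) by blast
  have xc: "x \<in> carrier M" using subm_closed(1)[OF K' x(1)] .
  have "fr x \<one> \<notin> extension K"
  proof
    assume "fr x \<one> \<in> extension K"
    then obtain m s where m: "m \<in> K" "s \<in> S" "fr x \<one> = fr m s" by (auto simp: extension_def)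
    have mc: "m \<in> carrier M" using subm_closed(1)[OF K m(1)] .
    obtain u where u: "u \<in> S" "u \<odot>\<^bsub>M\<^esub> (s \<odot>\<^bsub>M\<^esub> x) = u \<odot>\<^bsub>M\<^esub> (\<one> \<odot>\<^bsub>M\<^esub> m)"
      using m(3) fr_eq_iff[OF xc S_one mc m(2)] by blast
    have "(u \<otimes> s) \<odot>\<^bsub>M\<^esub> x = u \<odot>\<^bsub>M\<^esub> m" using u m(2) xc mc by (simp add: smult_assoc1)
    moreover have "u \<odot>\<^bsub>M\<^esub> m \<in> K" using subm_closed(4)[OF K u(1)[THEN S_carrier] m(1)] .
    ultimately have "(u \<otimes> s) \<odot>\<^bsub>M\<^esub> x \<in> K" by simp
    then show False using x(2) xc S_mult[OF u(1) m(2)] unfolding saturation_def by blast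
  qed
  moreover have "fr x \<one> \<in> extension K'" using x(1) S_one by (auto simp: extension_def)
  moreover have "extension K \<subseteq> extension K'" using assms(3) by (auto simp: extension_def)
  ultimately show ?thesis by blast
qed

text \<open>\<open>chain_at\<close> is recursive from the top, whereas \<open>module_length\<close>
  asks for an indexed sequence.\<close>

lemma chain_at_sequence:
  assumes "subm B" "chain_at \<qq> n A B"
  shows "\<exists>N. N n = B \<and> (\<forall>i\<le>n. subm (N i) \<and> N i \<subseteq> B) \<and> (\<forall>i<n. N i \<subseteq> N (Suc i) \<and> \<not> N (Suc i) \<subseteq> saturation \<qq> (N i))"
  using assms
proof (induction n arbitrary: B)
  case 0
  then show ?case by (intro exI[of _ "\<lambda>_. B"]) simp
next
  case (Suc n)
  then obtain C where C: "subm C" "chain_at \<qq> n A C" "C \<subseteq> B" "\<not> B \<subseteq> saturation \<qq> C" by auto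
  then obtain N where N: "N n = C" "\<forall>i\<le>n. subm (N i) \<and> N i \<subseteq> C" "\<forall>i<n. N i \<subseteq> N (Suc i) \<and> \<not> N (Suc i) \<subseteq> saturation \<qq> (N i)"
    using Suc.IH[OF C(1,2)] by (elim exE conjE)
  let ?N = "N(Suc n := B)"
  have "subm (?N i) \<and> ?N i \<subseteq> B" if "i \<le> Suc n" for i
  proof (cases "i = Suc n")
    case False
    then have "subm (N i) \<and> N i \<subseteq> C" using N(2) that by simp
    then show ?thesis using C(3) False by auto
  qed (use Suc(2) in simp)
  moreover have "?N i \<subseteq> ?N (Suc i) \<and> \<not> ?N (Suc i) \<subseteq> saturation \<qq> (?N i)" if "i < Suc n" for i
    using N(1,3) C(3,4) that by (cases "i = n") simp_all
  ultimately show ?case by (intro exI[of _ ?N]) simp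
qed

text \<open>Contraction turns a chain in H^0 into one counted at \<pp>, which bounds its length;
  extending a chain of maximal length attains the bound.\<close>

lemma module_length_local_cohomology: "module_length Rp HM = enat (mult_at \<pp> {\<zero>\<^bsub>M\<^esub>})"
proof -
  have "n \<le> mult_at \<pp> {\<zero>\<^bsub>M\<^esub>}"
    if N: "\<forall>i\<le>n. submodule (N i) Rp HM" "\<forall>i<n. N i \<subset> N (Suc i)" for n N
  proof -
    have "chain_at \<pp> i {\<zero>\<^bsub>M\<^esub>} (contraction (N i))" if "i \<le> n" for i
      using that
    proof (induction i)
      case 0
      then show ?case using subm_closed(2)[OF subm_contraction] N(1) by simp
    next
      case (Suc i)
      have sub: "submodule (N i) Rp HM" "submodule (N (Suc i)) Rp HM" using N(1) Suc(2) by auto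
      have "contraction (N i) \<subset> contraction (N (Suc i))" using contraction_psubset[OF sub] N(2) Suc(2) by simp
      \<comment> \<open>Contractions are saturated, so a strict inclusion between them is already
        strict at \<pp>.\<close>
      then have "contraction (N i) \<subseteq> contraction (N (Suc i))" "\<not> contraction (N (Suc i)) \<subseteq> saturation \<pp> (contraction (N i))"
        using saturation_contraction[OF sub(1)] by blast+
      then show ?case using Suc subm_contraction[OF sub(1)] by auto
    qed
    then have c: "chain_at \<pp> n {\<zero>\<^bsub>M\<^esub>} (contraction (N n))" by simp
    have "contraction (N n) \<subseteq> local_part \<pp> {\<zero>\<^bsub>M\<^esub>}"
      using submodule_HM_closed(1)[of "N n"] N(1) mem_H0_iff[OF _ S_one] by (auto simp: contraction_def)
    then have "chain_at \<pp> n {\<zero>\<^bsub>M\<^esub>} (local_part \<pp> {\<zero>\<^bsub>M\<^esub>})" using chain_at_mono[OF c] by blast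
    then show ?thesis using mult_at_geI[OF prime subm_zero] by blast
  qed
  moreover have "\<exists>N. (\<forall>i\<le>mult_at \<pp> {\<zero>\<^bsub>M\<^esub>}. submodule (N i) Rp HM) \<and> (\<forall>i<mult_at \<pp> {\<zero>\<^bsub>M\<^esub>}. N i \<subset> N (Suc i))"
  proof -
    have "chain_at \<pp> (mult_at \<pp> {\<zero>\<^bsub>M\<^esub>}) {\<zero>\<^bsub>M\<^esub>} (local_part \<pp> {\<zero>\<^bsub>M\<^esub>})"
      using has_length_at_mult_at[OF prime subm_zero] by (simp only: has_length_at_def)
    from chain_at_sequence[OF subm_local_part[OF subm_zero] this]
    obtain N where N: "\<forall>i\<le>mult_at \<pp> {\<zero>\<^bsub>M\<^esub>}. subm (N i) \<and> N i \<subseteq> local_part \<pp> {\<zero>\<^bsub>M\<^esub>}"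
      "\<forall>i<mult_at \<pp> {\<zero>\<^bsub>M\<^esub>}. N i \<subseteq> N (Suc i) \<and> \<not> N (Suc i) \<subseteq> saturation \<pp> (N i)"
      by (elim exE conjE)
    have "submodule (extension (N i)) Rp HM" if "i \<le> mult_at \<pp> {\<zero>\<^bsub>M\<^esub>}" for i
      using N(1) that by (intro submodule_extension) blast+
    moreover have "extension (N i) \<subset> extension (N (Suc i))" if "i < mult_at \<pp> {\<zero>\<^bsub>M\<^esub>}" for i
    proof (rule extension_psubset)
      show "subm (N i)" "subm (N (Suc i))" using N(1) that by simp_all
      show "N i \<subseteq> N (Suc i)" "\<not> N (Suc i) \<subseteq> saturation \<pp> (N i)" using N(2) that by blast+
    qed
    ultimately show ?thesis by (intro exI[of _ "\<lambda>i. extension (N i)"] conjI allI impI)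
  qed
  ultimately show ?thesis
    unfolding module_length_def
    by (intro antisym Sup_least Sup_upper CollectI exI[of _ "mult_at \<pp> {\<zero>\<^bsub>M\<^esub>}"] conjI refl) auto
qed

end

lemma (in noetherian_module) local_mult_eq_mult_at:
  assumes "primeideal \<pp> R"
  shows "local_mult R M \<pp> = mult_at \<pp> {\<zero>\<^bsub>M\<^esub>}"
proof -
  have "noetherian_module_at_prime R M \<pp>"
    by (intro noetherian_module_at_prime.intro noetherian_module_at_prime_axioms.intro noetherian_module_axioms assms)
  from noetherian_module_at_prime.module_length_local_cohomology[OF this]
  show ?thesis unfolding local_mult_def by (simp only: the_enat.simps)
qed

theorem mainTheorem1:
  fixes R :: "('r, 'x) ring_scheme" and M :: "('r, 'm, 'y) module_scheme"
  assumes "cring R" and "noetherian_ring R" and "krull_dim R < \<infinity>"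
    and "module R M" and "fin_gen_module R M"
  shows "ordinal_length R M =
           shuffle_sum (\<lambda>\<pp>. ncopies (local_mult R M \<pp>) (omega_pow (the_enat (krull_dim (R Quot \<pp>)))))
             (Spec R) \<and>
         finite (Ass R M) \<and>
         (\<forall>\<pp> \<in> Spec R.
           ncopies (local_mult R M \<pp>) (omega_pow (the_enat (krull_dim (R Quot \<pp>)))) \<noteq>
             (0 :: 'm set ordinal) \<longrightarrow> \<pp> \<in> Ass R M)"
proof -
  interpret finite_dim_noetherian_module R M
    using assms by (intro finite_dim_noetherian_module.intro noetherian_module.intro
      noetherian_module_axioms.intro finite_dim_noetherian_module_axioms.intro)
  let ?Z = "{\<zero>\<^bsub>M\<^esub>}"
  have Ass: "Ass R M = Ass_quot ?Z" by (auto simp: Ass_def Ass_quot_def Spec_def colon_def)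
  have mult: "local_mult R M \<pp> = mult_at \<pp> ?Z" if "\<pp> \<in> Spec R" for \<pp>
    using that local_mult_eq_mult_at by (simp add: Spec_def)
  \<comment> \<open>At the zero submodule M/N is M, and the rank formula supplies an ordinal whose
    coefficients are those of the shuffle sum.\<close>
  have "shuffle_sum (\<lambda>\<pp>. ncopies (local_mult R M \<pp>) (omega_pow (the_enat (krull_dim (R Quot \<pp>))))) (Spec R)
    = (cnf_eval (mult_of_dim ?Z) (the_enat (krull_dim R)) :: 'm set ordinal)"
  proof (rule shuffle_sum_monomials)
    show "mult_of_dim ?Z n = (\<Sum>\<pp> | \<pp> \<in> Spec R \<and> the_enat (krull_dim (R Quot \<pp>)) = n \<and> local_mult R M \<pp> \<noteq> 0. local_mult R M \<pp>)" for n
      unfolding mult_of_dim_def coheight_def[symmetric]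
      by (rule sum.cong) (auto simp: local_mult_eq_mult_at Spec_def)
    have "{\<pp> \<in> Spec R. local_mult R M \<pp> \<noteq> 0} = {\<pp>. prm \<pp> \<and> mult_at \<pp> ?Z \<noteq> 0}" using mult by (auto simp: Spec_def)
    then show "finite {\<pp> \<in> Spec R. local_mult R M \<pp> \<noteq> 0}" using finite_mult_at_support[OF subm_zero] by simp
  qed (rule is_cnf_mult_of_dim)
  then have "ordinal_length R M =
    shuffle_sum (\<lambda>\<pp>. ncopies (local_mult R M \<pp>) (omega_pow (the_enat (krull_dim (R Quot \<pp>))))) (Spec R)"
    unfolding ordinal_length_def height_rank_eq_cnf[OF subm_zero] by simp
  moreover have "finite (Ass R M)" unfolding Ass by (rule finite_Ass_quot[OF subm_zero])
  moreover have "\<pp> \<in> Ass R M" if "\<pp> \<in> Spec R" "local_mult R M \<pp> \<noteq> 0" for \<pp>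
    unfolding Ass using that mult mult_at_nonzero_Ass_quot[OF _ subm_zero] by (simp add: Spec_def)
  ultimately show ?thesis by (simp add: ncopies_omega_pow_eq_0_iff)
qed

end
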